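(* Let $f\in L^2(\Omega)$. Let $u^{\varepsilon}\in V=H^1_0(\Omega)$ be the solution of $a(u^{\varepsilon},v)=(f,v)$ for all $v\in V$, and let $u_h^{ms}\in V_h^{ms}$ be the solution of $a(u_h^{ms},v)=(f,v)$ for all $v\in V_h^{ms}$. Then $$\|u^{\varepsilon}-u_h^{ms}\|_{V}\leq C\, h\, \|f\|_{L^2(\Omega)},$$ where the positive constant $C$ does not depend on the mesh size $h$.
   Context: $\Omega\subset\mathbb{R}^2$ is a bounded convex polygonal domain with Lipschitz boundary. $A^{\varepsilon}(x)=(A^{\varepsilon}_{ij}(x))$ is a symmetric, bounded (measurable) matrix-valued function on $\Omega$ satisfying $\alpha|\xi|^2\le \sum_{i,j}A^{\varepsilon}_{ij}(x)\xi_i\xi_j\le\beta|\xi|^2$ for all $\xi\in\mathbb{R}^2$, with constants $\alpha,\beta>0$. $V=H^1_0(\Omega)$ with $\|\cdot\|_V$ the $H^1(\Omega)$-norm, $a(u,v)=\int_\Omega A^{\varepsilon}\nabla u\cdot\nabla v\,dx$, and $(f,v)=\int_\Omega fv\,dx$. $\mathcal{T}_h$ is a standard regular (conforming, shape-regular) triangulation of $\Omega$, $h_K=\mathrm{diam}(K)$ for $K\in\mathcal{T}_h$, $h=\max_{K\in\mathcal{T}_h}h_K$, and $\mathcal{N}$ is the set of interior nodal points (vertices). "Independent of $h$" means the same constant works for all triangulations of the regular family. $V_h=\{u_h\in H^1_0(\Omega): u_h|_K\in P_1(K)\ \forall K\in\mathcal{T}_h\}$, where $P_1(K)$ is the space of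 polynomials of total degree at most one on $K$. For $a\in\mathcal{N}$, $\lambda_a\in V_h$ is the nodal basis function equal to $1$ at $a$ and $0$ at all other vertices. The interpolation $\mathcal{J}_h:V\to V_h$ is $\mathcal{J}_hv=\sum_{a\in\mathcal{N}}\tilde v(a)\lambda_a$ with $$\tilde v(a)=\frac{\int_\Omega v\lambda_a\,dx+h^2\sum_{K\in\mathcal{T}_h}\int_K\nabla v\cdot\nabla\lambda_a\,dx}{\int_\Omega\lambda_a\,dx+h^2\sum_{K\in\mathcal{T}_h}\int_K|\nabla\lambda_a|\,dx}.$$ Its kernel is $V^f=\{v\in V:\mathcal{J}_hv=0\}$. For $a\in\mathcal{N}$, the fine-scale corrector $\phi_a\in V^f$ is defined by $a(\phi_a,w)=a(\lambda_a,w)$ for all $w\in V^f$ (here $a(\cdot,\cdot)$ is the bilinear form and the subscript $a$ is the node). The modified coarse space is $V_h^{ms}=\mathrm{span}\{\lambda_a-\phi_a: a\in\mathcal{N}\}$. *)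

theory Defs
  imports "HOL-Analysis.Analysis"
begin

section \<open>The spaces L2, H1 and H10 on a plane domain\<close>

text \<open>
  Functions on a domain are represented by total functions on the plane; values outside the domain
  are irrelevant. All integrals are Lebesgue integrals over the completed measure.
\<close>

definition L2 :: "(real^2) set \<Rightarrow> (real^2 \<Rightarrow> 'b::euclidean_space) set" where
  "L2 \<Omega> = {g. g \<in> borel_measurable (lebesgue_on \<Omega>) \<and>
              integrable (lebesgue_on \<Omega>) (\<lambda>x. (norm (g x))\<^sup>2)}"

definition L2_norm :: "(real^2) set \<Rightarrow> (real^2 \<Rightarrow> 'b::euclidean_space) \<Rightarrow> real" where
  "L2_norm \<Omega> g = sqrt (LINT x|lebesgue_on \<Omega>. (norm (g x))\<^sup>2)"

definition L2_inner :: "(real^2) set \<Rightarrow> (real^2 \<Rightarrow> real) \<Rightarrow> (real^2 \<Rightarrow> real) \<Rightarrow> real" where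
  "L2_inner \<Omega> f v = (LINT x|lebesgue_on \<Omega>. f x * v x)"

definition partial_deriv :: "2 \<Rightarrow> (real^2 \<Rightarrow> real) \<Rightarrow> real^2 \<Rightarrow> real" where
  "partial_deriv i \<phi> x = frechet_derivative \<phi> (at x) (axis i 1)"

primrec Ck :: "nat \<Rightarrow> (real^2 \<Rightarrow> real) \<Rightarrow> bool" where
  "Ck 0 \<phi> \<longleftrightarrow> continuous_on UNIV \<phi>"
| "Ck (Suc k) \<phi> \<longleftrightarrow> (\<forall>x. \<phi> differentiable (at x)) \<and> (\<forall>i. Ck k (partial_deriv i \<phi>))"

definition test_functions :: "(real^2) set \<Rightarrow> (real^2 \<Rightarrow> real) set" where
  "test_functions \<Omega> =
     {\<phi>. (\<forall>k. Ck k \<phi>) \<and> compact (closure {x. \<phi> x \<noteq> 0}) \<and> closure {x. \<phi> x \<noteq> 0} \<subseteq> \<Omega>}"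

definition is_weak_gradient ::
    "(real^2) set \<Rightarrow> (real^2 \<Rightarrow> real) \<Rightarrow> (real^2 \<Rightarrow> real^2) \<Rightarrow> bool" where
  "is_weak_gradient \<Omega> u g \<longleftrightarrow>
     g \<in> L2 \<Omega> \<and>
     (\<forall>\<phi>\<in>test_functions \<Omega>. \<forall>i.
        (LINT x|lebesgue_on \<Omega>. u x * partial_deriv i \<phi> x)
          = - (LINT x|lebesgue_on \<Omega>. g x $ i * \<phi> x))"

definition H1 :: "(real^2) set \<Rightarrow> (real^2 \<Rightarrow> real) set" where
  "H1 \<Omega> = {u \<in> L2 \<Omega>. \<exists>g. is_weak_gradient \<Omega> u g}"

text \<open>
  A weak gradient is unique up to a null set, so the choice below does not affect any integral.
\<close>

definition wgrad :: "(real^2) set \<Rightarrow> (real^2 \<Rightarrow> real) \<Rightarrow> real^2 \<Rightarrow> real^2" where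
  "wgrad \<Omega> u = (SOME g. is_weak_gradient \<Omega> u g)"

definition H1_norm :: "(real^2) set \<Rightarrow> (real^2 \<Rightarrow> real) \<Rightarrow> real" where
  "H1_norm \<Omega> u = sqrt ((L2_norm \<Omega> u)\<^sup>2 + (L2_norm \<Omega> (wgrad \<Omega> u))\<^sup>2)"

definition H10 :: "(real^2) set \<Rightarrow> (real^2 \<Rightarrow> real) set" where
  "H10 \<Omega> = {u \<in> H1 \<Omega>. \<forall>e>0. \<exists>\<phi>\<in>test_functions \<Omega>. H1_norm \<Omega> (\<lambda>x. u x - \<phi> x) < e}"


section \<open>Domain, coefficient and bilinear form\<close>

text \<open>A bounded convex open set automatically has a Lipschitz boundary.\<close>

definition convex_polygonal_domain :: "(real^2) set \<Rightarrow> bool" where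
  "convex_polygonal_domain \<Omega> \<longleftrightarrow>
     open \<Omega> \<and> \<Omega> \<noteq> {} \<and> bounded \<Omega> \<and> convex \<Omega> \<and> polytope (closure \<Omega>)"

definition elliptic_coefficient ::
    "(real^2) set \<Rightarrow> real \<Rightarrow> real \<Rightarrow> (real^2 \<Rightarrow> real^2^2) \<Rightarrow> bool" where
  "elliptic_coefficient \<Omega> \<alpha> \<beta> A \<longleftrightarrow>
     A \<in> borel_measurable (lebesgue_on \<Omega>) \<and> bounded (A ` \<Omega>) \<and>
     (\<forall>x\<in>\<Omega>. \<forall>i j. A x $ i $ j = A x $ j $ i) \<and>
     (\<forall>x\<in>\<Omega>. \<forall>\<xi>. \<alpha> * (norm \<xi>)\<^sup>2 \<le> (\<Sum>i\<in>UNIV. \<Sum>j\<in>UNIV. A x $ i $ j * \<xi> $ i * \<xi> $ j) \<and>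
                (\<Sum>i\<in>UNIV. \<Sum>j\<in>UNIV. A x $ i $ j * \<xi> $ i * \<xi> $ j) \<le> \<beta> * (norm \<xi>)\<^sup>2)"

definition bilin ::
    "(real^2) set \<Rightarrow> (real^2 \<Rightarrow> real^2^2) \<Rightarrow> (real^2 \<Rightarrow> real) \<Rightarrow> (real^2 \<Rightarrow> real) \<Rightarrow> real" where
  "bilin \<Omega> A u v = (LINT x|lebesgue_on \<Omega>. (A x *v wgrad \<Omega> u x) \<bullet> wgrad \<Omega> v x)"


section \<open>Regular families of triangulations\<close>

text \<open>
  A mesh is the set of its closed, nondegenerate triangles. The library notion
  \<^const>\<open>triangulation\<close> contains the conformity condition: any two cells meet in a common face,
  where the empty set also counts as a face.
\<close>

definition triangulation_of :: "(real^2) set \<Rightarrow> (real^2) set set \<Rightarrow> bool" where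
  "triangulation_of \<Omega> T \<longleftrightarrow> triangulation T \<and> (\<forall>K\<in>T. 2 simplex K) \<and> \<Union>T = closure \<Omega>"

definition mesh_size :: "(real^2) set set \<Rightarrow> real" where
  "mesh_size T = Max (diameter ` T)"

definition ball_diameter :: "(real^2) set \<Rightarrow> real" where
  "ball_diameter K = Sup {2 * r | r. 0 \<le> r \<and> (\<exists>c. cball c r \<subseteq> K)}"

definition regular_family :: "(real^2) set \<Rightarrow> (real^2) set set set \<Rightarrow> bool" where
  "regular_family \<Omega> \<F> \<longleftrightarrow>
     (\<forall>T\<in>\<F>. triangulation_of \<Omega> T) \<and>
     (\<exists>\<sigma>. \<forall>T\<in>\<F>. \<forall>K\<in>T. diameter K \<le> \<sigma> * ball_diameter K)"

definition mesh_vertices :: "(real^2) set set \<Rightarrow> (real^2) set" where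
  "mesh_vertices T = {a. \<exists>K\<in>T. a extreme_point_of K}"

definition interior_nodes :: "(real^2) set \<Rightarrow> (real^2) set set \<Rightarrow> (real^2) set" where
  "interior_nodes \<Omega> T = mesh_vertices T \<inter> \<Omega>"


section \<open>Coarse space, interpolation and modified coarse space\<close>

text \<open>
  Coarse functions are represented by the pointwise affine (hence continuous) member of their
  class. A nodal basis function is thereby unique on the closure of the domain.
\<close>

definition Vh :: "(real^2) set \<Rightarrow> (real^2) set set \<Rightarrow> (real^2 \<Rightarrow> real) set" where
  "Vh \<Omega> T = {u \<in> H10 \<Omega>. \<forall>K\<in>T. \<exists>c b. \<forall>x\<in>K. u x = c + b \<bullet> x}"

definition nodal_basis :: "(real^2) set \<Rightarrow> (real^2) set set \<Rightarrow> real^2 \<Rightarrow> real^2 \<Rightarrow> real" where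
  "nodal_basis \<Omega> T a =
     (SOME l. l \<in> Vh \<Omega> T \<and> l a = 1 \<and> (\<forall>b\<in>mesh_vertices T - {a}. l b = 0))"

definition node_value ::
    "(real^2) set \<Rightarrow> (real^2) set set \<Rightarrow> (real^2 \<Rightarrow> real) \<Rightarrow> real^2 \<Rightarrow> real" where
  "node_value \<Omega> T v a =
     ((LINT x|lebesgue_on \<Omega>. v x * nodal_basis \<Omega> T a x)
        + (mesh_size T)\<^sup>2 *
          (\<Sum>K\<in>T. LINT x|lebesgue_on K. wgrad \<Omega> v x \<bullet> wgrad \<Omega> (nodal_basis \<Omega> T a) x))
     / ((LINT x|lebesgue_on \<Omega>. nodal_basis \<Omega> T a x)
        + (mesh_size T)\<^sup>2 *
          (\<Sum>K\<in>T. LINT x|lebesgue_on K. norm (wgrad \<Omega> (nodal_basis \<Omega> T a) x)))"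

definition interp ::
    "(real^2) set \<Rightarrow> (real^2) set set \<Rightarrow> (real^2 \<Rightarrow> real) \<Rightarrow> real^2 \<Rightarrow> real" where
  "interp \<Omega> T v x = (\<Sum>a\<in>interior_nodes \<Omega> T. node_value \<Omega> T v a * nodal_basis \<Omega> T a x)"

definition Vf :: "(real^2) set \<Rightarrow> (real^2) set set \<Rightarrow> (real^2 \<Rightarrow> real) set" where
  "Vf \<Omega> T = {v \<in> H10 \<Omega>. \<forall>x\<in>\<Omega>. interp \<Omega> T v x = 0}"

definition is_corrector ::
    "(real^2) set \<Rightarrow> (real^2 \<Rightarrow> real^2^2) \<Rightarrow> (real^2) set set \<Rightarrow> real^2 \<Rightarrow> (real^2 \<Rightarrow> real) \<Rightarrow> bool" where
  "is_corrector \<Omega> A T a p \<longleftrightarrow>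
     p \<in> Vf \<Omega> T \<and> (\<forall>w\<in>Vf \<Omega> T. bilin \<Omega> A p w = bilin \<Omega> A (nodal_basis \<Omega> T a) w)"

text \<open>
  The linear span of the finitely many functions \<open>\<lambda>\<^sub>a - \<phi>\<^sub>a\<close>, written out because real-valued
  functions do not form an instance of the class of real vector spaces.
\<close>

definition Vms ::
    "(real^2) set \<Rightarrow> (real^2) set set \<Rightarrow> (real^2 \<Rightarrow> real^2 \<Rightarrow> real) \<Rightarrow> (real^2 \<Rightarrow> real) set" where
  "Vms \<Omega> T \<phi> =
     {\<lambda>x. \<Sum>a\<in>interior_nodes \<Omega> T. c a * (nodal_basis \<Omega> T a x - \<phi> a x) | c. True}"

definition galerkin_solution ::
    "(real^2) set \<Rightarrow> (real^2 \<Rightarrow> real^2^2) \<Rightarrow> (real^2 \<Rightarrow> real) set \<Rightarrow> (real^2 \<Rightarrow> real)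
      \<Rightarrow> (real^2 \<Rightarrow> real) \<Rightarrow> bool" where
  "galerkin_solution \<Omega> A W f u \<longleftrightarrow> u \<in> W \<and> (\<forall>v\<in>W. bilin \<Omega> A u v = L2_inner \<Omega> f v)"

end

theory Submission
  imports Defs
begin

text \<open>
  Consider the product \<open>(v, w)\<^sub>h = (v, w) + h\<^sup>2 (\<nabla>v, \<nabla>w)\<close>. The numerator of the nodal value of
  \<open>v\<close> at \<open>a\<close> is \<open>(v, \<lambda>\<^sub>a)\<^sub>h\<close> and the denominator is positive, so the kernel \<open>V\<^sup>f\<close> of the
  interpolation is exactly the orthogonal complement of the coarse space for this product
  (\<open>Vf_iff\<close>). The proof rests on this observation.

  First, the error \<open>e = u - u\<^sub>m\<^sub>s\<close> lies in \<open>V\<^sup>f\<close> (\<open>galerkin_error_in_Vf\<close>). Orthogonal projection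
  writes \<open>u\<close> as a coarse function plus an element of \<open>V\<^sup>f\<close>; replacing each hat function
  \<open>\<lambda>\<^sub>a\<close> by \<open>\<lambda>\<^sub>a - \<phi>\<^sub>a\<close> changes only the second part. Since the modified coarse space is orthogonal to
  \<open>V\<^sup>f\<close> in the energy product, the modified coarse part of \<open>u\<close> has the Galerkin property. It
  therefore differs from \<open>u\<^sub>m\<^sub>s\<close> by a function of zero energy, which vanishes by the inequality of
  Poincare. The same orthogonality gives \<open>a(e, e) = (f, e)\<close>.

  Secondly, functions of \<open>V\<^sup>f\<close> satisfy \<open>\<parallel>e\<parallel> \<le> C h \<parallel>\<nabla>e\<parallel>\<close> (\<open>Vf_L2_bound\<close>). By orthogonality the
  norm of \<open>e\<close> for the product \<open>(\<cdot>, \<cdot>)\<^sub>h\<close> is at most that of \<open>e - v\<close> for every coarse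
  \<open>v\<close>, so it is enough to find one \<open>v\<close> with \<open>\<parallel>e - v\<parallel> \<le> C h \<parallel>\<nabla>e\<parallel>\<close> and
  \<open>\<parallel>\<nabla>v\<parallel> \<le> C \<parallel>\<nabla>e\<parallel>\<close> (\<open>quasi_interpolation\<close>). By density it suffices to treat a test function
  near \<open>e\<close>.
  The nodal values of \<open>v\<close> are averages over balls of radius proportional to \<open>h\<close>, but of the
  function stretched by the factor \<open>1 + h\<close> about an interior point. As the domain is convex, the
  stretching moves the boundary out of reach of the balls, so \<open>v\<close> vanishes there. All balls have the
  same radius, whatever the size of the adjacent cells, and pointwise bounds by the energy in a
  ball of radius proportional to \<open>h\<close> can be integrated by Fubini's theorem. Shape
  regularity enters when the oscillation of an affine function on a triangle is turned into a
  bound for its gradient.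

  The first half of the text provides the Sobolev space theory that this requires: smooth
  mollifiers, uniqueness of weak gradients, and the fact that continuous piecewise affine functions
  vanishing on the boundary belong to \<open>H\<^sup>1\<^sub>0\<close> (\<open>pw_affine_interpolant\<close>).
\<close>

section \<open>Smooth functions\<close>

lemma partial_deriv_eq:
  assumes "(\<phi> has_derivative D) (at x)"
  shows "partial_deriv i \<phi> x = D (axis i 1)"
  using frechet_derivative_at[OF assms] by (simp add: partial_deriv_def)

definition grad :: "(real^2 \<Rightarrow> real) \<Rightarrow> real^2 \<Rightarrow> real^2" where
  "grad \<phi> x = (\<chi> i. partial_deriv i \<phi> x)"

lemma grad_nth [simp]: "grad \<phi> x $ i = partial_deriv i \<phi> x"
  by (simp add: grad_def)

lemma has_derivative_grad:
  assumes "\<phi> differentiable (at x)"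
  shows "(\<phi> has_derivative (\<lambda>v. grad \<phi> x \<bullet> v)) (at x)"
proof -
  have d: "(\<phi> has_derivative frechet_derivative \<phi> (at x)) (at x)"
    using assms by (simp add: frechet_derivative_works)
  then have lin: "linear (frechet_derivative \<phi> (at x))"
    using has_derivative_linear by blast
  have "frechet_derivative \<phi> (at x) v = grad \<phi> x \<bullet> v" for v
  proof -
    have "frechet_derivative \<phi> (at x) v = frechet_derivative \<phi> (at x) (\<Sum>i\<in>UNIV. v $ i *\<^sub>R axis i 1)"
      using basis_expansion[of v] by (simp add: scalar_mult_eq_scaleR)
    also have "\<dots> = (\<Sum>i\<in>UNIV. v $ i * partial_deriv i \<phi> x)"
      by (simp add: linear_sum[OF lin] linear_cmul[OF lin] partial_deriv_def)
    finally show ?thesis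
      by (simp add: inner_vec_def mult.commute)
  qed
  then have "frechet_derivative \<phi> (at x) = (\<lambda>v. grad \<phi> x \<bullet> v)"
    by (rule ext)
  with d show ?thesis by simp
qed

lemma Ck_continuous: "Ck k \<phi> \<Longrightarrow> continuous_on UNIV \<phi>"
  by (cases k) (auto simp: continuous_on_eq_continuous_at differentiable_imp_continuous_within)

lemma Ck_Suc_imp: "Ck (Suc k) \<phi> \<Longrightarrow> Ck k \<phi>"
  by (induction k arbitrary: \<phi>) (auto dest: Ck_continuous simp: continuous_on_eq_continuous_at differentiable_imp_continuous_within)

lemma Ck_1_iff:
  "Ck 1 \<phi> \<longleftrightarrow> (\<forall>x. \<phi> differentiable (at x)) \<and> continuous_on UNIV (grad \<phi>)"
proof -
  have "continuous_on UNIV (grad \<phi>) \<longleftrightarrow> (\<forall>i. continuous_on UNIV (partial_deriv i \<phi>))"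
  proof
    assume "continuous_on UNIV (grad \<phi>)"
    then have "continuous_on UNIV (\<lambda>x. grad \<phi> x $ i)" for i
      by (intro continuous_intros)
    then show "\<forall>i. continuous_on UNIV (partial_deriv i \<phi>)"
      by simp
  next
    assume *: "\<forall>i. continuous_on UNIV (partial_deriv i \<phi>)"
    show "continuous_on UNIV (grad \<phi>)"
      unfolding grad_def [abs_def] by (intro continuous_on_vec_lambda) (use * in auto)
  qed
  then show ?thesis by simp
qed

lemma Ck_const: "Ck k (\<lambda>x. c)"
proof (induction k arbitrary: c)
  case (Suc k)
  have "partial_deriv i (\<lambda>x. c) = (\<lambda>x. 0)" for i
    by (rule ext, subst partial_deriv_eq[where D="\<lambda>x. 0"]) auto
  then show ?case using Suc by auto
qed simp

lemma Ck_add: "Ck k f \<Longrightarrow> Ck k g \<Longrightarrow> Ck k (\<lambda>x. f x + g x)"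
proof (induction k arbitrary: f g)
  case 0
  then show ?case by (auto intro: continuous_intros)
next
  case (Suc k)
  have "partial_deriv i (\<lambda>x. f x + g x) = (\<lambda>x. partial_deriv i f x + partial_deriv i g x)" for i
  proof (rule ext, subst partial_deriv_eq)
    show "((\<lambda>x. f x + g x) has_derivative (\<lambda>v. grad f x \<bullet> v + grad g x \<bullet> v)) (at x)" for x
      using Suc.prems by (intro has_derivative_add has_derivative_grad) auto
  qed (simp add: inner_axis)
  then show ?case using Suc by (auto intro: differentiable_add)
qed

lemma Ck_mult: "Ck k f \<Longrightarrow> Ck k g \<Longrightarrow> Ck k (\<lambda>x. f x * g x)"
proof (induction k arbitrary: f g)
  case 0
  then show ?case by (auto intro: continuous_intros)
next
  case (Suc k)
  have *: "partial_deriv i (\<lambda>x. f x * g x) = (\<lambda>x. f x * partial_deriv i g x + partial_deriv i f x * g x)" for i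
  proof (rule ext, subst partial_deriv_eq)
    show "((\<lambda>x. f x * g x) has_derivative (\<lambda>v. f x * (grad g x \<bullet> v) + (grad f x \<bullet> v) * g x)) (at x)" for x
      using Suc.prems by (intro has_derivative_mult has_derivative_grad) auto
  qed (simp add: inner_axis)
  have "Ck k (\<lambda>x. f x * partial_deriv i g x + partial_deriv i f x * g x)" for i
    using Suc.prems Ck_Suc_imp[OF Suc.prems(1)] Ck_Suc_imp[OF Suc.prems(2)]
    by (intro Ck_add Suc.IH) auto
  then show ?case using Suc.prems by (auto simp: * intro: differentiable_mult)
qed

lemma tendsto_poly_div_exp: "((\<lambda>x. poly p x / exp x) \<longlongrightarrow> (0::real)) at_top"
proof -
  have "((\<lambda>x. \<Sum>i\<le>degree p. coeff p i * (x ^ i / exp x)) \<longlongrightarrow> (\<Sum>i\<le>degree p. coeff p i * 0)) at_top"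
    by (intro tendsto_intros tendsto_power_div_exp_0)
  then show ?thesis
    by (simp add: poly_altdef sum_divide_distrib)
qed

text \<open>
  The derivatives of \<open>exp (- 1 / t)\<close> for \<open>t > 0\<close> are \<open>P\<^sub>n (1 / t) exp (- 1 / t)\<close> with the
  polynomials below; extended by zero they form a tower of derivatives on the whole line.
\<close>

primrec flat_poly :: "nat \<Rightarrow> real poly" where
  "flat_poly 0 = 1"
| "flat_poly (Suc n) = monom 1 2 * (flat_poly n - pderiv (flat_poly n))"

definition flat :: "nat \<Rightarrow> real \<Rightarrow> real" where
  "flat n t = (if t > 0 then poly (flat_poly n) (1 / t) * exp (- (1 / t)) else 0)"

lemma flat_has_derivative: "(flat n has_real_derivative flat (Suc n) t) (at t)"
proof -
  consider "t < 0" | "t = 0" | "t > 0" by linarith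
  then show ?thesis
  proof cases
    case 1
    have "((\<lambda>t. 0) has_real_derivative 0) (at t)" by simp
    then have "(flat n has_real_derivative 0) (at t)"
      by (rule has_field_derivative_transform_within_open[where S="{..<0}"])
        (use 1 in \<open>auto simp: flat_def\<close>)
    then show ?thesis using 1 by (simp add: flat_def)
  next
    case 3
    have "((\<lambda>t. poly (flat_poly n) (1 / t) * exp (- (1 / t))) has_real_derivative
       poly (flat_poly (Suc n)) (1 / t) * exp (- (1 / t))) (at t)"
      using 3 by (auto intro!: derivative_eq_intros simp: poly_monom power2_eq_square field_simps)
    then have "(flat n has_real_derivative poly (flat_poly (Suc n)) (1 / t) * exp (- (1 / t))) (at t)"
      by (rule has_field_derivative_transform_within_open[where S="{0<..}"])
        (use 3 in \<open>auto simp: flat_def\<close>)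
    then show ?thesis using 3 by (simp add: flat_def)
  next
    case 2
    have "((\<lambda>s. poly (flat_poly n * monom 1 1) s / exp s) \<longlongrightarrow> (0::real)) at_top"
      by (rule tendsto_poly_div_exp)
    then have "((\<lambda>y. poly (flat_poly n * monom 1 1) (inverse y) / exp (inverse y)) \<longlongrightarrow> (0::real)) (at_right 0)"
      by (rule filterlim_compose[OF _ filterlim_inverse_at_top_right])
    then have r: "((\<lambda>y. (flat n y - flat n 0) / (y - 0)) \<longlongrightarrow> 0) (at_right 0)"
      by (rule Lim_transform_eventually)
        (auto simp: eventually_at_filter flat_def poly_monom exp_minus field_simps)
    have l: "((\<lambda>y. (flat n y - flat n 0) / (y - 0)) \<longlongrightarrow> 0) (at_left 0)"
      by (rule Lim_transform_eventually[OF tendsto_const])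
        (auto simp: eventually_at_filter flat_def)
    from filterlim_split_at[OF l r] show ?thesis
      using 2 by (simp add: has_field_derivative_iff flat_def)
  qed
qed

lemma Ck_flat_affine: "Ck k (\<lambda>x. flat n (c + s * x $ i))"
proof (induction k arbitrary: n)
  have der: "((\<lambda>x. flat n (c + s * x $ i)) has_derivative (\<lambda>v. flat (Suc n) (c + s * x $ i) * (s * v $ i))) (at x)" for x :: "real^2" and n
  proof -
    have "((\<lambda>x. x $ i) has_derivative (\<lambda>v. v $ i)) (at x)"
      by (rule bounded_linear_imp_has_derivative[OF bounded_linear_vec_nth])
    then have "((\<lambda>x. c + s * x $ i) has_derivative (\<lambda>v. s * v $ i)) (at x)"
      by (auto intro!: derivative_eq_intros)
    from has_derivative_compose[OF this flat_has_derivative[unfolded has_field_derivative_def]]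
    show ?thesis by simp
  qed
  {
    case 0
    show ?case
      by (auto simp: continuous_on_eq_continuous_at intro: has_derivative_continuous[OF der])
  next
    case (Suc k)
    have "partial_deriv j (\<lambda>x. flat n (c + s * x $ i)) = (\<lambda>x. (s * axis j 1 $ i) * flat (Suc n) (c + s * x $ i))" for j
      by (rule ext, subst partial_deriv_eq[OF der]) simp
    then show ?case
      using der Suc by (auto simp: differentiable_def intro!: Ck_mult Ck_const)
  }
qed

lemma lborel_positive_integral:
  fixes f :: "real^2 \<Rightarrow> real"
  assumes "integrable lborel f" "\<And>x. f x \<ge> 0" "continuous_on UNIV f" "f a > 0"
  shows "(LINT x|lborel. f x) > 0"
proof -
  have "(LINT x|lborel. f x) \<noteq> 0"
  proof
    assume "(LINT x|lborel. f x) = 0"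
    then have "AE x in lborel. f x = 0"
      using integral_nonneg_eq_0_iff_AE[OF assms(1)] assms(2) by auto
    then have ae: "AE x in lebesgue. f x = 0"
      by (rule AE_completion)
    have "open {x. f x > 0}"
      using assms(3) by (intro open_Collect_less) auto
    then have "\<not> negligible {x. f x > 0}"
      using open_not_negligible assms(4) by blast
    moreover have "negligible {x. f x > 0}"
    proof -
      obtain N where N: "N \<in> null_sets lebesgue" "{x. f x \<noteq> 0} \<subseteq> N"
        using ae unfolding eventually_ae_filter by auto
      then have "{x. f x > 0} \<subseteq> N" by auto
      with N show ?thesis
        unfolding negligible_iff_null_sets by (blast intro: null_sets_completion_subset)
    qed
    ultimately show False by simp
  qed
  moreover have "(LINT x|lborel. f x) \<ge> 0"
    using assms(2) by simp
  ultimately show ?thesis by linarith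
qed

lemma integrable_lborel_compact_support:
  fixes f :: "'a::euclidean_space \<Rightarrow> 'b::euclidean_space"
  assumes "continuous_on UNIV f" "compact S" "\<And>x. x \<notin> S \<Longrightarrow> f x = 0"
  shows "integrable lborel f"
proof -
  have "integrable lborel (\<lambda>x. indicator S x *\<^sub>R f x)"
    using borel_integrable_compact[OF assms(2)] continuous_on_subset[OF assms(1)] by auto
  moreover have "(\<lambda>x. indicator S x *\<^sub>R f x) = f"
    using assms(3) by (auto simp: indicator_def fun_eq_iff)
  ultimately show ?thesis by simp
qed

text \<open>Friedrichs mollifiers: the product of two flat functions, one for each end of an interval,
  is a smooth bump in one variable, and the product over the two coordinates is one in the plane.\<close>

lemma mollifier_exists:
  assumes "e > 0"
  obtains \<rho> :: "real^2 \<Rightarrow> real"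
  where "\<And>k. Ck k \<rho>" "\<And>x. \<rho> x \<ge> 0" "\<And>x. norm x > e \<Longrightarrow> \<rho> x = 0"
    "integrable lborel \<rho>" "(LINT x|lborel. \<rho> x) = 1"
proof -
  define b where "b i x = flat 0 (1 + 2 / e * x $ i) * flat 0 (1 + (- 2 / e) * x $ i)" for i :: 2 and x :: "real^2"
  define B where "B x = b 1 x * b 2 x" for x
  have CkB: "Ck k B" for k
    unfolding B_def[abs_def] b_def[abs_def] by (intro Ck_mult Ck_flat_affine)
  have flat_nonneg: "flat 0 t \<ge> 0" for t
    by (simp add: flat_def)
  have B_nonneg: "B x \<ge> 0" for x
    unfolding B_def b_def by (intro mult_nonneg_nonneg flat_nonneg)
  have b0: "b i x = 0" if "\<bar>x $ i\<bar> \<ge> e / 2" for i x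
  proof -
    from that have "x $ i \<ge> e / 2 \<or> x $ i \<le> - e / 2" by auto
    then have "1 + 2 / e * x $ i \<le> 0 \<or> 1 + (- 2 / e) * x $ i \<le> 0"
      using assms by (auto simp: field_simps)
    then show ?thesis by (auto simp: b_def flat_def)
  qed
  have B0: "B x = 0" if "norm x > e" for x
  proof -
    have "norm x \<le> (\<Sum>i\<in>UNIV. \<bar>x $ i\<bar>)" by (rule norm_le_l1_cart)
    also have "\<dots> = \<bar>x $ 1\<bar> + \<bar>x $ 2\<bar>" by (simp add: UNIV_2)
    finally have "\<bar>x $ 1\<bar> \<ge> e / 2 \<or> \<bar>x $ 2\<bar> \<ge> e / 2" using that by linarith
    then show ?thesis using b0 by (auto simp: B_def)
  qed
  have int: "integrable lborel B"
    by (rule integrable_lborel_compact_support[of _ "cball 0 e"])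
      (use Ck_continuous[OF CkB] B0 in auto)
  have "B 0 > 0" by (simp add: B_def b_def flat_def)
  then have pos: "(LINT x|lborel. B x) > 0"
    using lborel_positive_integral[OF int B_nonneg Ck_continuous[OF CkB]] by blast
  define I where "I = (LINT x|lborel. B x)"
  show thesis
  proof (rule that[of "\<lambda>x. inverse I * B x"])
    show "Ck k (\<lambda>x. inverse I * B x)" for k
      by (intro Ck_mult Ck_const CkB)
    show "(LINT x|lborel. inverse I * B x) = 1"
      using pos by (simp add: I_def)
  qed (use pos B_nonneg B0 int in \<open>auto simp: I_def\<close>)
qed

section \<open>Mollification\<close>

lemma lborel_integral_reflect:
  fixes f :: "'a::euclidean_space \<Rightarrow> real"
  shows "(LINT y|lborel. f (x - y)) = (LINT y|lborel. f y)"
    and "integrable lborel (\<lambda>y. f (x - y)) \<longleftrightarrow> integrable lborel f"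
proof -
  have eq: "distr lborel borel (\<lambda>y. x - y) = (lborel :: 'a measure)"
    using lborel_affine[of "-1 :: real" x] by (simp add: density_1)
  have B: "distr lborel lborel (\<lambda>y. x - y) = (lborel :: 'a measure)"
    using eq distr_cong[of lborel lborel lborel borel "\<lambda>y. x - y" "\<lambda>y. x - y"] by simp
  have inj: "(\<lambda>z. x - (x - z)) = (\<lambda>z::'a. z)" by auto
  have meas: "f \<in> borel_measurable lborel" if "(\<lambda>y. f (x - y)) \<in> borel_measurable lborel" for f :: "'a \<Rightarrow> real"
  proof -
    have "(\<lambda>z. f (x - (x - z))) \<in> borel_measurable lborel"
      using that by measurable
    then show ?thesis by simp
  qed
  have int: "integrable lborel (\<lambda>y. f (x - y))" if "integrable lborel f" for f :: "'a \<Rightarrow> real"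
    using that integrable_distr[of "\<lambda>y. x - y" lborel lborel f] B by simp
  show "integrable lborel (\<lambda>y. f (x - y)) \<longleftrightarrow> integrable lborel f"
    using int[of f] int[of "\<lambda>y. f (x - y)"] by auto
  show "(LINT y|lborel. f (x - y)) = (LINT y|lborel. f y)"
  proof (cases "f \<in> borel_measurable lborel")
    case True
    have "integral\<^sup>L (distr lborel lborel (\<lambda>y. x - y)) f = (LINT y|lborel. f (x - y))"
      by (rule integral_distr) (use True in simp_all)
    then show ?thesis
      unfolding B by (rule sym)
  next
    case False
    then have "\<not> integrable lborel f" "\<not> integrable lborel (\<lambda>y. f (x - y))"
      using meas[of f] borel_measurable_integrable by blast+
    then show ?thesis
      by (simp add: not_integrable_integral_eq)
  qed
qed

definition conv :: "(real^2 \<Rightarrow> real) \<Rightarrow> (real^2 \<Rightarrow> real) \<Rightarrow> real^2 \<Rightarrow> real" where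
  "conv \<rho> w x = (LINT y|lborel. \<rho> (x - y) * w y)"

lemma conv_commute: "conv \<rho> w x = (LINT y|lborel. \<rho> y * w (x - y))"
  unfolding conv_def using lborel_integral_reflect(1)[of "\<lambda>y. \<rho> y * w (x - y)" x] by simp

text \<open>
  The derivative falls on the kernel, so mere continuity of \<open>w\<close> suffices. The integral may be taken
  over a box that contains the support of \<open>w\<close>, where differentiation under the integral applies.
\<close>

lemma conv_has_derivative:
  assumes \<rho>: "Ck 1 \<rho>" and w: "continuous_on UNIV w" "compact S" "\<And>y. y \<notin> S \<Longrightarrow> w y = 0"
  shows "(conv \<rho> w has_derivative (\<lambda>v. (\<chi> i. conv (partial_deriv i \<rho>) w x) \<bullet> v)) (at x)"
proof -
  obtain a where S: "S \<subseteq> cbox (- a) a"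
    by (rule bounded_subset_cbox_symmetric[OF compact_imp_bounded[OF w(2)]])
  have diff: "\<rho> differentiable (at y)" and cg: "continuous_on UNIV (grad \<rho>)" for y
    using \<rho>[unfolded Ck_1_iff] by blast+
  have c\<rho>: "continuous_on UNIV \<rho>" by (rule Ck_continuous[OF \<rho>])
  have HK: "conv q w x = integral (cbox (- a) a) (\<lambda>y. q (x - y) * w y)"
    if q: "continuous_on UNIV q" for q x
  proof -
    have c: "continuous_on UNIV (\<lambda>y. q (x - y) * w y)"
      by (intro continuous_intros w continuous_on_compose2[OF q]) auto
    have "integrable lborel (\<lambda>y. q (x - y) * w y)"
      by (rule integrable_lborel_compact_support[OF c w(2)]) (use w(3) in auto)
    then have "conv q w x = integral UNIV (\<lambda>y. q (x - y) * w y)"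
      unfolding conv_def by (simp add: integral_lborel)
    also have "\<dots> = integral UNIV (\<lambda>y. if y \<in> cbox (- a) a then q (x - y) * w y else 0)"
      by (rule arg_cong[where f="integral UNIV"]) (use S w(3) in \<open>auto simp: fun_eq_iff\<close>)
    finally show ?thesis by (simp only: integral_restrict_UNIV)
  qed
  define fx where "fx x y = w y *\<^sub>R blinfun_inner_right (grad \<rho> (x - y))" for x y
  have cfx: "continuous_on (UNIV \<times> cbox (- a) a) (\<lambda>(x, y). fx x y)"
    unfolding fx_def case_prod_beta
    by (intro continuous_intros continuous_on_compose2[OF w(1)] continuous_on_compose2[OF cg]
        bounded_linear.continuous_on[OF bounded_linear_blinfun_inner_right]) auto
  have "((\<lambda>x. integral (cbox (- a) a) (\<lambda>y. \<rho> (x - y) * w y)) has_derivative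
      blinfun_apply (integral (cbox (- a) a) (fx x))) (at x within UNIV)"
  proof (rule leibniz_rule[OF _ _ cfx])
    fix x y :: "real^2"
    have "((\<lambda>x. x - y) has_derivative (\<lambda>v. v)) (at x)"
      by (auto intro!: derivative_eq_intros)
    from has_derivative_compose[OF this has_derivative_grad[OF diff[of "x - y"]]]
    have "((\<lambda>x. \<rho> (x - y) * w y) has_derivative (\<lambda>v. (grad \<rho> (x - y) \<bullet> v) * w y)) (at x)"
      by (rule has_derivative_mult_left)
    moreover have "blinfun_apply (fx x y) = (\<lambda>v. (grad \<rho> (x - y) \<bullet> v) * w y)"
      by (simp add: fx_def blinfun.scaleR_left fun_eq_iff)
    ultimately show "((\<lambda>x. \<rho> (x - y) * w y) has_derivative blinfun_apply (fx x y)) (at x within UNIV)"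
      by simp
  next
    show "(\<lambda>y. \<rho> (x - y) * w y) integrable_on cbox (- a) a" for x
      by (intro integrable_continuous continuous_intros continuous_on_compose2[OF c\<rho>]
          continuous_on_subset[OF w(1)]) auto
  qed auto
  moreover have "(\<lambda>x. integral (cbox (- a) a) (\<lambda>y. \<rho> (x - y) * w y)) = conv \<rho> w"
    using HK[OF c\<rho>] by auto
  moreover have "blinfun_apply (integral (cbox (- a) a) (fx x))
      = (\<lambda>v. (\<chi> i. conv (partial_deriv i \<rho>) w x) \<bullet> v)"
  proof
    fix v
    have cx: "continuous_on (cbox (- a) a) (fx x)"
      unfolding fx_def
      by (intro continuous_intros continuous_on_subset[OF w(1)] continuous_on_compose2[OF cg]
        bounded_linear.continuous_on[OF bounded_linear_blinfun_inner_right]) auto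
    have cp: "continuous_on UNIV (partial_deriv i \<rho>)" for i
      using \<rho> by simp
    have "blinfun_apply (integral (cbox (- a) a) (fx x)) v
        = integral (cbox (- a) a) (\<lambda>y. blinfun_apply (fx x y) v)"
      by (rule blinfun_apply_integral) (rule integrable_continuous[OF cx])
    also have "\<dots> = integral (cbox (- a) a) (\<lambda>y. \<Sum>i\<in>UNIV. (partial_deriv i \<rho> (x - y) * w y) * v $ i)"
      by (simp add: fx_def blinfun.scaleR_left inner_vec_def sum_distrib_left mult_ac)
    also have "\<dots> = (\<Sum>i\<in>UNIV. integral (cbox (- a) a) (\<lambda>y. (partial_deriv i \<rho> (x - y) * w y) * v $ i))"
      by (rule integral_sum)
        (auto intro!: integrable_continuous continuous_intros continuous_on_compose2[OF cp]
          continuous_on_subset[OF w(1)])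
    also have "\<dots> = (\<chi> i. conv (partial_deriv i \<rho>) w x) \<bullet> v"
      by (simp add: inner_vec_def HK[OF cp])
    finally show "blinfun_apply (integral (cbox (- a) a) (fx x)) v
      = (\<chi> i. conv (partial_deriv i \<rho>) w x) \<bullet> v" .
  qed
  ultimately show ?thesis by simp
qed

text \<open>
  Smoothness of every order is assumed of the kernel because each step of the induction replaces it
  by one of its derivatives.
\<close>

lemma Ck_conv:
  assumes "\<And>k. Ck k \<rho>" and w: "continuous_on UNIV w" "compact S" "\<And>y. y \<notin> S \<Longrightarrow> w y = 0"
  shows "Ck k (conv \<rho> w)"
  using assms(1)
proof (induction k arbitrary: \<rho>)
  note der = conv_has_derivative[OF _ w]
  {
    case 0
    then show ?case
      using has_derivative_continuous[OF der[OF 0]] by (simp add: continuous_on_eq_continuous_at)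
  next
    case (Suc k)
    have "partial_deriv i (conv \<rho> w) = conv (partial_deriv i \<rho>) w" for i
      by (rule ext, subst partial_deriv_eq[OF der[OF Suc.prems]]) (simp_all add: inner_axis)
    moreover have "Ck k (conv (partial_deriv i \<rho>) w)" for i
    proof (rule Suc.IH)
      show "Ck j (partial_deriv i \<rho>)" for j
        using Suc.prems[of "Suc j"] by simp
    qed
    ultimately show ?case
      using der[OF Suc.prems] by (auto simp: differentiable_def)
  }
qed

lemma test_function_Ck: "\<phi> \<in> test_functions \<Omega> \<Longrightarrow> Ck k \<phi>"
  by (simp add: test_functions_def)

text \<open>
  The difference quotient in the direction of \<open>g\<close> itself tends to \<open>norm g ^ 2\<close>.
\<close>

lemma norm_gradient_le:
  fixes f :: "'a::real_inner \<Rightarrow> real"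
  assumes f: "(f has_derivative (\<lambda>v. g \<bullet> v)) (at x)" and "L \<ge> 0" and L: "\<And>y. \<bar>f y - f x\<bar> \<le> L * norm (y - x)"
  shows "norm g \<le> L"
proof (cases "g = 0")
  case True
  then show ?thesis using assms(2) by simp
next
  case False
  have "((\<lambda>t. x + t *\<^sub>R g) has_derivative (\<lambda>t. t *\<^sub>R g)) (at 0)"
    by (auto intro!: derivative_eq_intros)
  from has_derivative_compose[OF this, of f "\<lambda>v. g \<bullet> v"] f
  have "((\<lambda>t. f (x + t *\<^sub>R g)) has_real_derivative g \<bullet> g) (at 0)"
    by (simp add: has_field_derivative_def mult_commute_abs)
  then have "((\<lambda>t. (f (x + t *\<^sub>R g) - f x) / t) \<longlongrightarrow> g \<bullet> g) (at 0)"
    by (simp add: has_field_derivative_iff)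
  then have "g \<bullet> g \<le> L * norm g"
  proof (rule tendsto_upperbound)
    have "(f (x + t *\<^sub>R g) - f x) / t \<le> L * norm g" if "t \<noteq> 0" for t
    proof -
      have "\<bar>f (x + t *\<^sub>R g) - f x\<bar> \<le> \<bar>t\<bar> * (L * norm g)"
        using L[of "x + t *\<^sub>R g"] by (simp add: mult_ac)
      then have "\<bar>(f (x + t *\<^sub>R g) - f x) / t\<bar> \<le> L * norm g"
        using that by (simp add: field_simps)
      then show ?thesis by linarith
    qed
    then show "\<forall>\<^sub>F t in at 0. (f (x + t *\<^sub>R g) - f x) / t \<le> L * norm g"
      by (simp add: eventually_at_filter)
  qed simp
  then have "norm g * norm g \<le> L * norm g"
    by (simp add: dot_square_norm power2_eq_square)
  then show ?thesis using False by simp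
qed

definition mollifier :: "real \<Rightarrow> (real^2 \<Rightarrow> real) \<Rightarrow> bool" where
  "mollifier e \<rho> \<longleftrightarrow> (\<forall>k. Ck k \<rho>) \<and> (\<forall>x. \<rho> x \<ge> 0) \<and> (\<forall>x. norm x > e \<longrightarrow> \<rho> x = 0) \<and>
     integrable lborel \<rho> \<and> (LINT x|lborel. \<rho> x) = 1"

context
  fixes e L :: real and \<rho> w :: "real^2 \<Rightarrow> real" and S :: "(real^2) set"
  assumes m: "mollifier e \<rho>" and L: "L-lipschitz_on UNIV w"
    and S: "compact S" "\<And>y. y \<notin> S \<Longrightarrow> w y = 0"
begin

lemma w_lipschitz: "\<bar>w x - w y\<bar> \<le> L * norm (x - y)"
  using lipschitz_onD[OF L, of x y] by (simp add: dist_norm)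

lemma w_continuous: "continuous_on UNIV w"
  by (rule lipschitz_on_continuous_on[OF L])

lemma Ck_mollify: "Ck k (conv \<rho> w)"
  using m by (intro Ck_conv[OF _ w_continuous S]) (auto simp: mollifier_def)

lemma integrable_conv: "integrable lborel (\<lambda>y. \<rho> y * w (x - y))"
proof -
  have c: "continuous_on UNIV \<rho>"
    using m Ck_continuous[of 0 \<rho>] unfolding mollifier_def by blast
  show ?thesis
  proof (rule integrable_lborel_compact_support[where S="cball 0 e"])
    show "continuous_on UNIV (\<lambda>y. \<rho> y * w (x - y))"
      by (intro continuous_intros continuous_on_compose2[OF w_continuous] c) auto
  qed (use m in \<open>auto simp: mollifier_def\<close>)
qed

lemma conv_support: "conv \<rho> w x \<noteq> 0 \<Longrightarrow> \<exists>y. norm (x - y) \<le> e \<and> w y \<noteq> 0"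
proof (rule ccontr)
  assume *: "conv \<rho> w x \<noteq> 0" "\<nexists>y. norm (x - y) \<le> e \<and> w y \<noteq> 0"
  then have "(\<lambda>y. \<rho> (x - y) * w y) = (\<lambda>y. 0)"
    using m by (force simp: mollifier_def fun_eq_iff)
  with *(1) show False by (simp add: conv_def)
qed

lemma mollifier_mean_le:
  assumes i: "integrable lborel (\<lambda>y. \<rho> y * k y)" and M: "\<And>y. norm y \<le> e \<Longrightarrow> \<bar>k y\<bar> \<le> M"
  shows "\<bar>LINT y|lborel. \<rho> y * k y\<bar> \<le> M"
proof -
  have "\<bar>LINT y|lborel. \<rho> y * k y\<bar> \<le> (LINT y|lborel. M * \<rho> y)"
  proof (rule order_trans[OF integral_abs_bound], rule integral_mono)
    show "\<bar>\<rho> y * k y\<bar> \<le> M * \<rho> y" for y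
      using m M[of y] by (cases "norm y \<le> e")
        (auto simp: mollifier_def abs_mult intro!: mult_left_mono simp: mult.commute[of M])
  qed (use i m in \<open>auto simp: mollifier_def\<close>)
  also have "\<dots> = M" using m by (simp add: mollifier_def)
  finally show ?thesis .
qed

lemma conv_close: "\<bar>conv \<rho> w x - w x\<bar> \<le> L * e"
proof -
  have i: "integrable lborel (\<lambda>y. \<rho> y * (w (x - y) - w x))"
    using m integrable_conv[of x] by (auto simp: mollifier_def right_diff_distrib)
  have "conv \<rho> w x - w x = (LINT y|lborel. \<rho> y * (w (x - y) - w x))"
    using m integrable_conv[of x] by (simp add: conv_commute mollifier_def right_diff_distrib)
  moreover have "\<bar>w (x - y) - w x\<bar> \<le> L * e" if "norm y \<le> e" for y
    using order_trans[OF w_lipschitz[of "x - y" x]] that lipschitz_on_nonneg[OF L]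
    by (simp add: mult_left_mono)
  ultimately show ?thesis using mollifier_mean_le[OF i] by simp
qed

lemma conv_diff: "\<bar>conv \<rho> w x' - conv \<rho> w x - c\<bar> \<le> M"
  if M: "\<And>y. norm y \<le> e \<Longrightarrow> \<bar>w (x' - y) - w (x - y) - c\<bar> \<le> M"
proof -
  have i: "integrable lborel (\<lambda>y. \<rho> y * (w (x' - y) - w (x - y) - c))"
    using m integrable_conv[of x] integrable_conv[of x'] by (auto simp: mollifier_def right_diff_distrib)
  have "conv \<rho> w x' - conv \<rho> w x - c = (LINT y|lborel. \<rho> y * (w (x' - y) - w (x - y) - c))"
    using m integrable_conv[of x] integrable_conv[of x']
    by (simp add: conv_commute mollifier_def right_diff_distrib)
  then show ?thesis using mollifier_mean_le[OF i M] by simp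
qed

lemma conv_lipschitz: "\<bar>conv \<rho> w x - conv \<rho> w y\<bar> \<le> L * norm (x - y)"
proof -
  have "\<bar>conv \<rho> w x - conv \<rho> w y - 0\<bar> \<le> L * norm (x - y)"
  proof (rule conv_diff)
    show "\<bar>w (x - z) - w (y - z) - 0\<bar> \<le> L * norm (x - y)" for z
      using w_lipschitz[of "x - z" "y - z"] by simp
  qed
  then show ?thesis by simp
qed

lemma grad_conv_bound: "norm (grad (conv \<rho> w) x) \<le> L"
proof (rule norm_gradient_le)
  show "(conv \<rho> w has_derivative (\<lambda>v. grad (conv \<rho> w) x \<bullet> v)) (at x)"
    using Ck_mollify[of 1] unfolding Ck_1_iff by (intro has_derivative_grad) auto
  show "0 \<le> L" by (rule lipschitz_on_nonneg[OF L])
qed (rule conv_lipschitz)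

text \<open>Mollification reproduces affine functions up to a constant.\<close>

lemma grad_conv_affine:
  assumes aff: "\<And>y. y \<in> ball x r \<Longrightarrow> w y = c + g \<bullet> y" and r: "e < r"
  shows "grad (conv \<rho> w) x = g"
proof -
  have eq: "conv \<rho> w x' = conv \<rho> w x + g \<bullet> (x' - x)" if x': "x' \<in> ball x (r - e)" for x'
  proof -
    have "\<bar>conv \<rho> w x' - conv \<rho> w x - g \<bullet> (x' - x)\<bar> \<le> 0"
    proof (rule conv_diff)
      fix y :: "real^2" assume y: "norm y \<le> e"
      have "norm (x - (x' - y)) < r"
        using y x' norm_triangle_ineq[of "x - x'" y] by (simp add: dist_norm algebra_simps)
      then have "x' - y \<in> ball x r" "x - y \<in> ball x r"
        using y r by (simp_all add: dist_norm)
      then show "\<bar>w (x' - y) - w (x - y) - g \<bullet> (x' - x)\<bar> \<le> 0"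
        using aff by (simp add: inner_diff_right)
    qed
    then show ?thesis by simp
  qed
  have "((\<lambda>x'. conv \<rho> w x + g \<bullet> (x' - x)) has_derivative (\<lambda>v. g \<bullet> v)) (at x)"
    by (auto intro!: derivative_eq_intros)
  then have "(conv \<rho> w has_derivative (\<lambda>v. g \<bullet> v)) (at x)"
  proof (rule has_derivative_transform_within_open[where s="ball x (r - e)"])
    show "conv \<rho> w x + g \<bullet> (x' - x) = conv \<rho> w x'" if "x' \<in> ball x (r - e)" for x'
      using eq[OF that] by simp
  qed (use r in auto)
  from partial_deriv_eq[OF this] show ?thesis
    by (simp add: vec_eq_iff inner_axis)
qed

end

section \<open>Integration by parts\<close>

lemma lborel_integral_translate:
  fixes f :: "'a::euclidean_space \<Rightarrow> real"
  shows "(LINT y|lborel. f (h + y)) = (LINT y|lborel. f y)"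
    and "integrable lborel (\<lambda>y. f (h + y)) \<longleftrightarrow> integrable lborel f"
  using lborel_integral_reflect[of "\<lambda>y. f (h - y)" 0] lborel_integral_reflect[of f h]
  by simp_all

lemma compact_support_bounded:
  fixes f :: "'a::topological_space \<Rightarrow> 'b::real_normed_vector"
  assumes "continuous_on UNIV f" "compact S" "\<And>x. x \<notin> S \<Longrightarrow> f x = 0"
  obtains M where "M > 0" "\<And>x. norm (f x) \<le> M"
proof -
  have "bounded (f ` S)"
    using assms(1,2) by (intro compact_imp_bounded compact_continuous_image) (auto intro: continuous_on_subset)
  then obtain M where M: "M > 0" "\<And>x. x \<in> S \<Longrightarrow> norm (f x) \<le> M"
    unfolding bounded_pos by auto
  show thesis
    by (rule that[OF M(1)]) (use M assms(3) in \<open>metis norm_zero less_imp_le\<close>)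
qed

lemma grad_eq_0_outside:
  assumes "closed S" "\<And>x. x \<notin> S \<Longrightarrow> F x = 0" "x \<notin> S"
  shows "grad F x = 0"
proof -
  have "((\<lambda>x. 0) has_derivative (\<lambda>v. 0)) (at x)" by simp
  then have "(F has_derivative (\<lambda>v. 0)) (at x)"
    by (rule has_derivative_transform_within_open[where s="- S"])
      (use assms in \<open>auto simp: open_Compl\<close>)
  from partial_deriv_eq[OF this] show ?thesis
    by (simp add: vec_eq_iff)
qed

lemma C1_compact_support_lipschitz:
  assumes F: "Ck 1 F" and S: "compact S" "\<And>x. x \<notin> S \<Longrightarrow> F x = 0"
  obtains M where "M > 0" "\<And>x. norm (grad F x) \<le> M" "M-lipschitz_on UNIV F"
proof -
  have c: "continuous_on UNIV (grad F)" and d: "\<And>x. F differentiable (at x)"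
    using F unfolding Ck_1_iff by auto
  have g0: "grad F x = 0" if "x \<notin> S" for x
    using grad_eq_0_outside[of S F] compact_imp_closed[OF S(1)] S(2) that by blast
  obtain M where M: "M > 0" "\<And>x. norm (grad F x) \<le> M"
    using compact_support_bounded[OF c S(1) g0] by blast
  have "M-lipschitz_on UNIV F"
  proof (rule bounded_derivative_imp_lipschitz)
    show "(F has_derivative (\<lambda>v. grad F x \<bullet> v)) (at x within UNIV)" for x
      by (rule has_derivative_grad[OF d])
    show "onorm (\<lambda>v. grad F x \<bullet> v) \<le> M" for x
    proof (rule onorm_bound)
      show "norm (grad F x \<bullet> v) \<le> M * norm v" for v
        using Cauchy_Schwarz_ineq2[of "grad F x" v] mult_right_mono[OF M(2)[of x], of "norm v"] by simp
    qed (use M in simp)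
  qed (use M in auto)
  with M that show thesis by blast
qed

text \<open>
  The difference quotients of \<open>F\<close> in a coordinate direction have integral zero by translation
  invariance, and they converge boundedly on a fixed ball to the partial derivative.
\<close>

lemma integral_partial_deriv_eq_0:
  assumes F: "Ck 1 F" and S: "compact S" "\<And>x. x \<notin> S \<Longrightarrow> F x = 0"
  shows "(LINT x|lborel. partial_deriv i F x) = 0"
proof -
  obtain M where M: "M > 0" "M-lipschitz_on UNIV F"
    using C1_compact_support_lipschitz[OF F S] by metis
  have cF: "continuous_on UNIV F" by (rule Ck_continuous[OF F])
  have intF: "integrable lborel F"
    by (rule integrable_lborel_compact_support[OF cF S])
  define s where "s n = inverse (real (Suc n))" for n
  have s: "s n > 0" "s n \<le> 1" "s \<longlonglongrightarrow> 0" for n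
    using LIMSEQ_inverse_real_of_nat by (auto simp: s_def[abs_def] inverse_le_1_iff)
  define q where "q n x = (F (s n *\<^sub>R axis i 1 + x) - F x) / s n" for n x
  obtain r where r: "r > 0" "S \<subseteq> ball 0 r"
    using bounded_subset_ballD[OF compact_imp_bounded[OF S(1)]] by blast
  have ae: "(\<lambda>n. q n x) \<longlonglongrightarrow> partial_deriv i F x" for x
  proof -
    have d: "F differentiable (at x)" using F unfolding Ck_1_iff by auto
    have "((\<lambda>t. t *\<^sub>R axis i 1 + x) has_derivative (\<lambda>t. t *\<^sub>R axis i 1)) (at 0)"
      by (auto intro!: derivative_eq_intros)
    from has_derivative_compose[OF this, of F "\<lambda>v. grad F x \<bullet> v"] has_derivative_grad[OF d]
    have "((\<lambda>t. F (t *\<^sub>R axis i 1 + x)) has_real_derivative partial_deriv i F x) (at 0)"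
      by (simp add: has_field_derivative_def mult_commute_abs inner_axis)
    then have "((\<lambda>t. (F (t *\<^sub>R axis i 1 + x) - F x) / t) \<longlongrightarrow> partial_deriv i F x) (at 0)"
      by (simp add: has_field_derivative_iff)
    moreover have "filterlim s (at 0) sequentially"
      using s(3) s(1) by (auto simp: filterlim_at less_imp_neq[symmetric])
    ultimately show ?thesis
      unfolding q_def by (rule filterlim_compose)
  qed
  have "(\<lambda>n. LINT x|lborel. q n x) \<longlonglongrightarrow> (LINT x|lborel. partial_deriv i F x)"
  proof (rule integral_dominated_convergence[where w="\<lambda>x. indicator (cball 0 (r + 1)) x *\<^sub>R M"])
    have "continuous_on UNIV (partial_deriv i F)" using F by simp
    then show "partial_deriv i F \<in> borel_measurable lborel"
      by (simp add: borel_measurable_continuous_onI)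
    show "q n \<in> borel_measurable lborel" for n
      unfolding q_def using borel_measurable_continuous_onI[OF cF] by measurable
    show "integrable lborel (\<lambda>x. indicator (cball (0::real^2) (r + 1)) x *\<^sub>R M)"
      by (rule borel_integrable_compact) auto
    have "norm (q n x) \<le> indicator (cball 0 (r + 1)) x *\<^sub>R M" for n x
    proof (cases "x \<in> cball 0 (r + 1)")
      case True
      have "\<bar>F (s n *\<^sub>R axis i 1 + x) - F x\<bar> \<le> M * s n"
        using lipschitz_onD[OF M(2), of "s n *\<^sub>R axis i 1 + x" x] s(1)[of n] by (simp add: dist_norm)
      then show ?thesis using True s(1)[of n] by (simp add: q_def field_simps)
    next
      case False
      have "norm x \<le> norm (s n *\<^sub>R axis i (1::real) + x) + s n"
        using norm_triangle_ineq4[of "s n *\<^sub>R axis i (1::real) + x" "s n *\<^sub>R axis i (1::real)"] s(1)[of n]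
        by simp
      then have "norm (s n *\<^sub>R axis i (1::real) + x) > r" using False s(2)[of n] by simp
      then have "s n *\<^sub>R axis i 1 + x \<notin> S" "x \<notin> S" using r False by auto
      then show ?thesis using S(2) False by (simp add: q_def)
    qed
    then show "AE x in lborel. norm (q n x) \<le> indicator (cball 0 (r + 1)) x *\<^sub>R M" for n
      by simp
  qed (use ae in simp)
  moreover have "(LINT x|lborel. q n x) = 0" for n
    using intF lborel_integral_translate[of F "s n *\<^sub>R axis i 1"]
    by (simp add: q_def)
  ultimately show ?thesis
    using LIMSEQ_unique by (fastforce simp: LIMSEQ_const_iff)
qed

lemma partial_deriv_mult:
  assumes "f differentiable (at x)" "g differentiable (at x)"
  shows "partial_deriv i (\<lambda>x. f x * g x) x = f x * partial_deriv i g x + partial_deriv i f x * g x"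
  by (subst partial_deriv_eq[OF has_derivative_mult[OF has_derivative_grad[OF assms(1)] has_derivative_grad[OF assms(2)]]])
    (simp add: inner_axis)

lemma integration_by_parts:
  assumes \<phi>: "Ck 1 \<phi>" and \<psi>: "Ck 1 \<psi>" and S: "compact S" "\<And>x. x \<notin> S \<Longrightarrow> \<psi> x = 0"
  shows "(LINT x|lborel. \<phi> x * partial_deriv i \<psi> x) = - (LINT x|lborel. partial_deriv i \<phi> x * \<psi> x)"
proof -
  have d: "\<phi> differentiable (at x)" "\<psi> differentiable (at x)" for x
    using \<phi> \<psi> unfolding Ck_1_iff by auto
  have c: "continuous_on UNIV \<phi>" "continuous_on UNIV \<psi>" "continuous_on UNIV (partial_deriv i \<phi>)"
    "continuous_on UNIV (partial_deriv i \<psi>)"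
    using \<phi> \<psi> Ck_continuous[OF \<phi>] Ck_continuous[OF \<psi>] by auto
  have p0: "partial_deriv i \<psi> x = 0" if "x \<notin> S" for x
    using grad_eq_0_outside[of S \<psi> x] compact_imp_closed[OF S(1)] S(2) that grad_nth[of \<psi> x i] by simp
  have "0 = (LINT x|lborel. partial_deriv i (\<lambda>x. \<phi> x * \<psi> x) x)"
    using integral_partial_deriv_eq_0[OF Ck_mult[OF \<phi> \<psi>] S(1)] S(2) by simp
  also have "\<dots> = (LINT x|lborel. \<phi> x * partial_deriv i \<psi> x + partial_deriv i \<phi> x * \<psi> x)"
    by (simp add: partial_deriv_mult[OF d])
  also have "\<dots> = (LINT x|lborel. \<phi> x * partial_deriv i \<psi> x) + (LINT x|lborel. partial_deriv i \<phi> x * \<psi> x)"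
    by (rule Bochner_Integration.integral_add; rule integrable_lborel_compact_support[OF _ S(1)])
      (auto simp: p0 S(2) intro!: continuous_on_mult c)
  finally show ?thesis by linarith
qed

section \<open>Weak gradients\<close>

lemma test_function_support:
  assumes "\<phi> \<in> test_functions \<Omega>"
  obtains S where "compact S" "S \<subseteq> \<Omega>" "\<And>x. x \<notin> S \<Longrightarrow> \<phi> x = 0"
proof (rule that[of "closure {x. \<phi> x \<noteq> 0}"])
  show "\<phi> x = 0" if "x \<notin> closure {x. \<phi> x \<noteq> 0}" for x
    using that closure_subset[of "{x. \<phi> x \<noteq> 0}"] by blast
qed (use assms in \<open>auto simp: test_functions_def\<close>)

lemma test_functionI:
  assumes "\<And>k. Ck k \<phi>" "compact S" "S \<subseteq> \<Omega>" "\<And>x. x \<notin> S \<Longrightarrow> \<phi> x = 0"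
  shows "\<phi> \<in> test_functions \<Omega>"
proof -
  have "closure {x. \<phi> x \<noteq> 0} \<subseteq> S"
    using assms(4) by (intro closure_minimal compact_imp_closed[OF assms(2)]) auto
  moreover from this have "compact (closure {x. \<phi> x \<noteq> 0})"
    using assms(2) by (metis closed_closure compact_Int_closed inf.absorb_iff2)
  ultimately show ?thesis
    using assms by (auto simp: test_functions_def)
qed

lemma test_function_lincomb:
  assumes "\<phi> \<in> test_functions \<Omega>" "\<psi> \<in> test_functions \<Omega>"
  shows "(\<lambda>x. a * \<phi> x + b * \<psi> x) \<in> test_functions \<Omega>"
proof -
  obtain S T where S: "compact S" "S \<subseteq> \<Omega>" "\<And>x. x \<notin> S \<Longrightarrow> \<phi> x = 0"
    and T: "compact T" "T \<subseteq> \<Omega>" "\<And>x. x \<notin> T \<Longrightarrow> \<psi> x = 0"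
    using test_function_support[OF assms(1)] test_function_support[OF assms(2)] by metis
  show ?thesis
  proof (rule test_functionI[of _ "S \<union> T"])
    show "Ck k (\<lambda>x. a * \<phi> x + b * \<psi> x)" for k
      by (intro Ck_add Ck_mult Ck_const test_function_Ck[OF assms(1)] test_function_Ck[OF assms(2)])
  qed (use S T in auto)
qed

lemma zero_test_function: "(\<lambda>x. 0) \<in> test_functions \<Omega>"
  by (rule test_functionI[of _ "{}"]) (auto intro: Ck_const)

locale bounded_domain =
  fixes \<Omega> :: "(real^2) set"
  assumes open_\<Omega>: "open \<Omega>" and bounded_\<Omega>: "bounded \<Omega>"
begin

lemma \<Omega>_lebesgue [measurable, simp]: "\<Omega> \<in> sets lebesgue"
  using open_\<Omega> by simp

lemma \<Omega>_lmeasurable: "\<Omega> \<in> lmeasurable"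
  using bounded_\<Omega> open_\<Omega> lmeasurable_open by blast

lemma finite_measure_\<Omega>: "finite_measure (lebesgue_on \<Omega>)"
  using \<Omega>_lmeasurable by (rule finite_measure_lebesgue_on)

lemma AE_not_negligible:
  assumes "negligible N"
  shows "AE x in lebesgue_on \<Omega>. x \<notin> N"
proof -
  have "AE x in lebesgue. x \<notin> N"
    using assms by (intro AE_not_in) (simp add: negligible_iff_null_sets)
  then have "AE x in lebesgue. x \<in> \<Omega> \<longrightarrow> x \<notin> N"
    by eventually_elim simp
  then show ?thesis by (simp add: AE_restrict_space_iff)
qed

lemma integral_supported:
  fixes f :: "real^2 \<Rightarrow> real"
  assumes f: "f \<in> borel_measurable borel" "\<And>x. x \<notin> \<Omega> \<Longrightarrow> f x = 0"
  shows "(LINT x|lebesgue_on \<Omega>. f x) = (LINT x|lborel. f x)"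
    and "integrable (lebesgue_on \<Omega>) f \<longleftrightarrow> integrable lborel f"
proof -
  have *: "indicator \<Omega> x * f x = f x" for x
    using f(2) by (auto simp: indicator_def)
  show "(LINT x|lebesgue_on \<Omega>. f x) = (LINT x|lborel. f x)"
    using f(1) by (subst integral_restrict_space) (simp_all add: * integral_completion)
  show "integrable (lebesgue_on \<Omega>) f \<longleftrightarrow> integrable lborel f"
    using f(1) by (subst integrable_restrict_space) (simp_all add: * integrable_completion)
qed

lemma integrable_bounded_mult:
  fixes f g :: "real^2 \<Rightarrow> real"
  assumes "integrable (lebesgue_on \<Omega>) f" "g \<in> borel_measurable (lebesgue_on \<Omega>)" "\<And>x. x \<in> \<Omega> \<Longrightarrow> \<bar>g x\<bar> \<le> M"
  shows "integrable (lebesgue_on \<Omega>) (\<lambda>x. f x * g x)"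
proof (rule Bochner_Integration.integrable_bound[of _ "\<lambda>x. M * f x"])
  show "AE x in lebesgue_on \<Omega>. norm (f x * g x) \<le> norm (M * f x)"
  proof (rule AE_I2)
    fix x assume "x \<in> space (lebesgue_on \<Omega>)"
    then have "\<bar>g x\<bar> \<le> \<bar>M\<bar>" using assms(3)[of x] by simp
    then show "norm (f x * g x) \<le> norm (M * f x)"
      using mult_right_mono[of "\<bar>g x\<bar>" "\<bar>M\<bar>" "\<bar>f x\<bar>"] by (simp add: abs_mult mult.commute)
  qed
qed (use assms in auto)

subsection \<open>The space of square integrable functions\<close>

lemma L2_measurable: "f \<in> L2 \<Omega> \<Longrightarrow> f \<in> borel_measurable (lebesgue_on \<Omega>)"
  by (simp add: L2_def)

text \<open>
  The source of almost all membership statements: multiples, components and bounded functions.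
\<close>

lemma L2_dominated:
  fixes f :: "real^2 \<Rightarrow> 'b::euclidean_space" and g :: "real^2 \<Rightarrow> 'c::euclidean_space"
  assumes "f \<in> borel_measurable (lebesgue_on \<Omega>)" "g \<in> L2 \<Omega>" "\<And>x. x \<in> \<Omega> \<Longrightarrow> norm (f x) \<le> c * norm (g x)"
  shows "f \<in> L2 \<Omega>"
proof -
  have "integrable (lebesgue_on \<Omega>) (\<lambda>x. (norm (f x))\<^sup>2)"
  proof (rule Bochner_Integration.integrable_bound[of _ "\<lambda>x. c\<^sup>2 * (norm (g x))\<^sup>2"])
    show "AE x in lebesgue_on \<Omega>. norm ((norm (f x))\<^sup>2) \<le> norm (c\<^sup>2 * (norm (g x))\<^sup>2)"
    proof (rule AE_I2)
      fix x assume "x \<in> space (lebesgue_on \<Omega>)"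
      then have "(norm (f x))\<^sup>2 \<le> (c * norm (g x))\<^sup>2"
        using assms(3)[of x] by (intro power_mono) auto
      then show "norm ((norm (f x))\<^sup>2) \<le> norm (c\<^sup>2 * (norm (g x))\<^sup>2)"
        by (simp add: power_mult_distrib)
    qed
  qed (use assms in \<open>auto simp: L2_def\<close>)
  with assms(1) show ?thesis by (simp add: L2_def)
qed

lemma L2_add:
  assumes "f \<in> L2 \<Omega>" "g \<in> L2 \<Omega>"
  shows "(\<lambda>x. f x + g x) \<in> L2 \<Omega>"
proof -
  have "integrable (lebesgue_on \<Omega>) (\<lambda>x. (norm (f x + g x))\<^sup>2)"
  proof (rule Bochner_Integration.integrable_bound[of _ "\<lambda>x. 2 * (norm (f x))\<^sup>2 + 2 * (norm (g x))\<^sup>2"])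
    show "AE x in lebesgue_on \<Omega>. norm ((norm (f x + g x))\<^sup>2) \<le> norm (2 * (norm (f x))\<^sup>2 + 2 * (norm (g x))\<^sup>2)"
    proof (rule AE_I2)
      fix x
      have "(norm (f x + g x))\<^sup>2 \<le> (norm (f x) + norm (g x))\<^sup>2"
        by (intro power_mono norm_triangle_ineq) auto
      also have "\<dots> \<le> 2 * (norm (f x))\<^sup>2 + 2 * (norm (g x))\<^sup>2"
        using sum_squares_bound[of "norm (f x)" "norm (g x)"] by (simp add: power2_sum)
      finally show "norm ((norm (f x + g x))\<^sup>2) \<le> norm (2 * (norm (f x))\<^sup>2 + 2 * (norm (g x))\<^sup>2)"
        by simp
    qed
  qed (use assms in \<open>auto simp: L2_def\<close>)
  with assms show ?thesis by (auto simp: L2_def)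
qed

lemma L2_scaleR: "f \<in> L2 \<Omega> \<Longrightarrow> (\<lambda>x. c *\<^sub>R f x) \<in> L2 \<Omega>"
  by (rule L2_dominated[of _ f "\<bar>c\<bar>"]) (auto simp: L2_def)

lemma L2_lincomb:
  fixes f g :: "real^2 \<Rightarrow> real"
  assumes "f \<in> L2 \<Omega>" "g \<in> L2 \<Omega>"
  shows "(\<lambda>x. a * f x + b * g x) \<in> L2 \<Omega>"
  using L2_add[OF L2_scaleR[OF assms(1), of a] L2_scaleR[OF assms(2), of b]] by simp

lemma L2_nth: "g \<in> L2 \<Omega> \<Longrightarrow> (\<lambda>x. (g x :: real^2) $ i) \<in> L2 \<Omega>"
  by (rule L2_dominated[of _ g 1])
    (auto simp: L2_def component_le_norm_cart intro!: borel_measurable_continuous_on[where f="\<lambda>v. v $ i"]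
      continuous_intros)

lemma L2_bounded:
  fixes f :: "real^2 \<Rightarrow> 'b::euclidean_space"
  assumes "f \<in> borel_measurable (lebesgue_on \<Omega>)" "\<And>x. x \<in> \<Omega> \<Longrightarrow> norm (f x) \<le> M"
  shows "f \<in> L2 \<Omega>"
proof (rule L2_dominated[of f "\<lambda>x. 1::real" M])
  interpret finite_measure "lebesgue_on \<Omega>" by (rule finite_measure_\<Omega>)
  show "(\<lambda>x. 1::real) \<in> L2 \<Omega>" by (simp add: L2_def)
qed (use assms in auto)

lemma L2_mult_integrable:
  fixes f g :: "real^2 \<Rightarrow> real"
  assumes "f \<in> L2 \<Omega>" "g \<in> L2 \<Omega>"
  shows "integrable (lebesgue_on \<Omega>) (\<lambda>x. f x * g x)"
proof (rule Bochner_Integration.integrable_bound[of _ "\<lambda>x. (norm (f x))\<^sup>2 + (norm (g x))\<^sup>2"])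
  show "AE x in lebesgue_on \<Omega>. norm (f x * g x) \<le> norm ((norm (f x))\<^sup>2 + (norm (g x))\<^sup>2)"
  proof (rule AE_I2)
    fix x
    have "2 * \<bar>f x * g x\<bar> \<le> (f x)\<^sup>2 + (g x)\<^sup>2"
      using sum_squares_bound[of "\<bar>f x\<bar>" "\<bar>g x\<bar>"] by (simp add: abs_mult mult.assoc)
    moreover have "0 \<le> \<bar>f x * g x\<bar>" by simp
    ultimately show "norm (f x * g x) \<le> norm ((norm (f x))\<^sup>2 + (norm (g x))\<^sup>2)"
      unfolding real_norm_def power2_abs by linarith
  qed
qed (use assms in \<open>auto simp: L2_def\<close>)

lemma L2_integrable:
  fixes f :: "real^2 \<Rightarrow> real"
  assumes "f \<in> L2 \<Omega>"
  shows "integrable (lebesgue_on \<Omega>) f"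
  using L2_mult_integrable[OF assms L2_bounded[of "\<lambda>x. 1::real" 1]] by simp

lemma continuous_compact_L2:
  fixes f :: "real^2 \<Rightarrow> 'b::euclidean_space"
  assumes "continuous_on UNIV f" "compact S" "\<And>x. x \<notin> S \<Longrightarrow> f x = 0"
  shows "f \<in> L2 \<Omega>"
proof -
  obtain M where "M > 0" "\<And>x. norm (f x) \<le> M"
    using compact_support_bounded[of f S] assms by blast
  moreover have "f \<in> borel_measurable (lebesgue_on \<Omega>)"
    using borel_measurable_continuous_onI[OF assms(1)]
    by (intro measurable_restrict_space1 measurable_completion) simp
  ultimately show ?thesis by (intro L2_bounded) auto
qed

lemma test_function_L2:
  assumes "\<phi> \<in> test_functions \<Omega>"
  shows "\<phi> \<in> L2 \<Omega>" "grad \<phi> \<in> L2 \<Omega>" "partial_deriv i \<phi> \<in> L2 \<Omega>"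
proof -
  obtain S where S: "compact S" "S \<subseteq> \<Omega>" "\<And>x. x \<notin> S \<Longrightarrow> \<phi> x = 0"
    using test_function_support[OF assms] by blast
  have g0: "grad \<phi> x = 0" if "x \<notin> S" for x
    using grad_eq_0_outside[of S \<phi> x] compact_imp_closed[OF S(1)] S(3) that by blast
  have c: "continuous_on UNIV \<phi>" "continuous_on UNIV (grad \<phi>)"
    using test_function_Ck[OF assms, of 1] Ck_continuous Ck_1_iff by blast+
  show "\<phi> \<in> L2 \<Omega>" by (rule continuous_compact_L2[OF c(1) S(1,3)])
  show g: "grad \<phi> \<in> L2 \<Omega>" by (rule continuous_compact_L2[OF c(2) S(1) g0])
  show "partial_deriv i \<phi> \<in> L2 \<Omega>" using L2_nth[OF g, of i] by simp
qed

subsection \<open>The fundamental lemma of the calculus of variations\<close>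

text \<open>
  The indicator function of an open set is a bounded pointwise limit of test functions: mollify
  the cut-off functions \<open>x \<mapsto> min 1 (max 0 (n dist (x, - U) - 1))\<close> on a scale that is small
  compared with their Lipschitz constant.
\<close>

lemma indicator_open_limit_test_functions:
  assumes U: "open U" "U \<subseteq> \<Omega>"
  obtains \<phi> where "\<And>n. \<phi> n \<in> test_functions \<Omega>" "\<And>n x. \<bar>\<phi> n x\<bar> \<le> 2"
    "\<And>x. (\<lambda>n. \<phi> n x) \<longlonglongrightarrow> indicator U x"
proof -
  have ne: "- U \<noteq> {}"
    using bounded_\<Omega> U(2) not_bounded_UNIV by (metis Compl_empty_eq double_compl bounded_subset)
  have cl: "closed (- U)" using U(1) by (simp add: closed_Compl)
  define d where "d x = infdist x (- U)" for x
  define c where "c n x = min 1 (max 0 (real (Suc n) * d x - 1))" for n x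
  \<comment> \<open>small compared with the Lipschitz constant \<open>Suc n\<close> of the cut-off and with its distance to the complement\<close>
  define e where "e n = inverse (2 * (real (Suc n))\<^sup>2)" for n
  have e: "e n > 0" "real (Suc n) * e n \<le> inverse (real (Suc n))" "e n \<le> inverse (real (Suc n)) / 2" for n
  proof -
    have *: "N * inverse (2 * N\<^sup>2) \<le> inverse N" "inverse (2 * N\<^sup>2) \<le> inverse N / 2" if "N \<ge> 1" for N :: real
    proof -
      have "N * 1 \<le> N * N" using that by (intro mult_left_mono) auto
      then show "N * inverse (2 * N\<^sup>2) \<le> inverse N" "inverse (2 * N\<^sup>2) \<le> inverse N / 2"
        using that by (simp_all add: power2_eq_square field_simps)
    qed
    show "e n > 0" by (simp add: e_def del: of_nat_Suc)
    show "real (Suc n) * e n \<le> inverse (real (Suc n))" "e n \<le> inverse (real (Suc n)) / 2"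
      using *[of "real (Suc n)"] by (simp_all add: e_def del: of_nat_Suc)
  qed
  have "\<exists>\<rho>. mollifier (e n) \<rho>" for n
    using mollifier_exists[OF e(1)[of n]] unfolding mollifier_def by metis
  then obtain \<rho> where \<rho>: "\<And>n. mollifier (e n) (\<rho> n)" by metis
  have lipd: "\<bar>d x - d y\<bar> \<le> norm (x - y)" for x y
    using infdist_triangle[of x "- U" y] infdist_triangle[of y "- U" x]
    by (auto simp: d_def dist_norm norm_minus_commute)
  have lipc: "(real (Suc n))-lipschitz_on UNIV (c n)" for n
  proof (rule lipschitz_onI)
    fix x y
    have "\<bar>c n x - c n y\<bar> \<le> \<bar>real (Suc n) * d x - real (Suc n) * d y\<bar>"
      by (auto simp: c_def)
    also have "\<dots> = real (Suc n) * \<bar>d x - d y\<bar>"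
      by (simp add: abs_mult flip: right_diff_distrib)
    also have "\<dots> \<le> real (Suc n) * norm (x - y)"
      by (intro mult_left_mono lipd) simp
    finally show "dist (c n x) (c n y) \<le> real (Suc n) * dist x y"
      by (simp add: dist_norm)
  qed simp
  define S where "S n = {x. d x \<ge> inverse (real (Suc n))}" for n
  define S' where "S' n = {x. d x \<ge> inverse (real (Suc n)) / 2}" for n
  have cd: "continuous_on UNIV d"
    unfolding d_def by (intro continuous_intros)
  have d0: "d x = 0 \<longleftrightarrow> x \<notin> U" for x
    using in_closed_iff_infdist_zero[OF cl ne] by (auto simp: d_def)
  have dpos: "d x \<ge> 0" for x by (simp add: d_def infdist_nonneg)
  have subU: "{x. d x \<ge> t} \<subseteq> U" if "t > 0" for t
  proof
    fix x assume "x \<in> {x. d x \<ge> t}"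
    then have "d x \<noteq> 0" using that by auto
    then show "x \<in> U" using d0[of x] by auto
  qed
  have comp: "compact {x. d x \<ge> t}" if "t > 0" for t
  proof -
    have "bounded {x. d x \<ge> t}"
      using subU[OF that] U(2) bounded_\<Omega> bounded_subset by blast
    moreover have "closed {x. d x \<ge> t}"
      using cd by (intro closed_Collect_le) auto
    ultimately show ?thesis by (simp add: compact_eq_bounded_closed)
  qed
  have S: "compact (S n)" "compact (S' n)" "S' n \<subseteq> \<Omega>" for n
  proof -
    have p: "inverse (real (Suc n)) > 0" "inverse (real (Suc n)) / 2 > 0" by simp_all
    show "compact (S n)" "compact (S' n)" "S' n \<subseteq> \<Omega>"
      unfolding S_def S'_def using comp[OF p(1)] comp[OF p(2)] subU[OF p(2)] U(2) by blast+
  qed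
  have c0: "c n x = 0" if "x \<notin> S n" for n x
    using that by (auto simp: S_def c_def field_simps)
  note mo = \<rho> lipc S(1) c0
  have test: "conv (\<rho> n) (c n) \<in> test_functions \<Omega>" for n
  proof (rule test_functionI[OF Ck_mollify[OF mo] S(2,3)[of n]])
    fix x assume x: "x \<notin> S' n"
    show "conv (\<rho> n) (c n) x = 0"
    proof (rule ccontr)
      assume "conv (\<rho> n) (c n) x \<noteq> 0"
      then obtain y where y: "norm (x - y) \<le> e n" "c n y \<noteq> 0"
        using conv_support[OF mo] by blast
      then have "d y \<ge> inverse (real (Suc n))" using c0[of y n] by (auto simp: S_def)
      then have "d x \<ge> inverse (real (Suc n)) / 2"
        using lipd[of x y] y(1) e(3)[of n] by linarith
      then show False using x by (simp add: S'_def)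
    qed
  qed
  have near: "\<bar>conv (\<rho> n) (c n) x - c n x\<bar> \<le> inverse (real (Suc n))" for n x
    using conv_close[OF \<rho>[of n] lipc[of n] S(1)[of n] c0, of x] e(2)[of n] by linarith
  have cb: "0 \<le> c n x" "c n x \<le> 1" for n x by (auto simp: c_def)
  show thesis
  proof (rule that[OF test])
    show "\<bar>conv (\<rho> n) (c n) x\<bar> \<le> 2" for n x
    proof -
      have "inverse (real (Suc n)) \<le> 1" by (simp add: inverse_le_1_iff)
      then show ?thesis using near[of n x] cb[of n x] by linarith
    qed
    show "(\<lambda>n. conv (\<rho> n) (c n) x) \<longlonglongrightarrow> indicator U x" for x
    proof -
      have "\<forall>\<^sub>F n in sequentially. c n x = indicator U x"
      proof (cases "x \<in> U")
        case True
        then have "d x > 0" using d0[of x] dpos[of x] by auto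
        then obtain N where N: "2 / d x < real N" using reals_Archimedean2 by blast
        have "c n x = 1" if "n \<ge> N" for n
        proof -
          have "2 / d x \<le> real (Suc n)" using N that by simp
          then have "2 \<le> real (Suc n) * d x" using \<open>d x > 0\<close> by (simp add: field_simps)
          then show ?thesis by (simp add: c_def)
        qed
        then show ?thesis using True by (auto simp: eventually_sequentially)
      next
        case False
        then show ?thesis using d0[of x] by (simp add: c_def)
      qed
      then have l: "(\<lambda>n. c n x) \<longlonglongrightarrow> indicator U x"
        by (rule tendsto_eventually)
      have "(\<lambda>n. conv (\<rho> n) (c n) x - c n x) \<longlonglongrightarrow> 0"
        by (rule Lim_null_comparison[OF _ LIMSEQ_inverse_real_of_nat]) (use near in simp)
      from tendsto_add[OF this l] show ?thesis by simp
    qed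
  qed
qed

text \<open>
  The integral of \<open>g\<close> over every open subset vanishes. The set where \<open>g\<close> is positive differs
  by a null set from a countable intersection of open sets, so the integral over it vanishes too.
\<close>

lemma fundamental_lemma_nonpos:
  assumes g: "integrable (lebesgue_on \<Omega>) g"
    and 0: "\<And>\<phi>. \<phi> \<in> test_functions \<Omega> \<Longrightarrow> (LINT x|lebesgue_on \<Omega>. g x * \<phi> x) = 0"
  shows "AE x in lebesgue_on \<Omega>. g x \<le> 0"
proof -
  have gm: "g \<in> borel_measurable (lebesgue_on \<Omega>)" using g by simp
  have indm: "(\<lambda>x. g x * indicator B x) \<in> borel_measurable (lebesgue_on \<Omega>)" if "B \<in> sets lebesgue" for B
    by (rule borel_measurable_times[OF gm measurable_restrict_space1[OF borel_measurable_indicator[OF that]]])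
  have op: "(LINT x|lebesgue_on \<Omega>. g x * indicator U x) = 0" if U: "open U" "U \<subseteq> \<Omega>" for U
  proof -
    obtain \<phi> where \<phi>: "\<And>n. \<phi> n \<in> test_functions \<Omega>" "\<And>n x. \<bar>\<phi> n x\<bar> \<le> 2"
      "\<And>x. (\<lambda>n. \<phi> n x) \<longlonglongrightarrow> indicator U x"
      using indicator_open_limit_test_functions[OF U] by blast
    have "(\<lambda>n. LINT x|lebesgue_on \<Omega>. g x * \<phi> n x) \<longlonglongrightarrow> (LINT x|lebesgue_on \<Omega>. g x * indicator U x)"
    proof (rule integral_dominated_convergence[where w="\<lambda>x. 2 * \<bar>g x\<bar>"])
      show "(\<lambda>x. g x * indicator U x) \<in> borel_measurable (lebesgue_on \<Omega>)"
        by (rule indm) (use U in auto)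
      show "(\<lambda>x. g x * \<phi> n x) \<in> borel_measurable (lebesgue_on \<Omega>)" for n
        using gm L2_measurable[OF test_function_L2(1)[OF \<phi>(1)]] by (intro borel_measurable_times)
      show "AE x in lebesgue_on \<Omega>. norm (g x * \<phi> n x) \<le> 2 * \<bar>g x\<bar>" for n
      proof (rule AE_I2)
        fix x
        show "norm (g x * \<phi> n x) \<le> 2 * \<bar>g x\<bar>"
          using mult_right_mono[OF \<phi>(2)[of n x], of "\<bar>g x\<bar>"] by (simp add: abs_mult mult.commute)
      qed
      show "AE x in lebesgue_on \<Omega>. (\<lambda>n. g x * \<phi> n x) \<longlonglongrightarrow> g x * indicator U x"
        using \<phi>(3) by (intro AE_I2 tendsto_mult) auto
    qed (use g in auto)
    then show ?thesis
      using 0[OF \<phi>(1)] by (simp add: LIMSEQ_const_iff)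
  qed
  define E where "E = {x \<in> \<Omega>. g x > 0}"
  have "{x \<in> space (lebesgue_on \<Omega>). 0 < g x} \<in> sets (lebesgue_on \<Omega>)"
    using gm unfolding borel_measurable_iff_greater by blast
  then have E: "E \<in> sets lebesgue"
    by (simp add: E_def sets_restrict_space_iff)
  obtain C T where C: "gdelta C" "negligible T" "E \<union> T = C"
    by (rule lebesgue_set_almost_gdelta[OF E]) (auto simp: negligible_iff_null_sets)
  obtain F :: "nat \<Rightarrow> (real^2) set" where F: "\<And>n. open (F n)" "C = \<Inter> (F ` UNIV)"
    using C(1) unfolding gdelta.simps by blast
  define V where "V n = \<Omega> \<inter> (\<Inter>k\<le>n. F k)" for n
  have V: "open (V n)" "V n \<subseteq> \<Omega>" for n
    unfolding V_def using F(1) open_\<Omega> by (auto intro!: open_Int open_INT)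
  have Vlim: "(\<lambda>n. indicator (V n) x :: real) \<longlonglongrightarrow> indicator (\<Omega> \<inter> C) x" for x
  proof (cases "x \<in> \<Omega> \<inter> C")
    case True
    then have "indicator (V n) x = (1::real)" for n using F(2) by (auto simp: V_def)
    then show ?thesis using True by simp
  next
    case False
    then obtain N where "x \<notin> \<Omega> \<or> x \<notin> F N" using F(2) by auto
    then have "x \<notin> V n" if "n \<ge> N" for n using that by (auto simp: V_def)
    then have "indicator (V n) x = (0::real)" if "n \<ge> N" for n using that by simp
    then have "\<forall>\<^sub>F n in sequentially. indicator (V n) x = (0::real)"
      by (auto simp: eventually_sequentially)
    then show ?thesis using False by (auto intro: tendsto_eventually)
  qed
  have Clb: "C \<in> sets lebesgue"
    using C(2,3) E by (metis negligible_imp_sets sets.Un)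
  have "(\<lambda>n. LINT x|lebesgue_on \<Omega>. g x * indicator (V n) x) \<longlonglongrightarrow> (LINT x|lebesgue_on \<Omega>. g x * indicator (\<Omega> \<inter> C) x)"
  proof (rule integral_dominated_convergence[where w="\<lambda>x. \<bar>g x\<bar>"])
    show "(\<lambda>x. g x * indicator (\<Omega> \<inter> C) x) \<in> borel_measurable (lebesgue_on \<Omega>)"
      by (rule indm) (use Clb in auto)
    show "(\<lambda>x. g x * indicator (V n) x) \<in> borel_measurable (lebesgue_on \<Omega>)" for n
      by (rule indm) (use V in auto)
    show "AE x in lebesgue_on \<Omega>. norm (g x * indicator (V n) x) \<le> \<bar>g x\<bar>" for n
      by (intro AE_I2) (auto simp: indicator_def)
    show "AE x in lebesgue_on \<Omega>. (\<lambda>n. g x * indicator (V n) x) \<longlonglongrightarrow> g x * indicator (\<Omega> \<inter> C) x"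
      using Vlim by (intro AE_I2 tendsto_mult) auto
  qed (use g in auto)
  then have z: "(LINT x|lebesgue_on \<Omega>. g x * indicator (\<Omega> \<inter> C) x) = 0"
    using op[OF V] by (simp add: LIMSEQ_const_iff)
  have Tnull: "AE x in lebesgue_on \<Omega>. x \<notin> T"
    by (rule AE_not_negligible[OF C(2)])
  have "(LINT x|lebesgue_on \<Omega>. max 0 (g x)) = (LINT x|lebesgue_on \<Omega>. g x * indicator (\<Omega> \<inter> C) x)"
  proof (rule integral_cong_AE)
    show "(\<lambda>x. g x * indicator (\<Omega> \<inter> C) x) \<in> borel_measurable (lebesgue_on \<Omega>)"
      by (rule indm) (use Clb in auto)
    have eq: "max 0 (g x) = g x * indicator (\<Omega> \<inter> C) x" if "x \<in> \<Omega>" "x \<notin> T" for x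
      using that C(3) by (auto simp: E_def indicator_def)
    show "AE x in lebesgue_on \<Omega>. max 0 (g x) = g x * indicator (\<Omega> \<inter> C) x"
      using Tnull AE_space[of "lebesgue_on \<Omega>"] by eventually_elim (simp add: eq)
  qed (use gm in auto)
  with z have "(LINT x|lebesgue_on \<Omega>. max 0 (g x)) = 0" by simp
  moreover have "integrable (lebesgue_on \<Omega>) (\<lambda>x. max 0 (g x))"
    using g by (intro Bochner_Integration.integrable_max) auto
  ultimately have "AE x in lebesgue_on \<Omega>. max 0 (g x) = 0"
    using integral_nonneg_eq_0_iff_AE[of "lebesgue_on \<Omega>" "\<lambda>x. max 0 (g x)"] by auto
  then show ?thesis by eventually_elim simp
qed

lemma fundamental_lemma:
  assumes g: "integrable (lebesgue_on \<Omega>) g"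
    and 0: "\<And>\<phi>. \<phi> \<in> test_functions \<Omega> \<Longrightarrow> (LINT x|lebesgue_on \<Omega>. g x * \<phi> x) = 0"
  shows "AE x in lebesgue_on \<Omega>. g x = 0"
proof -
  have "AE x in lebesgue_on \<Omega>. - g x \<le> 0"
    by (rule fundamental_lemma_nonpos) (use g 0 in auto)
  moreover have "AE x in lebesgue_on \<Omega>. g x \<le> 0"
    by (rule fundamental_lemma_nonpos) (use g 0 in auto)
  ultimately show ?thesis
    by eventually_elim simp
qed

end

section \<open>The Sobolev spaces\<close>

context bounded_domain
begin

lemma weak_gradient_L2: "is_weak_gradient \<Omega> u g \<Longrightarrow> g \<in> L2 \<Omega>"
  by (simp add: is_weak_gradient_def)

lemma weak_gradient_unique:
  assumes "is_weak_gradient \<Omega> u g" "is_weak_gradient \<Omega> u g'"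
  shows "AE x in lebesgue_on \<Omega>. g x = g' x"
proof -
  have "AE x in lebesgue_on \<Omega>. g x $ i - g' x $ i = 0" for i
  proof (rule fundamental_lemma)
    have L: "(\<lambda>x. g x $ i) \<in> L2 \<Omega>" "(\<lambda>x. g' x $ i) \<in> L2 \<Omega>"
      using assms by (auto intro!: L2_nth simp: is_weak_gradient_def)
    then show "integrable (lebesgue_on \<Omega>) (\<lambda>x. g x $ i - g' x $ i)"
      by (intro Bochner_Integration.integrable_diff L2_integrable)
    fix \<phi> assume \<phi>: "\<phi> \<in> test_functions \<Omega>"
    have "(LINT x|lebesgue_on \<Omega>. (g x $ i - g' x $ i) * \<phi> x)
        = (LINT x|lebesgue_on \<Omega>. g x $ i * \<phi> x) - (LINT x|lebesgue_on \<Omega>. g' x $ i * \<phi> x)"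
      using L test_function_L2(1)[OF \<phi>] by (simp add: left_diff_distrib L2_mult_integrable)
    also have "\<dots> = 0"
    proof -
      have "(LINT x|lebesgue_on \<Omega>. u x * partial_deriv i \<phi> x) = - (LINT x|lebesgue_on \<Omega>. g x $ i * \<phi> x)"
        "(LINT x|lebesgue_on \<Omega>. u x * partial_deriv i \<phi> x) = - (LINT x|lebesgue_on \<Omega>. g' x $ i * \<phi> x)"
        using assms \<phi> unfolding is_weak_gradient_def by blast+
      then show ?thesis by linarith
    qed
    finally show "(LINT x|lebesgue_on \<Omega>. (g x $ i - g' x $ i) * \<phi> x) = 0" .
  qed
  then have "AE x in lebesgue_on \<Omega>. \<forall>i\<in>UNIV. g x $ i - g' x $ i = 0"
    by (intro AE_finite_allI) auto
  then show ?thesis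
    by eventually_elim (simp add: vec_eq_iff)
qed

lemma weak_gradient_H1: "u \<in> L2 \<Omega> \<Longrightarrow> is_weak_gradient \<Omega> u g \<Longrightarrow> u \<in> H1 \<Omega>"
  by (auto simp: H1_def)

lemma H1_L2: "u \<in> H1 \<Omega> \<Longrightarrow> u \<in> L2 \<Omega>"
  by (simp add: H1_def)

lemma wgrad_weak_gradient: "u \<in> H1 \<Omega> \<Longrightarrow> is_weak_gradient \<Omega> u (wgrad \<Omega> u)"
  unfolding wgrad_def H1_def by (auto intro: someI[where P="is_weak_gradient \<Omega> u"])

lemma wgrad_L2: "u \<in> H1 \<Omega> \<Longrightarrow> wgrad \<Omega> u \<in> L2 \<Omega>"
  using weak_gradient_L2[OF wgrad_weak_gradient] .

text \<open>
  All later computations go through this lemma: any explicitly known weak gradient may replace the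
  chosen one under an integral.
\<close>

lemma wgrad_AE:
  assumes "is_weak_gradient \<Omega> u g"
  shows "AE x in lebesgue_on \<Omega>. wgrad \<Omega> u x = g x"
proof -
  have "is_weak_gradient \<Omega> u (wgrad \<Omega> u)"
    unfolding wgrad_def using assms by (rule someI[where P="is_weak_gradient \<Omega> u"])
  from weak_gradient_unique[OF this assms] show ?thesis .
qed

lemma weak_gradient_lincomb:
  assumes "u \<in> L2 \<Omega>" "v \<in> L2 \<Omega>" "is_weak_gradient \<Omega> u g" "is_weak_gradient \<Omega> v k"
  shows "is_weak_gradient \<Omega> (\<lambda>x. a * u x + b * v x) (\<lambda>x. a *\<^sub>R g x + b *\<^sub>R k x)"
  unfolding is_weak_gradient_def
proof (intro conjI ballI allI)
  have gk: "g \<in> L2 \<Omega>" "k \<in> L2 \<Omega>" using assms weak_gradient_L2 by auto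
  show "(\<lambda>x. a *\<^sub>R g x + b *\<^sub>R k x) \<in> L2 \<Omega>"
    by (intro L2_add L2_scaleR gk)
  fix \<phi> i assume \<phi>: "\<phi> \<in> test_functions \<Omega>"
  note t = test_function_L2[OF \<phi>]
  have "(LINT x|lebesgue_on \<Omega>. (a * u x + b * v x) * partial_deriv i \<phi> x)
     = a * (LINT x|lebesgue_on \<Omega>. u x * partial_deriv i \<phi> x) + b * (LINT x|lebesgue_on \<Omega>. v x * partial_deriv i \<phi> x)"
    using L2_mult_integrable[OF assms(1) t(3)] L2_mult_integrable[OF assms(2) t(3)]
    by (simp add: distrib_right mult.assoc)
  also have "\<dots> = - (a * (LINT x|lebesgue_on \<Omega>. g x $ i * \<phi> x) + b * (LINT x|lebesgue_on \<Omega>. k x $ i * \<phi> x))"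
    using assms(3,4) \<phi> by (simp add: is_weak_gradient_def)
  also have "a * (LINT x|lebesgue_on \<Omega>. g x $ i * \<phi> x) + b * (LINT x|lebesgue_on \<Omega>. k x $ i * \<phi> x)
     = (LINT x|lebesgue_on \<Omega>. (a *\<^sub>R g x + b *\<^sub>R k x) $ i * \<phi> x)"
    using L2_mult_integrable[OF L2_nth[OF gk(1), of i] t(1)] L2_mult_integrable[OF L2_nth[OF gk(2), of i] t(1)]
    by (simp add: distrib_right mult.assoc)
  finally show "(LINT x|lebesgue_on \<Omega>. (a * u x + b * v x) * partial_deriv i \<phi> x)
     = - (LINT x|lebesgue_on \<Omega>. (a *\<^sub>R g x + b *\<^sub>R k x) $ i * \<phi> x)" .
qed

lemma H1_lincomb:
  assumes "u \<in> H1 \<Omega>" "v \<in> H1 \<Omega>"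
  shows "(\<lambda>x. a * u x + b * v x) \<in> H1 \<Omega>"
  using weak_gradient_H1[OF L2_lincomb weak_gradient_lincomb] H1_L2 wgrad_weak_gradient assms by blast

lemma wgrad_lincomb:
  assumes "u \<in> H1 \<Omega>" "v \<in> H1 \<Omega>"
  shows "AE x in lebesgue_on \<Omega>. wgrad \<Omega> (\<lambda>x. a * u x + b * v x) x = a *\<^sub>R wgrad \<Omega> u x + b *\<^sub>R wgrad \<Omega> v x"
  using assms by (intro wgrad_AE weak_gradient_lincomb) (auto intro: H1_L2 wgrad_weak_gradient)

lemma test_function_weak_gradient:
  assumes "\<phi> \<in> test_functions \<Omega>"
  shows "is_weak_gradient \<Omega> \<phi> (grad \<phi>)"
  unfolding is_weak_gradient_def
proof (intro conjI ballI allI)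
  show "grad \<phi> \<in> L2 \<Omega>" by (rule test_function_L2[OF assms])
  fix \<psi> i assume \<psi>: "\<psi> \<in> test_functions \<Omega>"
  obtain S where S: "compact S" "S \<subseteq> \<Omega>" "\<And>x. x \<notin> S \<Longrightarrow> \<phi> x = 0"
    using test_function_support[OF assms] by blast
  obtain T where T: "compact T" "T \<subseteq> \<Omega>" "\<And>x. x \<notin> T \<Longrightarrow> \<psi> x = 0"
    using test_function_support[OF \<psi>] by blast
  have c1: "Ck 1 \<phi>" "Ck 1 \<psi>" using test_function_Ck assms \<psi> by blast+
  have m: "\<phi> \<in> borel_measurable borel" "\<psi> \<in> borel_measurable borel"
    "partial_deriv i \<phi> \<in> borel_measurable borel" "partial_deriv i \<psi> \<in> borel_measurable borel"
    using c1 Ck_continuous[OF c1(1)] Ck_continuous[OF c1(2)]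
    by (auto intro: borel_measurable_continuous_onI)
  have "(LINT x|lebesgue_on \<Omega>. \<phi> x * partial_deriv i \<psi> x) = (LINT x|lborel. \<phi> x * partial_deriv i \<psi> x)"
    by (rule integral_supported) (use m S in auto)
  also have "\<dots> = - (LINT x|lborel. partial_deriv i \<phi> x * \<psi> x)"
    by (rule integration_by_parts[OF c1 T(1,3)])
  also have "(LINT x|lborel. partial_deriv i \<phi> x * \<psi> x) = (LINT x|lebesgue_on \<Omega>. partial_deriv i \<phi> x * \<psi> x)"
    by (rule integral_supported(1)[symmetric]) (use m T in auto)
  finally show "(LINT x|lebesgue_on \<Omega>. \<phi> x * partial_deriv i \<psi> x) = - (LINT x|lebesgue_on \<Omega>. grad \<phi> x $ i * \<psi> x)"
    by simp
qed

lemma test_function_H1: "\<phi> \<in> test_functions \<Omega> \<Longrightarrow> \<phi> \<in> H1 \<Omega>"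
  using weak_gradient_H1 test_function_L2(1) test_function_weak_gradient by blast

subsection \<open>The energy forms\<close>

lemma L2_inner_lincomb:
  fixes u v w :: "real^2 \<Rightarrow> real"
  assumes "u \<in> L2 \<Omega>" "v \<in> L2 \<Omega>" "w \<in> L2 \<Omega>"
  shows "L2_inner \<Omega> (\<lambda>x. a * u x + b * v x) w = a * L2_inner \<Omega> u w + b * L2_inner \<Omega> v w"
  using L2_mult_integrable[OF assms(1,3)] L2_mult_integrable[OF assms(2,3)]
  by (simp add: L2_inner_def distrib_right mult.assoc)

lemma L2_inner_commute: "L2_inner \<Omega> u v = L2_inner \<Omega> v u"
  by (simp add: L2_inner_def mult.commute)

lemma L2_inner_self: "L2_inner \<Omega> u u = (L2_norm \<Omega> u)\<^sup>2"
  by (simp add: L2_inner_def L2_norm_def power2_eq_square)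

lemma bilin_sum:
  "(A *v \<xi>) \<bullet> \<eta> = (\<Sum>i\<in>UNIV. \<Sum>j\<in>UNIV. A $ i $ j * \<xi> $ j * \<eta> $ i)" for A :: "real^2^2"
  by (simp add: matrix_vector_mult_def inner_vec_def sum_distrib_right)

lemma coefficient_integrable:
  assumes A: "elliptic_coefficient \<Omega> \<alpha> \<beta> A" and "g \<in> L2 \<Omega>" "k \<in> L2 \<Omega>"
  shows "integrable (lebesgue_on \<Omega>) (\<lambda>x. (A x *v g x) \<bullet> k x)"
proof -
  obtain M where M: "\<And>x. x \<in> \<Omega> \<Longrightarrow> norm (A x) \<le> M"
    using A unfolding elliptic_coefficient_def bounded_iff by auto
  have m: "(\<lambda>x. A x $ i $ j) \<in> borel_measurable (lebesgue_on \<Omega>)" for i j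
    using A by (auto simp: elliptic_coefficient_def intro!: borel_measurable_continuous_on[where f="\<lambda>v. v $ i $ j"]
      continuous_intros)
  have b: "\<bar>A x $ i $ j\<bar> \<le> M" if "x \<in> \<Omega>" for x i j
    using M[OF that] component_le_norm_cart[of "A x $ i" j] Finite_Cartesian_Product.norm_nth_le[of "A x" i]
    by (metis order_trans)
  have "integrable (lebesgue_on \<Omega>) (\<lambda>x. (g x $ j * k x $ i) * A x $ i $ j)" for i j
    by (rule integrable_bounded_mult[OF L2_mult_integrable m b]) (use assms in \<open>auto intro: L2_nth\<close>)
  then have "integrable (lebesgue_on \<Omega>) (\<lambda>x. A x $ i $ j * g x $ j * k x $ i)" for i j
    by (simp add: mult_ac)
  then show ?thesis
    unfolding bilin_sum by (intro Bochner_Integration.integrable_sum)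
qed

lemma bilin_cong_AE:
  assumes A: "elliptic_coefficient \<Omega> \<alpha> \<beta> A" and uv: "u \<in> H1 \<Omega>" "v \<in> H1 \<Omega>" and gk: "g \<in> L2 \<Omega>" "k \<in> L2 \<Omega>"
    and ae: "AE x in lebesgue_on \<Omega>. wgrad \<Omega> u x = g x" "AE x in lebesgue_on \<Omega>. wgrad \<Omega> v x = k x"
  shows "bilin \<Omega> A u v = (LINT x|lebesgue_on \<Omega>. (A x *v g x) \<bullet> k x)"
  unfolding bilin_def
proof (rule integral_cong_AE)
  show "(\<lambda>x. (A x *v wgrad \<Omega> u x) \<bullet> wgrad \<Omega> v x) \<in> borel_measurable (lebesgue_on \<Omega>)"
    using coefficient_integrable[OF A wgrad_L2[OF uv(1)] wgrad_L2[OF uv(2)]] by simp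
  show "(\<lambda>x. (A x *v g x) \<bullet> k x) \<in> borel_measurable (lebesgue_on \<Omega>)"
    using coefficient_integrable[OF A gk] by simp
  show "AE x in lebesgue_on \<Omega>. (A x *v wgrad \<Omega> u x) \<bullet> wgrad \<Omega> v x = (A x *v g x) \<bullet> k x"
    using ae by eventually_elim simp
qed

text \<open>
  Linear combinations are kept in the rigid form \<open>a * u x + b * v x\<close>, also with \<open>a = 1\<close> and
  \<open>b = - 1\<close>: there is no vector space of functions modulo null sets, and the rigid form is what the
  lemmas on weak gradients match.
\<close>

lemma bilin_lincomb:
  assumes A: "elliptic_coefficient \<Omega> \<alpha> \<beta> A" and uv: "u \<in> H1 \<Omega>" "v \<in> H1 \<Omega>" "w \<in> H1 \<Omega>"
  shows "bilin \<Omega> A (\<lambda>x. a * u x + b * v x) w = a * bilin \<Omega> A u w + b * bilin \<Omega> A v w"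
proof -
  note L = uv[THEN wgrad_L2]
  have "bilin \<Omega> A (\<lambda>x. a * u x + b * v x) w
      = (LINT x|lebesgue_on \<Omega>. (A x *v (a *\<^sub>R wgrad \<Omega> u x + b *\<^sub>R wgrad \<Omega> v x)) \<bullet> wgrad \<Omega> w x)"
    by (rule bilin_cong_AE[OF A H1_lincomb[OF uv(1,2)] uv(3) _ L(3) wgrad_lincomb[OF uv(1,2)]])
      (rule L2_add[OF L2_scaleR[OF L(1)] L2_scaleR[OF L(2)]], simp)
  also have "\<dots> = (LINT x|lebesgue_on \<Omega>. a * ((A x *v wgrad \<Omega> u x) \<bullet> wgrad \<Omega> w x) + b * ((A x *v wgrad \<Omega> v x) \<bullet> wgrad \<Omega> w x))"
    by (simp add: matrix_vector_right_distrib inner_add_left matrix_vector_mult_scaleR)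
  also have "\<dots> = a * bilin \<Omega> A u w + b * bilin \<Omega> A v w"
    using coefficient_integrable[OF A L(1,3)] coefficient_integrable[OF A L(2,3)] by (simp add: bilin_def)
  finally show ?thesis .
qed

lemma bilin_commute:
  assumes A: "elliptic_coefficient \<Omega> \<alpha> \<beta> A"
  shows "bilin \<Omega> A u v = bilin \<Omega> A v u"
  unfolding bilin_def
proof (rule Bochner_Integration.integral_cong[OF refl])
  fix x assume "x \<in> space (lebesgue_on \<Omega>)"
  then have s: "A x $ i $ j = A x $ j $ i" for i j
    using A by (auto simp: elliptic_coefficient_def)
  show "(A x *v wgrad \<Omega> u x) \<bullet> wgrad \<Omega> v x = (A x *v wgrad \<Omega> v x) \<bullet> wgrad \<Omega> u x"
    unfolding bilin_sum by (subst sum.swap) (simp add: s mult_ac)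
qed

lemma norm_square_integrable: "(g :: real^2 \<Rightarrow> real^2) \<in> L2 \<Omega> \<Longrightarrow> integrable (lebesgue_on \<Omega>) (\<lambda>x. (norm (g x))\<^sup>2)"
  by (simp add: L2_def)

lemma L2_norm_square: "(L2_norm \<Omega> g)\<^sup>2 = (LINT x|lebesgue_on \<Omega>. (norm (g x))\<^sup>2)"
  by (simp add: L2_norm_def)

lemma bilin_coercive:
  assumes A: "elliptic_coefficient \<Omega> \<alpha> \<beta> A" and u: "u \<in> H1 \<Omega>"
  shows "\<alpha> * (L2_norm \<Omega> (wgrad \<Omega> u))\<^sup>2 \<le> bilin \<Omega> A u u"
proof -
  have "(LINT x|lebesgue_on \<Omega>. \<alpha> * (norm (wgrad \<Omega> u x))\<^sup>2) \<le> bilin \<Omega> A u u"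
    unfolding bilin_def
  proof (rule integral_mono)
    show "\<alpha> * (norm (wgrad \<Omega> u x))\<^sup>2 \<le> (A x *v wgrad \<Omega> u x) \<bullet> wgrad \<Omega> u x" if "x \<in> space (lebesgue_on \<Omega>)" for x
      using A that by (simp add: elliptic_coefficient_def bilin_sum mult_ac)
  qed (auto intro!: coefficient_integrable[OF A] norm_square_integrable wgrad_L2 u)
  then show ?thesis by (simp add: L2_norm_square)
qed

text \<open>
  The Dirichlet form is the case of the identity matrix, so its linearity and symmetry need no separate
  proof.
\<close>

lemma identity_coefficient: "elliptic_coefficient \<Omega> 1 1 (\<lambda>_. mat 1)"
proof -
  have "(\<Sum>i\<in>UNIV. \<Sum>j\<in>UNIV. (mat 1 :: real^2^2) $ i $ j * \<xi> $ i * \<xi> $ j) = (norm \<xi>)\<^sup>2" for \<xi>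
    using bilin_sum[of "mat 1" \<xi> \<xi>] by (simp add: power2_norm_eq_inner mult_ac)
  moreover have "(mat 1 :: real^2^2) $ i $ j = mat 1 $ j $ i" for i j
    by (simp add: mat_def)
  moreover have "bounded ((\<lambda>_. mat 1 :: real^2^2) ` \<Omega>)"
    by (rule bounded_subset[of "{mat 1}"]) auto
  ultimately show ?thesis
    by (simp add: elliptic_coefficient_def)
qed

text \<open>
  The two weights let the same lemmas serve the \<open>L\<^sup>2\<close> product (weights 1 and 0), the energy
  seminorm (0 and 1), the \<open>H\<^sup>1\<close> product (1 and 1) and the product with weights 1 and \<open>h\<^sup>2\<close>
  that is hidden in the interpolation.
\<close>

definition wform :: "real \<Rightarrow> real \<Rightarrow> (real^2 \<Rightarrow> real) \<Rightarrow> (real^2 \<Rightarrow> real) \<Rightarrow> real" where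
  "wform p c u v = p * L2_inner \<Omega> u v + c * bilin \<Omega> (\<lambda>_. mat 1) u v"

lemma wform_lincomb:
  assumes "u \<in> H1 \<Omega>" "v \<in> H1 \<Omega>" "w \<in> H1 \<Omega>"
  shows "wform p c (\<lambda>x. a * u x + b * v x) w = a * wform p c u w + b * wform p c v w"
  using assms by (simp add: wform_def L2_inner_lincomb H1_L2 bilin_lincomb[OF identity_coefficient] algebra_simps)

lemma wform_commute: "wform p c u v = wform p c v u"
  by (simp add: wform_def L2_inner_commute[of u v] bilin_commute[OF identity_coefficient, of u v])

lemma wform_self: "wform p c u u = p * (L2_norm \<Omega> u)\<^sup>2 + c * (L2_norm \<Omega> (wgrad \<Omega> u))\<^sup>2"
  by (simp add: wform_def L2_inner_self bilin_def L2_norm_square power2_norm_eq_inner)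

lemma wform_nonneg: "p \<ge> 0 \<Longrightarrow> c \<ge> 0 \<Longrightarrow> wform p c u u \<ge> 0"
  by (simp add: wform_self)

lemma H1_norm_square: "(H1_norm \<Omega> u)\<^sup>2 = wform 1 1 u u"
  by (simp add: H1_norm_def wform_self)

lemma H1_norm_nonneg: "H1_norm \<Omega> u \<ge> 0"
  by (simp add: H1_norm_def)

lemma wform_expand:
  assumes "u \<in> H1 \<Omega>" "v \<in> H1 \<Omega>"
  shows "wform p c (\<lambda>x. a * u x + b * v x) (\<lambda>x. a * u x + b * v x)
    = a\<^sup>2 * wform p c u u + 2 * a * b * wform p c u v + b\<^sup>2 * wform p c v v"
proof -
  have "wform p c (\<lambda>x. a * u x + b * v x) (\<lambda>x. a * u x + b * v x)
    = a * wform p c (\<lambda>x. a * u x + b * v x) u + b * wform p c (\<lambda>x. a * u x + b * v x) v"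
    using assms wform_commute
    by (subst wform_lincomb[OF assms H1_lincomb[OF assms]]) metis
  also have "\<dots> = a * (a * wform p c u u + b * wform p c v u) + b * (a * wform p c u v + b * wform p c v v)"
    by (simp add: wform_lincomb[OF assms(1,2,1)] wform_lincomb[OF assms(1,2,2)])
  finally show ?thesis
    by (simp add: wform_commute[of p c v u] power2_eq_square algebra_simps)
qed

text \<open>
  The parallelogram law without the second square; it takes the place of the triangle inequality.
\<close>

lemma wform_lincomb_le:
  assumes "u \<in> H1 \<Omega>" "v \<in> H1 \<Omega>" "p \<ge> 0" "c \<ge> 0"
  shows "wform p c (\<lambda>x. a * u x + b * v x) (\<lambda>x. a * u x + b * v x) \<le> 2 * a\<^sup>2 * wform p c u u + 2 * b\<^sup>2 * wform p c v v"
proof -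
  have "0 \<le> a\<^sup>2 * wform p c u u - 2 * a * b * wform p c u v + b\<^sup>2 * wform p c v v"
    using wform_expand[OF assms(1,2), of p c a "- b"]
      wform_nonneg[OF assms(3,4), of "\<lambda>x. a * u x + (- b) * v x"] by simp
  then show ?thesis
    using wform_expand[OF assms(1,2), of p c a b] by linarith
qed

subsection \<open>Functions vanishing on the boundary\<close>

lemma H10_H1: "u \<in> H10 \<Omega> \<Longrightarrow> u \<in> H1 \<Omega>"
  by (simp add: H10_def)

lemma H10_iff:
  "u \<in> H10 \<Omega> \<longleftrightarrow> u \<in> H1 \<Omega> \<and>
    (\<forall>e>0. \<exists>\<phi>\<in>test_functions \<Omega>. wform 1 1 (\<lambda>x. 1 * u x + (- 1) * \<phi> x) (\<lambda>x. 1 * u x + (- 1) * \<phi> x) < e)"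
proof -
  have "(\<forall>e>0. \<exists>\<phi>\<in>test_functions \<Omega>. H1_norm \<Omega> (\<lambda>x. u x - \<phi> x) < e) \<longleftrightarrow>
    (\<forall>e>0. \<exists>\<phi>\<in>test_functions \<Omega>. (H1_norm \<Omega> (\<lambda>x. u x - \<phi> x))\<^sup>2 < e)" (is "?L \<longleftrightarrow> ?R")
  proof
    assume L: ?L
    show ?R
    proof (intro allI impI)
      fix e :: real assume "e > 0"
      then obtain \<phi> where "\<phi> \<in> test_functions \<Omega>" "H1_norm \<Omega> (\<lambda>x. u x - \<phi> x) < sqrt e"
        using L by (meson real_sqrt_gt_zero)
      then show "\<exists>\<phi>\<in>test_functions \<Omega>. (H1_norm \<Omega> (\<lambda>x. u x - \<phi> x))\<^sup>2 < e"
        using \<open>e > 0\<close> by (intro bexI[of _ \<phi>]) (auto simp: H1_norm_nonneg real_less_rsqrt dest: power_strict_mono[of _ _ 2, OF _ H1_norm_nonneg])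
    qed
  next
    assume R: ?R
    show ?L
    proof (intro allI impI)
      fix e :: real assume "e > 0"
      then obtain \<phi> where "\<phi> \<in> test_functions \<Omega>" "(H1_norm \<Omega> (\<lambda>x. u x - \<phi> x))\<^sup>2 < e\<^sup>2"
        using R by (meson zero_less_power)
      then show "\<exists>\<phi>\<in>test_functions \<Omega>. H1_norm \<Omega> (\<lambda>x. u x - \<phi> x) < e"
        using \<open>e > 0\<close> by (auto dest: power_less_imp_less_base)
    qed
  qed
  then show ?thesis by (simp add: H10_def H1_norm_square)
qed

lemma H10_lincomb:
  assumes "u \<in> H10 \<Omega>" "v \<in> H10 \<Omega>"
  shows "(\<lambda>x. a * u x + b * v x) \<in> H10 \<Omega>"
  unfolding H10_iff
proof (intro conjI allI impI)
  show "(\<lambda>x. a * u x + b * v x) \<in> H1 \<Omega>"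
    by (intro H1_lincomb H10_H1 assms)
  fix e :: real assume e: "e > 0"
  define d where "d = e / (4 * (1 + a\<^sup>2 + b\<^sup>2))"
  have s: "1 + a\<^sup>2 + b\<^sup>2 > 0" by (simp add: add_pos_nonneg)
  then have d: "d > 0" using e by (simp add: d_def)
  let ?f = "\<lambda>u \<phi> x. 1 * u x + (- 1) * \<phi> x"
  obtain \<phi> where \<phi>: "\<phi> \<in> test_functions \<Omega>" "wform 1 1 (?f u \<phi>) (?f u \<phi>) < d"
    using assms(1) d unfolding H10_iff by meson
  obtain \<psi> where \<psi>: "\<psi> \<in> test_functions \<Omega>" "wform 1 1 (?f v \<psi>) (?f v \<psi>) < d"
    using assms(2) d unfolding H10_iff by meson
  have h: "?f u \<phi> \<in> H1 \<Omega>" "?f v \<psi> \<in> H1 \<Omega>"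
    by (intro H1_lincomb H10_H1 assms test_function_H1 \<phi> \<psi>)+
  let ?q = "\<lambda>x. a * \<phi> x + b * \<psi> x"
  let ?w = "\<lambda>x. a * ?f u \<phi> x + b * ?f v \<psi> x"
  have eq: "(\<lambda>x. 1 * (a * u x + b * v x) + (- 1) * ?q x) = ?w"
    by (simp add: fun_eq_iff algebra_simps)
  have "wform 1 1 ?w ?w \<le> 2 * a\<^sup>2 * wform 1 1 (?f u \<phi>) (?f u \<phi>) + 2 * b\<^sup>2 * wform 1 1 (?f v \<psi>) (?f v \<psi>)"
    by (rule wform_lincomb_le[OF h]) simp_all
  also have "\<dots> \<le> 2 * a\<^sup>2 * d + 2 * b\<^sup>2 * d"
    using \<phi>(2) \<psi>(2) by (intro add_mono mult_left_mono) auto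
  also have "\<dots> < 4 * (1 + a\<^sup>2 + b\<^sup>2) * d"
  proof -
    have "0 \<le> a\<^sup>2 * d" "0 \<le> b\<^sup>2 * d" using d by simp_all
    moreover have "4 * (1 + a\<^sup>2 + b\<^sup>2) * d = 4 * d + 4 * (a\<^sup>2 * d) + 4 * (b\<^sup>2 * d)"
      by (simp add: algebra_simps)
    ultimately show ?thesis using d by linarith
  qed
  also have "\<dots> = e" using s by (simp add: d_def)
  finally show "\<exists>q\<in>test_functions \<Omega>. wform 1 1 (\<lambda>x. 1 * (a * u x + b * v x) + (- 1) * q x) (\<lambda>x. 1 * (a * u x + b * v x) + (- 1) * q x) < e"
    using test_function_lincomb[OF \<phi>(1) \<psi>(1), of a b] by (intro bexI[of _ ?q]) (simp_all only: eq)
qed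

lemma zero_H10: "(\<lambda>x. 0) \<in> H10 \<Omega>"
proof -
  have "wform 1 1 (\<lambda>x. 0 * 0 + 0 * 0) (\<lambda>x. 0) = 0 * wform 1 1 (\<lambda>x. 0) (\<lambda>x. 0) + 0 * wform 1 1 (\<lambda>x. 0) (\<lambda>x. 0)"
    using test_function_H1[OF zero_test_function] by (rule wform_lincomb)
      (use test_function_H1[OF zero_test_function] in auto)
  then have "wform 1 1 (\<lambda>x. 0) (\<lambda>x. 0) = 0" by simp
  then show ?thesis
    unfolding H10_iff using test_function_H1[OF zero_test_function] zero_test_function
    by (auto intro!: bexI[of _ "\<lambda>x. 0"])
qed

lemma H10_sum:
  assumes "finite I" "\<And>i. i \<in> I \<Longrightarrow> f i \<in> H10 \<Omega>"
  shows "(\<lambda>x. \<Sum>i\<in>I. c i * f i x) \<in> H10 \<Omega>"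
  using assms
proof (induction I rule: finite_induct)
  case empty
  then show ?case by (simp add: zero_H10)
next
  case (insert i I)
  have "(\<lambda>x. c i * f i x + 1 * (\<Sum>i\<in>I. c i * f i x)) \<in> H10 \<Omega>"
    using insert by (intro H10_lincomb) auto
  then show ?case using insert by simp
qed

end

section \<open>Piecewise affine functions vanishing on the boundary\<close>

locale convex_domain = bounded_domain +
  fixes x0 :: "real^2" and r0 :: real
  assumes convex_\<Omega>: "convex \<Omega>" and r0: "r0 > 0" and ball_\<Omega>: "cball x0 r0 \<subseteq> \<Omega>"
begin

text \<open>The dilation about the centre \<open>x0\<close> of a ball inside the domain.\<close>

definition stretch :: "real \<Rightarrow> real^2 \<Rightarrow> real^2" where
  "stretch d x = x0 + (1 + d) *\<^sub>R (x - x0)"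

lemma stretch_diff: "stretch d x - stretch d y = (1 + d) *\<^sub>R (x - y)"
  by (simp add: stretch_def algebra_simps)

lemma stretch_self_diff: "stretch d x - x = d *\<^sub>R (x - x0)"
  by (simp add: stretch_def algebra_simps)

text \<open>
  The point \<open>x\<close> is a convex combination, with weights \<open>1 / (1 + d)\<close> and \<open>d / (1 + d)\<close>, of the
  given point of the closure and of a point of the ball around the centre.
\<close>

lemma stretch_into_domain:
  assumes d: "d > 0" and z: "norm z \<le> d * r0" and cl: "stretch d x + z \<in> closure \<Omega>"
  shows "x \<in> \<Omega>"
proof -
  define y where "y = x0 - (1 / d) *\<^sub>R z"
  have "norm ((1 / d) *\<^sub>R z) \<le> r0"
    using d z by (simp add: field_simps)
  then have "y \<in> interior \<Omega>"
    using ball_\<Omega> open_\<Omega> by (auto simp: y_def dist_norm interior_open)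
  then have "(stretch d x + z) - (d / (1 + d)) *\<^sub>R ((stretch d x + z) - y) \<in> interior \<Omega>"
    using d by (intro mem_interior_closure_convex_shrink[OF convex_\<Omega> _ cl]) auto
  moreover have "(stretch d x + z) - (d / (1 + d)) *\<^sub>R ((stretch d x + z) - y) = x"
  proof -
    have "(1 + d) *\<^sub>R ((stretch d x + z) - (d / (1 + d)) *\<^sub>R ((stretch d x + z) - y))
      = (1 + d) *\<^sub>R (stretch d x + z) - d *\<^sub>R ((stretch d x + z) - y)"
      using d by (simp add: scaleR_diff_right)
    also have "\<dots> = stretch d x + z + d *\<^sub>R y"
      by (simp add: algebra_simps)
    also have "d *\<^sub>R y = d *\<^sub>R x0 - z"
      using d by (simp add: y_def scaleR_diff_right)
    also have "stretch d x + z + (d *\<^sub>R x0 - z) = (1 + d) *\<^sub>R x"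
      by (simp add: stretch_def algebra_simps)
    finally show ?thesis using d by simp
  qed
  ultimately show ?thesis
    using interior_subset by auto
qed

lemma domain_radius:
  obtains R where "R > 0" "\<And>x. x \<in> closure \<Omega> \<Longrightarrow> norm (x - x0) \<le> R"
proof -
  have "bounded ((\<lambda>x. x - x0) ` closure \<Omega>)"
    using bounded_\<Omega> by (intro bounded_translation_minus) auto
  then show thesis
    using that unfolding bounded_pos by auto
qed

context
  fixes w :: "real^2 \<Rightarrow> real" and g :: "real^2 \<Rightarrow> real^2" and L M :: real and N :: "(real^2) set"
  assumes L: "L-lipschitz_on UNIV w" and w0: "\<And>x. x \<notin> \<Omega> \<Longrightarrow> w x = 0"
    and N: "negligible N"
    and aff: "\<And>x. x \<in> \<Omega> - N \<Longrightarrow> \<exists>r>0. \<exists>c. \<forall>y\<in>ball x r. w y = c + g x \<bullet> y"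
    and gm: "g \<in> borel_measurable (lebesgue_on \<Omega>)" and gb: "\<And>x. x \<in> \<Omega> \<Longrightarrow> norm (g x) \<le> M"
begin

text \<open>
  Stretching pushes the support of \<open>w\<close> away from the boundary; mollification on a smaller scale then
  gives test functions. Their gradients are bounded by the Lipschitz constant and, near a point
  where \<open>w\<close> is affine, eventually equal to the gradient of the stretched function.
\<close>

lemma test_function_approximation:
  obtains \<phi> B where "\<And>n. \<phi> n \<in> test_functions \<Omega>"
    "\<And>x. x \<in> \<Omega> \<Longrightarrow> (\<lambda>n. \<phi> n x) \<longlonglongrightarrow> w x"
    "\<And>n x. x \<in> \<Omega> \<Longrightarrow> \<bar>\<phi> n x - w x\<bar> \<le> B"
    "\<And>n x. norm (grad (\<phi> n) x) \<le> B"
    "\<And>x. x \<in> \<Omega> - N \<Longrightarrow> (\<lambda>n. grad (\<phi> n) x) \<longlonglongrightarrow> g x"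
proof -
  obtain R where R: "R > 0" "\<And>x. x \<in> closure \<Omega> \<Longrightarrow> norm (x - x0) \<le> R"
    using domain_radius by blast
  have L0: "L \<ge> 0" using lipschitz_on_nonneg[OF L] .
  define d where "d n = inverse (real (Suc n))" for n
  have d: "d n > 0" "d n \<le> 1" "d \<longlonglongrightarrow> 0" for n
    using LIMSEQ_inverse_real_of_nat by (auto simp: d_def[abs_def] inverse_le_1_iff)
  \<comment> \<open>half of the admissible distance, since the stretching may double distances\<close>
  define e where "e n = d n * r0 / 2" for n
  have e: "e n > 0" for n using d r0 by (simp add: e_def)
  have elim: "e \<longlonglongrightarrow> 0"
    unfolding e_def[abs_def] using tendsto_mult_left[OF d(3), of "r0 / 2"] by (simp add: mult_ac)
  have "\<exists>\<rho>. mollifier (e n) \<rho>" for n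
    using mollifier_exists[OF e(1)[of n]] unfolding mollifier_def by metis
  then obtain \<rho> where \<rho>: "\<And>n. mollifier (e n) (\<rho> n)" by metis
  define v where "v n x = w (stretch (d n) x)" for n x
  have lipv: "(2 * L)-lipschitz_on UNIV (v n)" for n
  proof (rule lipschitz_onI)
    fix x y
    have "dist (v n x) (v n y) \<le> L * norm ((1 + d n) *\<^sub>R (x - y))"
      using lipschitz_onD[OF L, of "stretch (d n) x" "stretch (d n) y"]
      by (simp add: v_def dist_norm stretch_diff)
    also have "\<dots> \<le> L * (2 * norm (x - y))"
      using d(1,2)[of n] L0 unfolding norm_scaleR by (intro mult_left_mono mult_right_mono) auto
    finally show "dist (v n x) (v n y) \<le> 2 * L * dist x y"
      by (simp add: dist_norm mult_ac)
  qed (use L0 in simp)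
  define S where "S n = (\<lambda>y. x0 + (1 / (1 + d n)) *\<^sub>R (y - x0)) ` closure \<Omega>" for n
  have S: "compact (S n)" for n
    unfolding S_def using bounded_\<Omega>
    by (intro compact_continuous_image continuous_intros) (simp add: compact_closure)
  have S_iff: "x \<in> S n \<longleftrightarrow> stretch (d n) x \<in> closure \<Omega>" for x n
  proof
    assume "x \<in> S n"
    then obtain y where "y \<in> closure \<Omega>" "x = x0 + (1 / (1 + d n)) *\<^sub>R (y - x0)"
      by (auto simp: S_def)
    then show "stretch (d n) x \<in> closure \<Omega>" using d(1)[of n] by (simp add: stretch_def)
  next
    assume *: "stretch (d n) x \<in> closure \<Omega>"
    have "x = x0 + (1 / (1 + d n)) *\<^sub>R (stretch (d n) x - x0)"
      using d(1)[of n] by (simp add: stretch_def)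
    with * show "x \<in> S n" unfolding S_def by blast
  qed
  have v0: "v n x = 0" if "x \<notin> S n" for n x
  proof -
    have "stretch (d n) x \<notin> \<Omega>" using that S_iff closure_subset by blast
    then show ?thesis by (simp add: v_def w0)
  qed
  note mo = \<rho> lipv S v0
  define \<phi> where "\<phi> n = conv (\<rho> n) (v n)" for n
  have test: "\<phi> n \<in> test_functions \<Omega>" for n
  proof (rule test_functionI)
    show "Ck k (\<phi> n)" for k unfolding \<phi>_def by (rule Ck_mollify[OF mo])
    show "compact {x + z | x z. x \<in> S n \<and> z \<in> cball 0 (e n)}"
      by (intro compact_sums S compact_cball)
    show "{x + z | x z. x \<in> S n \<and> z \<in> cball 0 (e n)} \<subseteq> \<Omega>"
    proof safe
      fix x z assume x: "x \<in> S n" and z: "z \<in> cball (0::real^2) (e n)"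
      show "x + z \<in> \<Omega>"
      proof (rule stretch_into_domain[OF d(1)[of n]])
        have "stretch (d n) (x + z) + - ((1 + d n) *\<^sub>R z) = stretch (d n) x"
          by (simp add: stretch_def algebra_simps)
        then show "stretch (d n) (x + z) + - ((1 + d n) *\<^sub>R z) \<in> closure \<Omega>"
          using x S_iff by simp
        have "norm (- ((1 + d n) *\<^sub>R z)) \<le> 2 * e n"
          using z d(1,2)[of n] e[of n] unfolding norm_minus_cancel norm_scaleR by (intro mult_mono) auto
        then show "norm (- ((1 + d n) *\<^sub>R z)) \<le> d n * r0" by (simp add: e_def)
      qed
    qed
    fix x assume x: "x \<notin> {x + z | x z. x \<in> S n \<and> z \<in> cball 0 (e n)}"
    show "\<phi> n x = 0"
    proof (rule ccontr)
      assume "\<phi> n x \<noteq> 0"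
      then obtain y where y: "norm (x - y) \<le> e n" "v n y \<noteq> 0"
        unfolding \<phi>_def using conv_support[OF mo] by blast
      then have "y \<in> S n" using v0 by blast
      moreover have "x = y + (x - y)" by simp
      ultimately show False using x y(1) by (metis (mono_tags, lifting) mem_Collect_eq mem_cball_0)
    qed
  qed
  have near: "\<bar>\<phi> n x - w x\<bar> \<le> (L * r0 + L * R) * d n" if "x \<in> \<Omega>" for n x
  proof -
    have "\<bar>\<phi> n x - v n x\<bar> \<le> 2 * L * e n"
      unfolding \<phi>_def using conv_close[OF \<rho>[of n] lipv[of n] S[of n] v0, of x] .
    moreover have "\<bar>v n x - w x\<bar> \<le> L * (d n * R)"
    proof -
      have "\<bar>v n x - w x\<bar> \<le> L * norm (d n *\<^sub>R (x - x0))"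
        using lipschitz_onD[OF L, of "stretch (d n) x" x] by (simp add: v_def dist_norm stretch_self_diff)
      also have "\<dots> \<le> L * (d n * R)"
        using R(2)[of x] that closure_subset d(1)[of n] L0 by (auto intro!: mult_left_mono)
      finally show ?thesis .
    qed
    ultimately show ?thesis by (simp add: e_def algebra_simps)
  qed
  show thesis
  proof (rule that[OF test, where B="max (L * r0 + L * R) (2 * L)"])
    have K: "L * r0 + L * R \<ge> 0" using L0 r0 R by simp
    show "\<bar>\<phi> n x - w x\<bar> \<le> max (L * r0 + L * R) (2 * L)" if "x \<in> \<Omega>" for n x
      using near[OF that, of n] mult_left_mono[OF d(2)[of n] K] by simp
    show "(\<lambda>n. \<phi> n x) \<longlonglongrightarrow> w x" if "x \<in> \<Omega>" for x
    proof (rule LIM_zero_cancel, rule Lim_null_comparison)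
      show "\<forall>\<^sub>F n in sequentially. norm (\<phi> n x - w x) \<le> (L * r0 + L * R) * d n"
        using near[OF that] by simp
      show "(\<lambda>n. (L * r0 + L * R) * d n) \<longlonglongrightarrow> 0"
        by (rule tendsto_mult_right_zero[OF d(3)])
    qed
    show "norm (grad (\<phi> n) x) \<le> max (L * r0 + L * R) (2 * L)" for n x
      unfolding \<phi>_def using grad_conv_bound[OF \<rho>[of n] lipv[of n] S[of n] v0, of x] by simp
    show "(\<lambda>n. grad (\<phi> n) x) \<longlonglongrightarrow> g x" if x: "x \<in> \<Omega> - N" for x
    proof -
      obtain r c where r: "r > 0" "\<And>y. y \<in> ball x r \<Longrightarrow> w y = c + g x \<bullet> y"
        using aff[OF x] by blast
      have "\<forall>\<^sub>F n in sequentially. d n < r / (2 * R)" "\<forall>\<^sub>F n in sequentially. e n < r / 4"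
        using order_tendstoD(2)[OF d(3), of "r / (2 * R)"] order_tendstoD(2)[OF elim, of "r / 4"] r(1) R(1)
        by simp_all
      then have ev: "\<forall>\<^sub>F n in sequentially. (1 + d n) *\<^sub>R g x = grad (\<phi> n) x"
      proof eventually_elim
        case (elim n)
        show ?case
          unfolding \<phi>_def
        proof (rule sym, rule grad_conv_affine[OF \<rho>[of n] lipv[of n] S[of n] v0 _ elim(2)])
          fix y assume y: "y \<in> ball x (r / 4)"
          have "norm (x - stretch (d n) y) \<le> norm ((1 + d n) *\<^sub>R (x - y)) + norm (d n *\<^sub>R (x - x0))"
          proof -
            have "x - stretch (d n) y = (1 + d n) *\<^sub>R (x - y) - d n *\<^sub>R (x - x0)"
              by (simp add: stretch_def algebra_simps)
            then show ?thesis by (metis norm_triangle_ineq4)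
          qed
          also have "norm ((1 + d n) *\<^sub>R (x - y)) \<le> 2 * (r / 4)"
            using y d(1,2)[of n] unfolding norm_scaleR by (intro mult_mono) (auto simp: dist_norm)
          also have "norm (d n *\<^sub>R (x - x0)) < r / 2"
          proof -
            have "norm (d n *\<^sub>R (x - x0)) \<le> d n * R"
              using R(2)[of x] x closure_subset d(1)[of n] by auto
            also have "\<dots> < r / (2 * R) * R"
              using elim(1) R(1) by (intro mult_strict_right_mono)
            finally show ?thesis using R(1) by simp
          qed
          finally have "stretch (d n) y \<in> ball x r" by (simp add: dist_norm)
          then have "v n y = c + g x \<bullet> stretch (d n) y" by (simp add: v_def r(2))
          then show "v n y = (c + g x \<bullet> x0 - (1 + d n) * (g x \<bullet> x0)) + ((1 + d n) *\<^sub>R g x) \<bullet> y"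
            by (simp add: stretch_def inner_add_right inner_diff_right right_diff_distrib)
        qed
      qed
      have "(\<lambda>n. (1 + d n) *\<^sub>R g x) \<longlonglongrightarrow> (1 + 0) *\<^sub>R g x"
        by (intro tendsto_intros d(3))
      from Lim_transform_eventually[OF this ev] show ?thesis by simp
    qed
  qed
qed

lemma Lipschitz_L2: "w \<in> L2 \<Omega>"
proof (rule continuous_compact_L2)
  show "continuous_on UNIV w" by (rule lipschitz_on_continuous_on[OF L])
  show "compact (closure \<Omega>)" using bounded_\<Omega> by (simp add: compact_closure)
  show "w x = 0" if "x \<notin> closure \<Omega>" for x
    using that w0 closure_subset by blast
qed

text \<open>
  Pass to the limit in the integration by parts for the smooth approximations.
\<close>

lemma Lipschitz_weak_gradient: "is_weak_gradient \<Omega> w g"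
  unfolding is_weak_gradient_def
proof (intro conjI ballI allI)
  show gL2: "g \<in> L2 \<Omega>" by (rule L2_bounded[OF gm gb])
  fix \<psi> i assume \<psi>: "\<psi> \<in> test_functions \<Omega>"
  note t = test_function_L2[OF \<psi>]
  obtain \<phi> B where \<phi>: "\<And>n. \<phi> n \<in> test_functions \<Omega>"
    "\<And>x. x \<in> \<Omega> \<Longrightarrow> (\<lambda>n. \<phi> n x) \<longlonglongrightarrow> w x"
    "\<And>n x. x \<in> \<Omega> \<Longrightarrow> \<bar>\<phi> n x - w x\<bar> \<le> B"
    "\<And>n x. norm (grad (\<phi> n) x) \<le> B"
    "\<And>x. x \<in> \<Omega> - N \<Longrightarrow> (\<lambda>n. grad (\<phi> n) x) \<longlonglongrightarrow> g x"
    using test_function_approximation by metis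
  have B0: "B \<ge> 0" using order_trans[OF norm_ge_zero \<phi>(4)] .
  have "(\<lambda>n. LINT x|lebesgue_on \<Omega>. \<phi> n x * partial_deriv i \<psi> x)
      \<longlonglongrightarrow> (LINT x|lebesgue_on \<Omega>. w x * partial_deriv i \<psi> x)"
  proof (rule integral_dominated_convergence[where w="\<lambda>x. (\<bar>w x\<bar> + B) * \<bar>partial_deriv i \<psi> x\<bar>"])
    show "integrable (lebesgue_on \<Omega>) (\<lambda>x. (\<bar>w x\<bar> + B) * \<bar>partial_deriv i \<psi> x\<bar>)"
      using integrable_abs[OF L2_mult_integrable[OF Lipschitz_L2 t(3)]] integrable_abs[OF L2_integrable[OF t(3)]]
      by (simp add: distrib_right abs_mult)
    show "AE x in lebesgue_on \<Omega>. norm (\<phi> n x * partial_deriv i \<psi> x) \<le> (\<bar>w x\<bar> + B) * \<bar>partial_deriv i \<psi> x\<bar>" for n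
    proof (rule AE_I2)
      fix x assume "x \<in> space (lebesgue_on \<Omega>)"
      then have "\<bar>\<phi> n x\<bar> \<le> \<bar>w x\<bar> + B" using \<phi>(3)[of x n] by simp
      then show "norm (\<phi> n x * partial_deriv i \<psi> x) \<le> (\<bar>w x\<bar> + B) * \<bar>partial_deriv i \<psi> x\<bar>"
        by (simp add: abs_mult mult_right_mono)
    qed
    show "AE x in lebesgue_on \<Omega>. (\<lambda>n. \<phi> n x * partial_deriv i \<psi> x) \<longlonglongrightarrow> w x * partial_deriv i \<psi> x"
      by (rule AE_I2) (use \<phi>(2) in \<open>auto intro!: tendsto_intros\<close>)
  qed (use L2_measurable[OF Lipschitz_L2] L2_measurable[OF t(3)] L2_measurable[OF test_function_L2(1)[OF \<phi>(1)]] in auto)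
  moreover have "(\<lambda>n. LINT x|lebesgue_on \<Omega>. grad (\<phi> n) x $ i * \<psi> x)
      \<longlonglongrightarrow> (LINT x|lebesgue_on \<Omega>. g x $ i * \<psi> x)"
  proof (rule integral_dominated_convergence[where w="\<lambda>x. B * \<bar>\<psi> x\<bar>"])
    show "integrable (lebesgue_on \<Omega>) (\<lambda>x. B * \<bar>\<psi> x\<bar>)"
      using L2_integrable[OF t(1)] by simp
    show "AE x in lebesgue_on \<Omega>. norm (grad (\<phi> n) x $ i * \<psi> x) \<le> B * \<bar>\<psi> x\<bar>" for n
    proof (rule AE_I2)
      fix x
      have "\<bar>grad (\<phi> n) x $ i\<bar> \<le> B" using \<phi>(4)[of n x] component_le_norm_cart order_trans by blast
      then show "norm (grad (\<phi> n) x $ i * \<psi> x) \<le> B * \<bar>\<psi> x\<bar>"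
        by (simp add: abs_mult mult_right_mono)
    qed
    show "AE x in lebesgue_on \<Omega>. (\<lambda>n. grad (\<phi> n) x $ i * \<psi> x) \<longlonglongrightarrow> g x $ i * \<psi> x"
      using AE_not_negligible[OF N] AE_space[of "lebesgue_on \<Omega>"]
    proof eventually_elim
      case (elim x)
      then show ?case by (intro tendsto_intros \<phi>(5)) auto
    qed
    show "(\<lambda>x. g x $ i * \<psi> x) \<in> borel_measurable (lebesgue_on \<Omega>)"
      using L2_measurable[OF L2_nth[OF gL2, of i]] L2_measurable[OF t(1)] by simp
    show "(\<lambda>x. grad (\<phi> n) x $ i * \<psi> x) \<in> borel_measurable (lebesgue_on \<Omega>)" for n
      using L2_measurable[OF test_function_L2(3)[OF \<phi>(1)[of n], of i]] L2_measurable[OF t(1)] by simp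
  qed
  then have "(\<lambda>n. - (LINT x|lebesgue_on \<Omega>. grad (\<phi> n) x $ i * \<psi> x))
      \<longlonglongrightarrow> - (LINT x|lebesgue_on \<Omega>. g x $ i * \<psi> x)"
    by (rule tendsto_minus)
  moreover have "(LINT x|lebesgue_on \<Omega>. \<phi> n x * partial_deriv i \<psi> x)
      = - (LINT x|lebesgue_on \<Omega>. grad (\<phi> n) x $ i * \<psi> x)" for n
    using test_function_weak_gradient[OF \<phi>(1)[of n]] \<psi> unfolding is_weak_gradient_def by blast
  ultimately show "(LINT x|lebesgue_on \<Omega>. w x * partial_deriv i \<psi> x) = - (LINT x|lebesgue_on \<Omega>. g x $ i * \<psi> x)"
    using LIMSEQ_unique by force
qed

lemma Lipschitz_H10: "w \<in> H10 \<Omega>"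
proof -
  have wH1: "w \<in> H1 \<Omega>" by (rule weak_gradient_H1[OF Lipschitz_L2 Lipschitz_weak_gradient])
  have gL2: "g \<in> L2 \<Omega>" by (rule L2_bounded[OF gm gb])
  obtain \<phi> B where \<phi>: "\<And>n. \<phi> n \<in> test_functions \<Omega>"
    "\<And>x. x \<in> \<Omega> \<Longrightarrow> (\<lambda>n. \<phi> n x) \<longlonglongrightarrow> w x"
    "\<And>n x. x \<in> \<Omega> \<Longrightarrow> \<bar>\<phi> n x - w x\<bar> \<le> B"
    "\<And>n x. norm (grad (\<phi> n) x) \<le> B"
    "\<And>x. x \<in> \<Omega> - N \<Longrightarrow> (\<lambda>n. grad (\<phi> n) x) \<longlonglongrightarrow> g x"
    using test_function_approximation by metis
  define f where "f n x = 1 * w x + (- 1) * \<phi> n x" for n x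
  have fH1: "f n \<in> H1 \<Omega>" for n
    unfolding f_def[abs_def] by (intro H1_lincomb wH1 test_function_H1 \<phi>)
  define k where "k n x = 1 *\<^sub>R g x + (- 1) *\<^sub>R grad (\<phi> n) x" for n x
  have kL2: "k n \<in> L2 \<Omega>" for n
    unfolding k_def[abs_def] by (intro L2_add L2_scaleR gL2 test_function_L2 \<phi>)
  have k: "AE x in lebesgue_on \<Omega>. wgrad \<Omega> (f n) x = k n x" for n
    unfolding f_def[abs_def] k_def
    by (intro wgrad_AE weak_gradient_lincomb Lipschitz_L2 test_function_L2 \<phi> Lipschitz_weak_gradient
        test_function_weak_gradient)
  interpret fin: finite_measure "lebesgue_on \<Omega>" by (rule finite_measure_\<Omega>)
  have a: "(\<lambda>n. (L2_norm \<Omega> (f n))\<^sup>2) \<longlonglongrightarrow> (LINT x|lebesgue_on \<Omega>. 0)"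
    unfolding L2_norm_square
  proof (rule integral_dominated_convergence[where w="\<lambda>x. B\<^sup>2"])
    show "(\<lambda>x. (norm (f n x))\<^sup>2) \<in> borel_measurable (lebesgue_on \<Omega>)" for n
      using L2_measurable[OF H1_L2[OF fH1]] by simp
    show "AE x in lebesgue_on \<Omega>. norm ((norm (f n x))\<^sup>2) \<le> B\<^sup>2" for n
    proof (rule AE_I2)
      fix x assume "x \<in> space (lebesgue_on \<Omega>)"
      then have "\<bar>f n x\<bar> \<le> B" using \<phi>(3)[of x n] by (simp add: f_def abs_minus_commute)
      then show "norm ((norm (f n x))\<^sup>2) \<le> B\<^sup>2" using power_mono[of "\<bar>f n x\<bar>" B 2] by simp
    qed
    show "AE x in lebesgue_on \<Omega>. (\<lambda>n. (norm (f n x))\<^sup>2) \<longlonglongrightarrow> 0"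
    proof (rule AE_I2)
      fix x assume "x \<in> space (lebesgue_on \<Omega>)"
      then have "(\<lambda>n. (norm (w x - \<phi> n x))\<^sup>2) \<longlonglongrightarrow> (norm (w x - w x))\<^sup>2"
        by (intro tendsto_intros \<phi>(2)) auto
      then show "(\<lambda>n. (norm (f n x))\<^sup>2) \<longlonglongrightarrow> 0" by (simp add: f_def)
    qed
  qed auto
  have b: "(\<lambda>n. (L2_norm \<Omega> (k n))\<^sup>2) \<longlonglongrightarrow> (LINT x|lebesgue_on \<Omega>. 0)"
    unfolding L2_norm_square
  proof (rule integral_dominated_convergence[where w="\<lambda>x. (M + B)\<^sup>2"])
    show "(\<lambda>x. (norm (k n x))\<^sup>2) \<in> borel_measurable (lebesgue_on \<Omega>)" for n
      using L2_measurable[OF kL2] by simp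
    show "AE x in lebesgue_on \<Omega>. norm ((norm (k n x))\<^sup>2) \<le> (M + B)\<^sup>2" for n
    proof (rule AE_I2)
      fix x assume "x \<in> space (lebesgue_on \<Omega>)"
      then have "norm (k n x) \<le> M + B"
        using gb[of x] \<phi>(4)[of n x] norm_triangle_ineq4[of "g x" "grad (\<phi> n) x"] by (simp add: k_def)
      then show "norm ((norm (k n x))\<^sup>2) \<le> (M + B)\<^sup>2" using power_mono[of "norm (k n x)" "M + B" 2] by simp
    qed
    show "AE x in lebesgue_on \<Omega>. (\<lambda>n. (norm (k n x))\<^sup>2) \<longlonglongrightarrow> 0"
      using AE_not_negligible[OF N] AE_space[of "lebesgue_on \<Omega>"]
    proof eventually_elim
      case (elim x)
      then have "(\<lambda>n. (norm (g x - grad (\<phi> n) x))\<^sup>2) \<longlonglongrightarrow> (norm (g x - g x))\<^sup>2"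
        by (intro tendsto_intros \<phi>(5)) auto
      then show ?case by (simp add: k_def)
    qed
  qed auto
  have eq: "(L2_norm \<Omega> (wgrad \<Omega> (f n)))\<^sup>2 = (L2_norm \<Omega> (k n))\<^sup>2" for n
    unfolding L2_norm_square
  proof (rule integral_cong_AE)
    show "AE x in lebesgue_on \<Omega>. (norm (wgrad \<Omega> (f n) x))\<^sup>2 = (norm (k n x))\<^sup>2"
      using k[of n] by eventually_elim simp
  qed (use L2_measurable[OF wgrad_L2[OF fH1]] L2_measurable[OF kL2] in auto)
  have lim: "(\<lambda>n. wform 1 1 (f n) (f n)) \<longlonglongrightarrow> 0"
    unfolding wform_self eq using tendsto_add[OF a b] by simp
  have "\<exists>n. wform 1 1 (f n) (f n) < e" if "e > 0" for e
    using order_tendstoD(2)[OF lim that] unfolding eventually_sequentially by blast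
  then show ?thesis
    unfolding H10_iff f_def[abs_def] using wH1 \<phi>(1) by blast
qed

end

end

section \<open>Interpolation on a triangulation\<close>

text \<open>
  A compact convex set is the convex hull of its extreme points, and half-spaces are convex.
\<close>

lemma affine_le_on_extreme_points:
  fixes F :: "'a::euclidean_space set"
  assumes "compact F" "convex F" "\<And>p. p extreme_point_of F \<Longrightarrow> c + b \<bullet> p \<le> m" "x \<in> F"
  shows "c + b \<bullet> x \<le> m"
proof -
  have "convex hull {p. p extreme_point_of F} \<subseteq> {x. b \<bullet> x \<le> m - c}"
    using assms(3) by (intro hull_minimal convex_halfspace_le) (auto simp: algebra_simps)
  with Krein_Milman_Minkowski[OF assms(1,2)] assms(4) show ?thesis
    by (auto simp: algebra_simps)
qed

lemma affine_eq_on_extreme_points: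
  fixes F :: "'a::euclidean_space set"
  assumes "compact F" "convex F" "\<And>p. p extreme_point_of F \<Longrightarrow> c + b \<bullet> p = c' + b' \<bullet> p" "x \<in> F"
  shows "c + b \<bullet> x = c' + b' \<bullet> x"
proof -
  have "(c - c') + (b - b') \<bullet> x \<le> 0"
  proof (rule affine_le_on_extreme_points[OF assms(1,2) _ assms(4)])
    show "(c - c') + (b - b') \<bullet> p \<le> 0" if "p extreme_point_of F" for p
      using assms(3)[OF that] by (simp add: inner_diff_left)
  qed
  moreover have "(c' - c) + (b' - b) \<bullet> x \<le> 0"
  proof (rule affine_le_on_extreme_points[OF assms(1,2) _ assms(4)])
    show "(c' - c) + (b' - b) \<bullet> p \<le> 0" if "p extreme_point_of F" for p
      using assms(3)[OF that] by (simp add: inner_diff_left)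
  qed
  ultimately show ?thesis by (simp add: inner_diff_left)
qed

lemma affine_interpolation:
  fixes C :: "'a::euclidean_space set"
  assumes "\<not> affine_dependent C"
  shows "\<exists>c b. \<forall>x\<in>C. c + b \<bullet> x = g x"
proof (cases "C = {}")
  case False
  then obtain a where a: "a \<in> C" by blast
  have "independent ((\<lambda>x. - a + x) ` (C - {a}))"
    using assms affine_dependent_iff_dependent2[OF a] by blast
  then obtain f :: "'a \<Rightarrow> real" where f: "linear f" "\<And>y. y \<in> (\<lambda>x. - a + x) ` (C - {a}) \<Longrightarrow> f y = g (a + y) - g a"
    using linear_independent_extend[of _ "\<lambda>y. g (a + y) - g a"] by blast
  define b where "b = adjoint f 1"
  have fb: "f y = b \<bullet> y" for y
    using adjoint_works[OF f(1), of y 1] by (simp add: b_def inner_commute)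
  have "(g a - b \<bullet> a) + b \<bullet> x = g x" if "x \<in> C" for x
  proof (cases "x = a")
    case False
    then have "f (- a + x) = g x - g a" using f(2)[of "- a + x"] that by auto
    then show ?thesis using fb[of "- a + x"] by (simp add: inner_diff_right)
  qed simp
  then show ?thesis by blast
qed simp

locale mesh = convex_domain +
  fixes T :: "(real^2) set set"
  assumes tri: "triangulation_of \<Omega> T"
begin

lemma finite_T: "finite T"
  using tri by (simp add: triangulation_of_def triangulation_def)

lemma Union_T: "\<Union> T = closure \<Omega>"
  using tri by (simp add: triangulation_of_def)

lemma cell_subset: "K \<in> T \<Longrightarrow> K \<subseteq> closure \<Omega>"
  using Union_T by blast

lemma cell_simplex: "K \<in> T \<Longrightarrow> 2 simplex K"
  using tri by (simp add: triangulation_of_def)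

lemma cell_compact: "K \<in> T \<Longrightarrow> compact K"
  using cell_simplex simplex_imp_polytope polytope_imp_compact by blast

lemma cell_convex: "K \<in> T \<Longrightarrow> convex K"
  using cell_simplex simplex_imp_polytope polytope_imp_convex by blast

lemma cell_Int_face: "K \<in> T \<Longrightarrow> K' \<in> T \<Longrightarrow> (K \<inter> K') face_of K"
  using tri by (simp add: triangulation_of_def triangulation_def)

lemma cell_vertices:
  assumes "K \<in> T"
  shows "\<not> affine_dependent {a. a extreme_point_of K}" "card {a. a extreme_point_of K} = 3"
    "finite {a. a extreme_point_of K}"
proof -
  obtain C where C: "\<not> affine_dependent C" "int (card C) = 2 + 1" "K = convex hull C" "finite C"
    using cell_simplex[OF assms] unfolding simplex by blast
  then have "{a. a extreme_point_of K} = C"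
    using extreme_point_of_convex_hull_affine_independent[OF C(1)] by auto
  with C show "\<not> affine_dependent {a. a extreme_point_of K}" "card {a. a extreme_point_of K} = 3"
    "finite {a. a extreme_point_of K}" by auto
qed

lemma finite_mesh_vertices: "finite (mesh_vertices T)"
proof -
  have "mesh_vertices T = (\<Union>K\<in>T. {a. a extreme_point_of K})"
    by (auto simp: mesh_vertices_def)
  then show ?thesis using finite_T cell_vertices(3) by auto
qed

lemma finite_interior_nodes: "finite (interior_nodes \<Omega> T)"
  using finite_mesh_vertices by (simp add: interior_nodes_def)

text \<open>
  The intersection of the two cells is a face of each; a face that meets the interior is everything.
\<close>

lemma cell_interiors_disjoint:
  assumes "K \<in> T" "K' \<in> T" "x \<in> interior K" "x \<in> K'"
  shows "K = K'"
proof -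
  have *: "K \<inter> K' = K" if "K \<in> T" "K' \<in> T" "x \<in> interior K" "x \<in> K'" for K K'
  proof (rule ccontr)
    assume "K \<inter> K' \<noteq> K"
    then have "(K \<inter> K') \<inter> rel_interior K = {}"
      using face_of_disjoint_rel_interior[OF cell_Int_face[OF that(1,2)]] by blast
    moreover have "x \<in> rel_interior K"
      using that(3) interior_subset_rel_interior by blast
    ultimately show False using that interior_subset by blast
  qed
  have sub: "K \<subseteq> K'" using *[OF assms] by blast
  then have "x \<in> interior K'" using assms(3) interior_mono by blast
  moreover have "x \<in> K" using assms(3) interior_subset by blast
  ultimately have "K' \<inter> K = K'" using *[of K' K] assms by blast
  with sub show ?thesis by blast
qed

definition skeleton :: "(real^2) set" where
  "skeleton = (\<Union>K\<in>T. frontier K)"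

lemma negligible_skeleton: "negligible skeleton"
  unfolding skeleton_def using finite_T negligible_convex_frontier[OF cell_convex]
  by (intro negligible_Union) auto

lemma off_skeleton:
  assumes "x \<in> closure \<Omega>" "x \<notin> skeleton"
  obtains K where "K \<in> T" "x \<in> interior K"
proof -
  obtain K where K: "K \<in> T" "x \<in> K" using assms(1) Union_T by blast
  with assms(2) have "x \<notin> frontier K" by (auto simp: skeleton_def)
  with K show thesis using that closure_subset by (auto simp: frontier_def)
qed

lemma interior_cell_subset: "K \<in> T \<Longrightarrow> interior K \<subseteq> \<Omega>"
  using interior_mono[OF cell_subset] convex_interior_closure[OF convex_\<Omega>] open_\<Omega>
  by (simp add: interior_open)

text \<open>
  A boundary point lies on a supporting line of the domain. This line cuts every cell in a face,
  and the vertices of that face lie on the boundary.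
\<close>

lemma affine_zero_on_boundary:
  assumes K: "K \<in> T" and v: "\<And>a. a extreme_point_of K \<Longrightarrow> a \<notin> \<Omega> \<Longrightarrow> c + b \<bullet> a = 0"
    and x: "x \<in> K" "x \<notin> \<Omega>"
  shows "c + b \<bullet> x = 0"
proof -
  have ne: "\<Omega> \<noteq> {}" using ball_\<Omega> r0 by (metis centre_in_cball empty_iff less_imp_le subsetD)
  have "\<exists>n d. n \<noteq> 0 \<and> (\<forall>y\<in>{x}. n \<bullet> y \<le> d) \<and> (\<forall>y\<in>\<Omega>. n \<bullet> y \<ge> d)"
    by (rule separating_hyperplane_sets) (use convex_\<Omega> ne x in auto)
  then obtain n d where n: "n \<noteq> 0" "n \<bullet> x \<le> d" "\<And>y. y \<in> \<Omega> \<Longrightarrow> n \<bullet> y \<ge> d" by auto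
  have "closure \<Omega> \<subseteq> {y. n \<bullet> y \<ge> d}"
    using n(3) by (intro closure_minimal closed_halfspace_ge) auto
  then have ge: "n \<bullet> y \<ge> d" if "y \<in> K" for y
    using that cell_subset[OF K] by blast
  define F where "F = K \<inter> {y. n \<bullet> y = d}"
  have F: "F face_of K"
    unfolding F_def using ge by (intro face_of_Int_supporting_hyperplane_ge cell_convex K) auto
  have xF: "x \<in> F" using x ge n(2) by (force simp: F_def)
  have out: "y \<notin> \<Omega>" if "n \<bullet> y = d" for y
  proof
    assume "y \<in> \<Omega>"
    then obtain e where e: "e > 0" "cball y e \<subseteq> \<Omega>" using open_\<Omega> open_contains_cball by blast
    have "y - (e / norm n) *\<^sub>R n \<in> \<Omega>" using e n(1) by (auto simp: dist_norm)
    then have "n \<bullet> (y - (e / norm n) *\<^sub>R n) \<ge> d" by (rule n(3))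
    then have "(e / norm n) * (n \<bullet> n) \<le> 0" using that by (simp add: inner_diff_right)
    moreover have "(e / norm n) * (n \<bullet> n) > 0" using e n(1) by (intro mult_pos_pos) auto
    ultimately show False by linarith
  qed
  have "c + b \<bullet> x = 0 + 0 \<bullet> x"
  proof (rule affine_eq_on_extreme_points[OF _ _ _ xF])
    show "compact F" "convex F"
      using face_of_imp_compact[OF cell_convex[OF K] cell_compact[OF K] F] face_of_imp_convex[OF F] by auto
    show "c + b \<bullet> p = 0 + 0 \<bullet> p" if "p extreme_point_of F" for p
      using that extreme_point_of_face[OF F] v[of p] out[of p] by (auto simp: F_def)
  qed
  then show ?thesis by simp
qed

definition pw_affine :: "(real^2 \<Rightarrow> real) \<Rightarrow> bool" where
  "pw_affine u \<longleftrightarrow> (\<forall>K\<in>T. \<exists>c b. \<forall>x\<in>K. u x = c + b \<bullet> x)"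

lemma pw_affine_unique:
  assumes "pw_affine u" "pw_affine v" "\<And>a. a \<in> mesh_vertices T \<Longrightarrow> u a = v a" "x \<in> closure \<Omega>"
  shows "u x = v x"
proof -
  obtain K where K: "K \<in> T" "x \<in> K" using assms(4) Union_T by blast
  obtain c b where u: "\<And>x. x \<in> K \<Longrightarrow> u x = c + b \<bullet> x" using assms(1) K(1) unfolding pw_affine_def by blast
  obtain c' b' where v: "\<And>x. x \<in> K \<Longrightarrow> v x = c' + b' \<bullet> x" using assms(2) K(1) unfolding pw_affine_def by blast
  have "c + b \<bullet> x = c' + b' \<bullet> x"
  proof (rule affine_eq_on_extreme_points[OF cell_compact[OF K(1)] cell_convex[OF K(1)] _ K(2)])
    fix p assume p: "p extreme_point_of K"
    then have "p \<in> K" "p \<in> mesh_vertices T"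
      using K by (auto simp: extreme_point_of_def mesh_vertices_def)
    then show "c + b \<bullet> p = c' + b' \<bullet> p" using u v assms(3) by metis
  qed
  then show ?thesis using u v K by simp
qed

lemma pw_affine_sum:
  assumes "finite I" "\<And>i. i \<in> I \<Longrightarrow> pw_affine (f i)"
  shows "pw_affine (\<lambda>x. \<Sum>i\<in>I. s i * f i x)"
  unfolding pw_affine_def
proof
  fix K assume K: "K \<in> T"
  have "\<forall>i\<in>I. \<exists>c b. \<forall>x\<in>K. f i x = c + b \<bullet> x"
    using assms(2) K unfolding pw_affine_def by blast
  then obtain c b where f: "\<And>i x. i \<in> I \<Longrightarrow> x \<in> K \<Longrightarrow> f i x = c i + b i \<bullet> x"
    by metis
  have "(\<Sum>i\<in>I. s i * f i x) = (\<Sum>i\<in>I. s i * c i) + (\<Sum>i\<in>I. s i *\<^sub>R b i) \<bullet> x" if "x \<in> K" for x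
    using f that by (simp add: inner_sum_left distrib_left sum.distrib)
  then show "\<exists>c b. \<forall>x\<in>K. (\<Sum>i\<in>I. s i * f i x) = c + b \<bullet> x" by blast
qed

text \<open>
  Two cells meet in a common face, whose extreme points are vertices of both, so the affine pieces
  agree there. A segment is cut into finitely many closed pieces by the cells and by the complement
  of the domain, and the function is Lipschitz on each of them, hence on the segment. Off the edges
  it is locally affine, so it belongs to \<open>H\<^sup>1\<^sub>0\<close>.
\<close>

lemma pw_affine_interpolant:
  assumes g0: "\<And>a. a \<in> mesh_vertices T \<Longrightarrow> a \<notin> \<Omega> \<Longrightarrow> g a = 0"
  obtains w c b G L where "\<And>K x. K \<in> T \<Longrightarrow> x \<in> K \<Longrightarrow> w x = c K + b K \<bullet> x"
    "\<And>a. a \<in> mesh_vertices T \<Longrightarrow> w a = g a"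
    "w \<in> H10 \<Omega>" "is_weak_gradient \<Omega> w G" "\<And>K x. K \<in> T \<Longrightarrow> x \<in> interior K \<Longrightarrow> G x = b K"
    "L-lipschitz_on UNIV w" "\<And>x. x \<notin> \<Omega> \<Longrightarrow> w x = 0"
proof -
  have "\<forall>K\<in>T. \<exists>c b. \<forall>a\<in>{a. a extreme_point_of K}. c + b \<bullet> a = g a"
    using affine_interpolation[OF cell_vertices(1)] by blast
  then obtain c b where cb: "\<And>K a. K \<in> T \<Longrightarrow> a extreme_point_of K \<Longrightarrow> c K + b K \<bullet> a = g a"
    by (metis mem_Collect_eq)
  have zero: "c K + b K \<bullet> x = 0" if "K \<in> T" "x \<in> K" "x \<notin> \<Omega>" for K x
  proof (rule affine_zero_on_boundary[OF that(1) _ that(2,3)])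
    show "c K + b K \<bullet> a = 0" if "a extreme_point_of K" "a \<notin> \<Omega>" for a
      using cb[OF \<open>K \<in> T\<close> that(1)] g0[of a] that \<open>K \<in> T\<close> by (auto simp: mesh_vertices_def)
  qed
  have cons: "c K + b K \<bullet> x = c K' + b K' \<bullet> x" if K: "K \<in> T" "K' \<in> T" "x \<in> K" "x \<in> K'" for K K' x
  proof (rule affine_eq_on_extreme_points[of "K \<inter> K'"])
    have F: "(K \<inter> K') face_of K" "(K \<inter> K') face_of K'"
      using cell_Int_face[OF K(1,2)] cell_Int_face[OF K(2,1)] by (simp_all add: Int_commute)
    show "compact (K \<inter> K')" "convex (K \<inter> K')"
      using cell_compact cell_convex K by (auto intro: convex_Int compact_Int)
    show "c K + b K \<bullet> p = c K' + b K' \<bullet> p" if "p extreme_point_of (K \<inter> K')" for p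
      using that extreme_point_of_face[OF F(1)] extreme_point_of_face[OF F(2)] cb K by metis
  qed (use K in auto)
  define w where "w x = (if x \<in> \<Omega> then (let K = (SOME K. K \<in> T \<and> x \<in> K) in c K + b K \<bullet> x) else 0)" for x
  have w: "w x = c K + b K \<bullet> x" if "K \<in> T" "x \<in> K" for K x
  proof (cases "x \<in> \<Omega>")
    case True
    define K' where "K' = (SOME K. K \<in> T \<and> x \<in> K)"
    have "K' \<in> T \<and> x \<in> K'"
      unfolding K'_def using that by (intro someI[of "\<lambda>K. K \<in> T \<and> x \<in> K" K]) auto
    then show ?thesis using True cons[of K' K x] that by (simp add: w_def Let_def flip: K'_def)
  next
    case False
    then show ?thesis using zero[OF that] by (simp add: w_def)
  qed
  have w0: "w x = 0" if "x \<notin> \<Omega>" for x using that by (simp add: w_def)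
  have wv: "w a = g a" if av: "a \<in> mesh_vertices T" for a
  proof -
    obtain K where "K \<in> T" "a extreme_point_of K" using av by (auto simp: mesh_vertices_def)
    then show ?thesis using cb[of K a] w[of K a] by (simp add: extreme_point_of_def)
  qed
  define L where "L = (\<Sum>K\<in>T. norm (b K))"
  have L0: "L \<ge> 0" by (simp add: L_def sum_nonneg)
  have bL: "norm (b K) \<le> L" if "K \<in> T" for K
    unfolding L_def using finite_T that by (intro member_le_sum) auto
  have lip: "L-lipschitz_on UNIV w"
  proof (rule lipschitz_onI[OF _ L0])
    fix x y :: "real^2"
    define p where "p t = x + t *\<^sub>R (y - x)" for t :: real
    define I where "I = insert (- \<Omega>) T"
    define U where "U S = {t. p t \<in> S}" for S
    have cp: "continuous_on UNIV p" unfolding p_def by (intro continuous_intros)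
    have "(L * dist x y)-lipschitz_on {0..1} (\<lambda>t. w (p t))"
    proof (rule lipschitz_on_closed_Union[where I=I and U=U])
      show "(L * dist x y)-lipschitz_on (U S) (\<lambda>t. w (p t))" if S: "S \<in> I" for S
      proof (rule lipschitz_onI)
        fix s t assume st: "s \<in> U S" "t \<in> U S"
        show "dist (w (p s)) (w (p t)) \<le> L * dist x y * dist s t"
        proof (cases "S = - \<Omega>")
          case True
          then have "w (p s) = 0" "w (p t) = 0" using st w0 by (auto simp: U_def)
          then show ?thesis using L0 by simp
        next
          case False
          then have K: "S \<in> T" "p s \<in> S" "p t \<in> S" using S st by (auto simp: I_def U_def)
          have "w (p s) - w (p t) = b S \<bullet> (p s - p t)"
            using w[OF K(1,2)] w[OF K(1,3)] by (simp add: inner_diff_right)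
          also have "p s - p t = (s - t) *\<^sub>R (y - x)"
            by (simp add: p_def algebra_simps)
          finally have "\<bar>w (p s) - w (p t)\<bar> \<le> norm (b S) * norm ((s - t) *\<^sub>R (y - x))"
            by (metis Cauchy_Schwarz_ineq2)
          also have "\<dots> \<le> L * norm ((s - t) *\<^sub>R (y - x))"
            by (intro mult_right_mono bL K) simp
          finally show ?thesis by (simp add: dist_norm norm_minus_commute mult_ac)
        qed
      qed (use L0 in simp)
      show "closed (U S)" if S: "S \<in> I" for S
      proof -
        have "closed S" using S open_\<Omega> cell_compact by (auto simp: I_def compact_imp_closed)
        then have "closed (p -` S)" using continuous_closed_vimage cp by (metis continuous_on_eq_continuous_at open_UNIV UNIV_I)
        then show ?thesis by (simp add: U_def vimage_def)
      qed
      have "\<Omega> \<subseteq> \<Union> T" using Union_T closure_subset by blast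
      then show "{0..1} \<subseteq> (\<Union>S\<in>I. U S)" by (auto simp: I_def U_def)
    qed (use finite_T L0 in \<open>auto simp: I_def\<close>)
    from lipschitz_onD[OF this, of 0 1] show "dist (w x) (w y) \<le> L * dist x y"
      by (simp add: p_def)
  qed
  define G where "G x = (\<Sum>K\<in>T. indicator (interior K) x *\<^sub>R b K)" for x
  have G: "G x = b K" if "K \<in> T" "x \<in> interior K" for K x
  proof -
    have "indicator (interior K') x *\<^sub>R b K' = (if K' = K then b K else 0)" if "K' \<in> T" for K'
      using cell_interiors_disjoint[OF \<open>K \<in> T\<close> that \<open>x \<in> interior K\<close>] \<open>x \<in> interior K\<close> interior_subset
      by (auto simp: indicator_def)
    then have "G x = (\<Sum>K'\<in>T. if K' = K then b K else 0)"
      unfolding G_def by (intro sum.cong) auto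
    then show ?thesis using finite_T that by simp
  qed
  have Gm: "G \<in> borel_measurable (lebesgue_on \<Omega>)"
    unfolding G_def by (intro borel_measurable_sum borel_measurable_scaleR measurable_restrict_space1
        borel_measurable_indicator) auto
  have Gb: "norm (G x) \<le> L" for x
    unfolding G_def L_def by (intro order_trans[OF norm_sum] sum_mono) (auto simp: indicator_def)
  have aff: "\<exists>r>0. \<exists>c. \<forall>y\<in>ball x r. w y = c + G x \<bullet> y" if x: "x \<in> \<Omega> - skeleton" for x
  proof -
    obtain K where K: "K \<in> T" "x \<in> interior K"
      using off_skeleton[of x] x closure_subset by blast
    then obtain r where "r > 0" "ball x r \<subseteq> K" using mem_interior by blast
    then show ?thesis using w[OF K(1)] G[OF K] by (metis subsetD)
  qed
  note H = lip w0 negligible_skeleton aff Gm Gb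
  show thesis
    by (rule that[OF w wv Lipschitz_H10[OF H] Lipschitz_weak_gradient[OF H] G lip w0])
qed

subsection \<open>Integration cell by cell\<close>

text \<open>
  Values outside the domain are arbitrary, but the part of a cell there lies in the null set of edges,
  and completeness of the measure makes the integrand measurable on the whole cell.
\<close>

lemma integral_cells:
  fixes f :: "real^2 \<Rightarrow> real"
  assumes f: "integrable (lebesgue_on \<Omega>) f"
  shows "(\<Sum>K\<in>T. LINT x|lebesgue_on K. f x) = (LINT x|lebesgue_on \<Omega>. f x)"
proof -
  have fi: "integrable lebesgue (\<lambda>x. indicator \<Omega> x * f x)"
    using f by (subst (asm) integrable_restrict_space) auto
  have ii: "integrable lebesgue (\<lambda>x. indicator (interior K) x * f x)" if "K \<in> T" for K
  proof -
    have "integrable lebesgue (\<lambda>x. indicator (interior K) x *\<^sub>R (indicator \<Omega> x * f x))"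
      by (rule integrable_mult_indicator[OF _ fi]) simp
    moreover have "(\<lambda>x. indicator (interior K) x *\<^sub>R (indicator \<Omega> x * f x)) = (\<lambda>x. indicator (interior K) x * f x)"
      using interior_cell_subset[OF that] by (auto simp: indicator_def fun_eq_iff)
    ultimately show ?thesis by (simp only:)
  qed
  have off: "AE x in lebesgue. x \<notin> skeleton"
    using negligible_skeleton by (intro AE_not_in) (simp add: negligible_iff_null_sets)
  have cell: "(LINT x|lebesgue_on K. f x) = (LINT x|lebesgue. indicator (interior K) x * f x)" if K: "K \<in> T" for K
  proof -
    have ae: "AE x in lebesgue. indicator (interior K) x * f x = indicator K x * f x"
      using off
    proof eventually_elim
      case (elim x)
      then have "x \<notin> frontier K" using K by (auto simp: skeleton_def)
      then have "x \<in> K \<longleftrightarrow> x \<in> interior K"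
        using closure_subset[of K] interior_subset[of K] by (auto simp: frontier_def)
      then show ?case by (simp add: indicator_def)
    qed
    have "K \<in> sets lebesgue" using cell_compact[OF K] by (simp add: compact_imp_closed)
    then have "(LINT x|lebesgue_on K. f x) = (LINT x|lebesgue. indicator K x * f x)"
      by (subst integral_restrict_space) auto
    also have "\<dots> = (LINT x|lebesgue. indicator (interior K) x * f x)"
    proof (rule integral_cong_AE)
      show "(\<lambda>x. indicator K x * f x) \<in> borel_measurable lebesgue"
        by (rule borel_measurable_AE[OF _ ae]) (use ii[OF K] in auto)
      show "AE x in lebesgue. indicator K x * f x = indicator (interior K) x * f x"
        using ae by eventually_elim (rule sym)
    qed (use ii[OF K] in auto)
    finally show ?thesis .
  qed
  have "(\<Sum>K\<in>T. LINT x|lebesgue_on K. f x) = (LINT x|lebesgue. (\<Sum>K\<in>T. indicator (interior K) x * f x))"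
    using cell ii by simp
  also have "\<dots> = (LINT x|lebesgue. indicator \<Omega> x * f x)"
  proof (rule integral_cong_AE)
    show "AE x in lebesgue. (\<Sum>K\<in>T. indicator (interior K) x * f x) = indicator \<Omega> x * f x"
      using off
    proof eventually_elim
      case (elim x)
      show ?case
      proof (cases "x \<in> \<Omega>")
        case True
        then obtain K where K: "K \<in> T" "x \<in> interior K"
          using off_skeleton[of x] elim closure_subset by blast
        have "indicator (interior K') x * f x = (if K' = K then f x else 0)" if "K' \<in> T" for K'
          using cell_interiors_disjoint[OF K(1) that K(2)] K(2) interior_subset by (auto simp: indicator_def)
        then have "(\<Sum>K\<in>T. indicator (interior K) x * f x) = (\<Sum>K'\<in>T. if K' = K then f x else 0)"
          by (intro sum.cong) auto
        then show ?thesis using finite_T K True by simp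
      next
        case False
        then have "x \<notin> interior K" if "K \<in> T" for K
          using interior_cell_subset[OF that] by blast
        then have "(\<Sum>K\<in>T. indicator (interior K) x * f x) = 0"
          by (intro sum.neutral) simp
        then show ?thesis using False by simp
      qed
    qed
  qed (use fi ii in auto)
  also have "\<dots> = (LINT x|lebesgue_on \<Omega>. f x)"
    by (subst integral_restrict_space) auto
  finally show ?thesis .
qed

end

section \<open>Averages of smooth functions\<close>

text \<open>
  The inequality of Cauchy and Schwarz. If the integrand is not integrable, its integral is zero by
  convention and there is nothing to show.
\<close>

lemma integral_square_le:
  assumes [measurable]: "A \<in> sets borel" "f \<in> borel_measurable borel"
  shows "ennreal ((LINT x|lborel. indicator A x * f x)\<^sup>2)
    \<le> emeasure lborel A * (\<integral>\<^sup>+x. indicator A x * ennreal ((f x)\<^sup>2) \<partial>lborel)"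
proof (cases "integrable lborel (\<lambda>x. indicator A x * f x)")
  case True
  have "ennreal \<bar>LINT x|lborel. indicator A x * f x\<bar> \<le> (\<integral>\<^sup>+x. ennreal \<bar>indicator A x * f x\<bar> \<partial>lborel)"
    using integral_norm_bound_ennreal[OF True] by simp
  also have "\<dots> = (\<integral>\<^sup>+x. indicator A x * (indicator A x * ennreal \<bar>f x\<bar>) \<partial>lborel)"
    by (intro nn_integral_cong) (auto simp: indicator_def)
  finally have "(ennreal \<bar>LINT x|lborel. indicator A x * f x\<bar>)\<^sup>2 \<le> (\<integral>\<^sup>+x. indicator A x * (indicator A x * ennreal \<bar>f x\<bar>) \<partial>lborel)\<^sup>2"
    by (intro power_mono) auto
  also have "\<dots> \<le> (\<integral>\<^sup>+x. (indicator A x)\<^sup>2 \<partial>lborel) * (\<integral>\<^sup>+x. (indicator A x * ennreal \<bar>f x\<bar>)\<^sup>2 \<partial>lborel)"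
    by (rule Cauchy_Schwarz_nn_integral) measurable
  also have "(\<integral>\<^sup>+x. (indicator A x)\<^sup>2 \<partial>lborel) = emeasure lborel A"
  proof -
    have "(\<lambda>x. (indicator A x :: ennreal)\<^sup>2) = indicator A"
      by (auto simp: indicator_def fun_eq_iff)
    then show ?thesis by simp
  qed
  also have "(\<integral>\<^sup>+x. (indicator A x * ennreal \<bar>f x\<bar>)\<^sup>2 \<partial>lborel) = (\<integral>\<^sup>+x. indicator A x * ennreal ((f x)\<^sup>2) \<partial>lborel)"
    by (intro nn_integral_cong) (auto simp: indicator_def ennreal_power)
  finally show ?thesis by (simp add: ennreal_power)
qed (simp add: not_integrable_integral_eq)

lemma nn_integral_affine:
  fixes a :: "'a::euclidean_space"
  assumes [measurable]: "f \<in> borel_measurable borel" and c: "c > 0"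
  shows "(\<integral>\<^sup>+x. f x \<partial>lborel) = ennreal (c ^ DIM('a)) * (\<integral>\<^sup>+x. f (a + c *\<^sub>R x) \<partial>lborel)"
  using c by (subst lborel_affine[of c a]) (simp_all add: nn_integral_density nn_integral_distr nn_integral_cmult)

lemma nn_integral_translate:
  fixes a :: "'a::euclidean_space"
  assumes "f \<in> borel_measurable borel"
  shows "(\<integral>\<^sup>+x. f (a + x) \<partial>lborel) = (\<integral>\<^sup>+x. f x \<partial>lborel)"
  using nn_integral_affine[OF assms, of 1 a] by simp

lemma nn_integral_expand_le:
  fixes a :: "'a::euclidean_space"
  assumes "f \<in> borel_measurable borel" "c \<ge> 1"
  shows "(\<integral>\<^sup>+x. f (a + c *\<^sub>R x) \<partial>lborel) \<le> (\<integral>\<^sup>+x. f x \<partial>lborel)"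
proof -
  have "1 * (\<integral>\<^sup>+x. f (a + c *\<^sub>R x) \<partial>lborel) \<le> ennreal (c ^ DIM('a)) * (\<integral>\<^sup>+x. f (a + c *\<^sub>R x) \<partial>lborel)"
    using assms(2) by (intro mult_right_mono) (auto simp flip: ennreal_1 intro!: ennreal_leI)
  then show ?thesis using nn_integral_affine[OF assms(1), of c a] assms(2) by simp
qed

lemma nn_integral_swap:
  fixes f :: "'a::euclidean_space \<Rightarrow> 'b::euclidean_space \<Rightarrow> ennreal"
  assumes "case_prod f \<in> borel_measurable (borel \<Otimes>\<^sub>M borel)"
  shows "(\<integral>\<^sup>+y. (\<integral>\<^sup>+x. f x y \<partial>lborel) \<partial>lborel) = (\<integral>\<^sup>+x. (\<integral>\<^sup>+y. f x y \<partial>lborel) \<partial>lborel)"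
proof -
  have "case_prod f \<in> borel_measurable (lborel \<Otimes>\<^sub>M lborel)"
    using assms by (simp cong: measurable_cong_sets sets_pair_measure_cong)
  then show ?thesis by (rule lborel_pair.Fubini')
qed

text \<open>
  The density of the Dirichlet energy, with extended nonnegative values: the estimates of this part
  exchange the order of integration freely.
\<close>

definition gsq :: "(real^2 \<Rightarrow> real) \<Rightarrow> real^2 \<Rightarrow> ennreal" where
  "gsq \<phi> y = ennreal ((norm (grad \<phi> y))\<^sup>2)"

lemma gsq_measurable: "Ck 1 \<phi> \<Longrightarrow> gsq \<phi> \<in> borel_measurable borel"
  unfolding gsq_def Ck_1_iff by (auto dest!: borel_measurable_continuous_onI)

text \<open>
  The fundamental theorem of calculus along the segment, squared by the Cauchy--Schwarz inequality.
\<close>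

lemma difference_square_le:
  assumes \<phi>: "Ck 1 \<phi>"
  shows "ennreal ((\<phi> (y + w) - \<phi> y)\<^sup>2)
    \<le> ennreal ((norm w)\<^sup>2) * (\<integral>\<^sup>+t. indicator {0..1} t * gsq \<phi> (y + t *\<^sub>R w) \<partial>lborel)"
proof -
  have d: "\<phi> differentiable (at x)" for x using \<phi> unfolding Ck_1_iff by auto
  have cg: "continuous_on UNIV (grad \<phi>)" using \<phi> unfolding Ck_1_iff by auto
  have [measurable]: "gsq \<phi> \<in> borel_measurable borel" by (rule gsq_measurable[OF \<phi>])
  define f where "f t = grad \<phi> (y + t *\<^sub>R w) \<bullet> w" for t
  have cf: "continuous_on UNIV f"
    unfolding f_def by (intro continuous_intros continuous_on_compose2[OF cg]) auto
  have deriv: "((\<lambda>t. \<phi> (y + t *\<^sub>R w)) has_real_derivative f t) (at t)" for t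
  proof -
    have "((\<lambda>t. y + t *\<^sub>R w) has_derivative (\<lambda>t. t *\<^sub>R w)) (at t)"
      by (auto intro!: derivative_eq_intros)
    from has_derivative_compose[OF this has_derivative_grad[OF d]]
    show ?thesis by (simp add: has_field_derivative_def f_def mult_commute_abs)
  qed
  have "(LINT t|lborel. f t * indicator {0..1} t) = \<phi> (y + 1 *\<^sub>R w) - \<phi> (y + 0 *\<^sub>R w)"
    by (rule integral_FTC_Icc_real) (use deriv cf in \<open>auto simp: continuous_on_eq_continuous_at\<close>)
  then have "ennreal ((\<phi> (y + w) - \<phi> y)\<^sup>2) = ennreal ((LINT t|lborel. indicator {0..1} t * f t)\<^sup>2)"
    by (simp add: mult.commute)
  also have "\<dots> \<le> emeasure lborel {0..1::real} * (\<integral>\<^sup>+t. indicator {0..1} t * ennreal ((f t)\<^sup>2) \<partial>lborel)"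
    by (rule integral_square_le) (use borel_measurable_continuous_onI[OF cf] in auto)
  also have "\<dots> = (\<integral>\<^sup>+t. indicator {0..1} t * ennreal ((f t)\<^sup>2) \<partial>lborel)"
    by simp
  also have "\<dots> \<le> (\<integral>\<^sup>+t. ennreal ((norm w)\<^sup>2) * (indicator {0..1} t * gsq \<phi> (y + t *\<^sub>R w)) \<partial>lborel)"
  proof (rule nn_integral_mono)
    fix t
    have "(f t)\<^sup>2 \<le> (norm (grad \<phi> (y + t *\<^sub>R w)) * norm w)\<^sup>2"
      unfolding f_def using power_mono[OF Cauchy_Schwarz_ineq2, of _ _ 2] by simp
    then have "ennreal ((f t)\<^sup>2) \<le> ennreal ((norm w)\<^sup>2) * gsq \<phi> (y + t *\<^sub>R w)"
      by (simp add: gsq_def power_mult_distrib mult.commute flip: ennreal_mult)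
    then show "indicator {0..1} t * ennreal ((f t)\<^sup>2) \<le> ennreal ((norm w)\<^sup>2) * (indicator {0..1} t * gsq \<phi> (y + t *\<^sub>R w))"
      by (auto simp: indicator_def)
  qed
  also have "\<dots> = ennreal ((norm w)\<^sup>2) * (\<integral>\<^sup>+t. indicator {0..1} t * gsq \<phi> (y + t *\<^sub>R w) \<partial>lborel)"
    by (rule nn_integral_cmult) measurable
  finally show ?thesis .
qed

text \<open>
  The quadratic mean over \<open>x\<close> of an increment along a displacement \<open>w x\<close> depending
  affinely on \<open>x\<close> is controlled by the Dirichlet energy, because the intermediate
  maps \<open>x \<mapsto> x + t w x\<close> do not contract areas.
\<close>

lemma increment_L2_le:
  assumes \<phi>: "Ck 1 \<phi>" and s: "s \<ge> 0" and S: "S \<in> sets borel"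
    and W: "W \<ge> 0" "\<And>x. x \<in> S \<Longrightarrow> norm (s *\<^sub>R x + v) \<le> W"
  shows "(\<integral>\<^sup>+x. indicator S x * ennreal ((\<phi> (x + (s *\<^sub>R x + v)) - \<phi> x)\<^sup>2) \<partial>lborel)
    \<le> ennreal (W\<^sup>2) * (\<integral>\<^sup>+x. gsq \<phi> x \<partial>lborel)"
proof -
  have [measurable]: "gsq \<phi> \<in> borel_measurable borel" by (rule gsq_measurable[OF \<phi>])
  have "(\<integral>\<^sup>+x. indicator S x * ennreal ((\<phi> (x + (s *\<^sub>R x + v)) - \<phi> x)\<^sup>2) \<partial>lborel)
    \<le> (\<integral>\<^sup>+x. ennreal (W\<^sup>2) * (\<integral>\<^sup>+t. indicator {0..1} t * gsq \<phi> (x + t *\<^sub>R (s *\<^sub>R x + v)) \<partial>lborel) \<partial>lborel)"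
  proof (rule nn_integral_mono)
    fix x
    show "indicator S x * ennreal ((\<phi> (x + (s *\<^sub>R x + v)) - \<phi> x)\<^sup>2)
      \<le> ennreal (W\<^sup>2) * (\<integral>\<^sup>+t. indicator {0..1} t * gsq \<phi> (x + t *\<^sub>R (s *\<^sub>R x + v)) \<partial>lborel)"
    proof (cases "x \<in> S")
      case True
      then have "(norm (s *\<^sub>R x + v))\<^sup>2 \<le> W\<^sup>2" using W(2) by (intro power_mono) auto
      then have "ennreal ((norm (s *\<^sub>R x + v))\<^sup>2) \<le> ennreal (W\<^sup>2)" by (rule ennreal_leI)
      from order_trans[OF difference_square_le[OF \<phi>] mult_right_mono[OF this]]
      show ?thesis using True by simp
    qed simp
  qed
  also have "\<dots> = ennreal (W\<^sup>2) * (\<integral>\<^sup>+x. (\<integral>\<^sup>+t. indicator {0..1} t * gsq \<phi> (x + t *\<^sub>R (s *\<^sub>R x + v)) \<partial>lborel) \<partial>lborel)"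
    by (rule nn_integral_cmult) measurable
  also have "(\<integral>\<^sup>+x. (\<integral>\<^sup>+t. indicator {0..1} t * gsq \<phi> (x + t *\<^sub>R (s *\<^sub>R x + v)) \<partial>lborel) \<partial>lborel)
      = (\<integral>\<^sup>+t. (\<integral>\<^sup>+x. indicator {0..1::real} t * gsq \<phi> (x + t *\<^sub>R (s *\<^sub>R x + v)) \<partial>lborel) \<partial>lborel)"
    by (rule nn_integral_swap) measurable
  also have "\<dots> \<le> (\<integral>\<^sup>+t. indicator {0..1::real} t * (\<integral>\<^sup>+x. gsq \<phi> x \<partial>lborel) \<partial>lborel)"
  proof (rule nn_integral_mono)
    fix t :: real
    show "(\<integral>\<^sup>+x. indicator {0..1} t * gsq \<phi> (x + t *\<^sub>R (s *\<^sub>R x + v)) \<partial>lborel)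
      \<le> indicator {0..1} t * (\<integral>\<^sup>+x. gsq \<phi> x \<partial>lborel)"
    proof (cases "t \<in> {0..1}")
      case True
      have "x + t *\<^sub>R (s *\<^sub>R x + v) = t *\<^sub>R v + (1 + t * s) *\<^sub>R x" for x
        by (simp add: algebra_simps)
      then have "(\<integral>\<^sup>+x. gsq \<phi> (x + t *\<^sub>R (s *\<^sub>R x + v)) \<partial>lborel) = (\<integral>\<^sup>+x. gsq \<phi> (t *\<^sub>R v + (1 + t * s) *\<^sub>R x) \<partial>lborel)"
        by simp
      also have "\<dots> \<le> (\<integral>\<^sup>+x. gsq \<phi> x \<partial>lborel)"
        by (rule nn_integral_expand_le) (use True s in auto)
      finally show ?thesis using True by simp
    qed simp
  qed
  also have "\<dots> = (\<integral>\<^sup>+x. gsq \<phi> x \<partial>lborel)"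
    by (subst nn_integral_multc) auto
  finally show ?thesis by (simp add: mult_left_mono)
qed

context bounded_domain
begin

lemma L2_norm_nn:
  fixes f :: "real^2 \<Rightarrow> 'b::euclidean_space"
  assumes "f \<in> L2 \<Omega>"
  shows "ennreal ((L2_norm \<Omega> f)\<^sup>2) = (\<integral>\<^sup>+x. indicator \<Omega> x * ennreal ((norm (f x))\<^sup>2) \<partial>lebesgue)"
proof -
  have "ennreal ((L2_norm \<Omega> f)\<^sup>2) = (\<integral>\<^sup>+x. ennreal ((norm (f x))\<^sup>2) \<partial>lebesgue_on \<Omega>)"
    unfolding L2_norm_square by (rule nn_integral_eq_integral[symmetric]) (use assms in \<open>auto simp: L2_def\<close>)
  also have "\<dots> = (\<integral>\<^sup>+x. indicator \<Omega> x * ennreal ((norm (f x))\<^sup>2) \<partial>lebesgue)"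
    by (subst nn_integral_restrict_space) (auto simp: mult.commute)
  finally show ?thesis .
qed

lemma AE_lebesgue_on_iff: "(AE x in lebesgue_on \<Omega>. P x) \<longleftrightarrow> (AE x in lebesgue. x \<in> \<Omega> \<longrightarrow> P x)"
  by (simp add: AE_restrict_space_iff)

lemma test_function_energy:
  assumes "\<phi> \<in> test_functions \<Omega>"
  shows "ennreal ((L2_norm \<Omega> (wgrad \<Omega> \<phi>))\<^sup>2) = (\<integral>\<^sup>+x. gsq \<phi> x \<partial>lborel)"
proof -
  obtain S where S: "compact S" "S \<subseteq> \<Omega>" "\<And>x. x \<notin> S \<Longrightarrow> \<phi> x = 0"
    using test_function_support[OF assms] by blast
  have g0: "grad \<phi> x = 0" if "x \<notin> \<Omega>" for x
    using grad_eq_0_outside[of S \<phi> x] compact_imp_closed[OF S(1)] S that by blast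
  have "AE x in lebesgue_on \<Omega>. wgrad \<Omega> \<phi> x = grad \<phi> x"
    by (rule wgrad_AE[OF test_function_weak_gradient[OF assms]])
  then have ae: "AE x in lebesgue. x \<in> \<Omega> \<longrightarrow> wgrad \<Omega> \<phi> x = grad \<phi> x"
    by (simp add: AE_lebesgue_on_iff)
  have "ennreal ((L2_norm \<Omega> (wgrad \<Omega> \<phi>))\<^sup>2) = (\<integral>\<^sup>+x. indicator \<Omega> x * ennreal ((norm (wgrad \<Omega> \<phi> x))\<^sup>2) \<partial>lebesgue)"
    by (rule L2_norm_nn[OF wgrad_L2[OF test_function_H1[OF assms]]])
  also have "\<dots> = (\<integral>\<^sup>+x. gsq \<phi> x \<partial>lebesgue)"
  proof (rule nn_integral_cong_AE)
    show "AE x in lebesgue. indicator \<Omega> x * ennreal ((norm (wgrad \<Omega> \<phi> x))\<^sup>2) = gsq \<phi> x"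
      using ae by eventually_elim (use g0 in \<open>auto simp: gsq_def indicator_def\<close>)
  qed
  finally show ?thesis by (simp add: nn_integral_completion)
qed

text \<open>
  A translation by more than the diameter moves the function off its own support, so the function
  equals minus its increment.
\<close>

lemma poincare_test_function:
  assumes \<phi>: "\<phi> \<in> test_functions \<Omega>" and d: "d > 0" "\<And>x y. x \<in> \<Omega> \<Longrightarrow> y \<in> \<Omega> \<Longrightarrow> norm (x - y) < d"
  shows "(L2_norm \<Omega> \<phi>)\<^sup>2 \<le> d\<^sup>2 * (L2_norm \<Omega> (wgrad \<Omega> \<phi>))\<^sup>2"
proof -
  obtain S where S: "compact S" "S \<subseteq> \<Omega>" "\<And>x. x \<notin> S \<Longrightarrow> \<phi> x = 0"
    using test_function_support[OF \<phi>] by blast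
  define v :: "real^2" where "v = d *\<^sub>R axis 1 1"
  have nv: "norm v = d" using d by (simp add: v_def)
  have "ennreal ((L2_norm \<Omega> \<phi>)\<^sup>2) = (\<integral>\<^sup>+x. indicator \<Omega> x * ennreal ((norm (\<phi> x))\<^sup>2) \<partial>lborel)"
    using L2_norm_nn[OF test_function_L2(1)[OF \<phi>]] by (simp add: nn_integral_completion)
  also have "\<dots> = (\<integral>\<^sup>+x. indicator \<Omega> x * ennreal ((\<phi> (x + (0 *\<^sub>R x + v)) - \<phi> x)\<^sup>2) \<partial>lborel)"
  proof (rule nn_integral_cong)
    fix x
    have "\<phi> (x + v) = 0" if "x \<in> \<Omega>"
    proof -
      have "x + v \<notin> \<Omega>" using d(2)[of "x + v" x] that nv by auto
      then show ?thesis using S by blast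
    qed
    then show "indicator \<Omega> x * ennreal ((norm (\<phi> x))\<^sup>2) = indicator \<Omega> x * ennreal ((\<phi> (x + (0 *\<^sub>R x + v)) - \<phi> x)\<^sup>2)"
      by (auto simp: indicator_def)
  qed
  also have "\<dots> \<le> ennreal (d\<^sup>2) * (\<integral>\<^sup>+x. gsq \<phi> x \<partial>lborel)"
    by (rule increment_L2_le[OF test_function_Ck[OF \<phi>]]) (use open_\<Omega> d nv in auto)
  also have "\<dots> = ennreal (d\<^sup>2 * (L2_norm \<Omega> (wgrad \<Omega> \<phi>))\<^sup>2)"
    by (simp add: test_function_energy[OF \<phi>, symmetric] ennreal_mult)
  finally show ?thesis by (simp add: ennreal_le_iff)
qed

lemma H10_approx:
  assumes "u \<in> H10 \<Omega>" "e > 0"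
  obtains \<phi> where "\<phi> \<in> test_functions \<Omega>" "(L2_norm \<Omega> (\<lambda>x. 1 * u x + (- 1) * \<phi> x))\<^sup>2 \<le> e"
    "(L2_norm \<Omega> (wgrad \<Omega> (\<lambda>x. 1 * u x + (- 1) * \<phi> x)))\<^sup>2 \<le> e"
proof -
  obtain \<phi> where \<phi>: "\<phi> \<in> test_functions \<Omega>" "wform 1 1 (\<lambda>x. 1 * u x + (- 1) * \<phi> x) (\<lambda>x. 1 * u x + (- 1) * \<phi> x) < e"
    using assms unfolding H10_iff by blast
  have "(L2_norm \<Omega> (\<lambda>x. 1 * u x + (- 1) * \<phi> x))\<^sup>2 + (L2_norm \<Omega> (wgrad \<Omega> (\<lambda>x. 1 * u x + (- 1) * \<phi> x)))\<^sup>2 < e"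
    using \<phi>(2) unfolding wform_self mult_1 .
  then have "(L2_norm \<Omega> (\<lambda>x. 1 * u x + (- 1) * \<phi> x))\<^sup>2 \<le> e"
    "(L2_norm \<Omega> (wgrad \<Omega> (\<lambda>x. 1 * u x + (- 1) * \<phi> x)))\<^sup>2 \<le> e"
    using zero_le_power2[of "L2_norm \<Omega> (\<lambda>x. 1 * u x + (- 1) * \<phi> x)"]
      zero_le_power2[of "L2_norm \<Omega> (wgrad \<Omega> (\<lambda>x. 1 * u x + (- 1) * \<phi> x))"] by linarith+
  with that \<phi>(1) show thesis by blast
qed

lemma poincare:
  assumes z: "z \<in> H10 \<Omega>" and g: "L2_norm \<Omega> (wgrad \<Omega> z) = 0"
  shows "L2_norm \<Omega> z = 0"
proof -
  obtain R where R: "R > 0" "\<And>x. x \<in> \<Omega> \<Longrightarrow> norm x \<le> R"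
    using bounded_\<Omega> unfolding bounded_pos by auto
  define d where "d = 2 * R + 1"
  have d: "norm (x - y) < d" if "x \<in> \<Omega>" "y \<in> \<Omega>" for x y
    using norm_triangle_ineq4[of x y] R(2)[OF that(1)] R(2)[OF that(2)] unfolding d_def by linarith
  have dpos: "d > 0" using R by (simp add: d_def)
  have *: "(L2_norm \<Omega> z)\<^sup>2 \<le> (2 + 4 * d\<^sup>2) * e" if e: "e > 0" for e
  proof -
    obtain \<phi> where \<phi>: "\<phi> \<in> test_functions \<Omega>" "(L2_norm \<Omega> (\<lambda>x. 1 * z x + (- 1) * \<phi> x))\<^sup>2 \<le> e"
      "(L2_norm \<Omega> (wgrad \<Omega> (\<lambda>x. 1 * z x + (- 1) * \<phi> x)))\<^sup>2 \<le> e"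
      using H10_approx[OF z e] by blast
    define k where "k x = 1 * z x + (- 1) * \<phi> x" for x
    have H1: "z \<in> H1 \<Omega>" "\<phi> \<in> H1 \<Omega>" "k \<in> H1 \<Omega>"
      unfolding k_def[abs_def] by (intro H10_H1 z test_function_H1 \<phi> H1_lincomb)+
    have zk: "z = (\<lambda>x. 1 * \<phi> x + 1 * k x)" and pk: "\<phi> = (\<lambda>x. 1 * z x + (- 1) * k x)"
      by (auto simp: k_def)
    have "(L2_norm \<Omega> (wgrad \<Omega> \<phi>))\<^sup>2 = wform 0 1 \<phi> \<phi>"
      by (simp add: wform_self)
    also have "\<dots> \<le> 2 * 1\<^sup>2 * wform 0 1 z z + 2 * (- 1)\<^sup>2 * wform 0 1 k k"
      using wform_lincomb_le[OF H1(1,3), of 0 1 1 "- 1", folded pk] by simp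
    also have "\<dots> \<le> 2 * e" using g \<phi>(3) by (simp add: wform_self k_def[abs_def])
    finally have 1: "(L2_norm \<Omega> (wgrad \<Omega> \<phi>))\<^sup>2 \<le> 2 * e" .
    have 2: "(L2_norm \<Omega> \<phi>)\<^sup>2 \<le> d\<^sup>2 * (2 * e)"
      by (rule order_trans[OF poincare_test_function[OF \<phi>(1) dpos d] mult_left_mono[OF 1]]) auto
    have "(L2_norm \<Omega> z)\<^sup>2 = wform 1 0 z z"
      by (simp add: wform_self)
    also have "\<dots> \<le> 2 * 1\<^sup>2 * wform 1 0 \<phi> \<phi> + 2 * 1\<^sup>2 * wform 1 0 k k"
      using wform_lincomb_le[OF H1(2,3), of 1 0 1 1, folded zk] by simp
    also have "\<dots> \<le> 2 * (d\<^sup>2 * (2 * e)) + 2 * e" using 2 \<phi>(2) by (simp add: wform_self k_def[abs_def])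
    finally show ?thesis by (simp add: algebra_simps)
  qed
  have pos: "2 + 4 * d\<^sup>2 > 0" by (simp add: add_pos_nonneg)
  have "(L2_norm \<Omega> z)\<^sup>2 \<le> 0"
  proof (rule field_le_epsilon)
    fix e :: real assume "e > 0"
    then show "(L2_norm \<Omega> z)\<^sup>2 \<le> 0 + e"
      using *[of "e / (2 + 4 * d\<^sup>2)"] pos by simp
  qed
  then show ?thesis by simp
qed

end

section \<open>Quasi-interpolation\<close>

text \<open>
  Compare the values at the two ends of the diameter of the ball in the direction of \<open>b\<close>.
\<close>

lemma norm_gradient_le_oscillation:
  fixes b :: "'a::real_inner"
  assumes "cball z r \<subseteq> K" "r > 0" "\<And>p. p \<in> K \<Longrightarrow> \<bar>c + b \<bullet> p - m\<bar> \<le> M"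
  shows "r * norm b \<le> M"
proof (cases "b = 0")
  case False
  define e where "e = (r / norm b) *\<^sub>R b"
  have e: "norm e = r" "b \<bullet> e = r * norm b"
    using assms(2) False by (auto simp: e_def dot_square_norm power2_eq_square)
  have "z + e \<in> K" "z - e \<in> K" using assms(1) e by (auto simp: dist_norm)
  then have "\<bar>c + b \<bullet> (z + e) - m\<bar> \<le> M" "\<bar>c + b \<bullet> (z - e) - m\<bar> \<le> M" using assms(3) by blast+
  then have "2 * (b \<bullet> e) \<le> 2 * M" by (simp add: inner_add_right inner_diff_right)
  then show ?thesis using e by simp
next
  case True
  have "z \<in> K" using assms by auto
  from assms(3)[OF this] show ?thesis using True by simp
qed

text \<open>
  The factor 4 allows for the supremum in \<open>ball_diameter\<close>, which need not be attained: half of it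
  is exceeded by the diameter \<open>2 * r\<close> of some ball.
\<close>

lemma inscribed_ball:
  assumes K: "bounded K" "diameter K > 0" and reg: "diameter K \<le> \<sigma> * ball_diameter K" and "\<sigma> > 0"
  obtains z r where "r > 0" "cball z r \<subseteq> K" "diameter K \<le> 4 * \<sigma> * r"
proof -
  let ?D = "{2 * r | r. 0 \<le> r \<and> (\<exists>c. cball c r \<subseteq> K)}"
  have "0 < \<sigma> * ball_diameter K" using K reg by linarith
  then have pos: "ball_diameter K > 0" using \<open>\<sigma> > 0\<close> by (simp add: zero_less_mult_iff)
  have "K \<noteq> {}" using K(2) by auto
  then obtain k where "k \<in> K" by blast
  then have "2 * 0 \<in> ?D" by (intro CollectI exI[of _ 0] conjI exI[of _ k]) auto
  then have "?D \<noteq> {}" by blast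
  moreover have "ball_diameter K / 2 < Sup ?D" using pos by (simp add: ball_diameter_def)
  ultimately obtain y where "y \<in> ?D" "ball_diameter K / 2 < y" using less_cSupE by blast
  then obtain r z where r: "cball z r \<subseteq> K" "ball_diameter K / 2 < 2 * r" by blast
  have "\<sigma> * ball_diameter K \<le> \<sigma> * (4 * r)" using r(2) \<open>\<sigma> > 0\<close> by (intro mult_left_mono) auto
  then show thesis using that[of r z] r pos reg by (simp add: mult_ac)
qed

context convex_domain
begin

text \<open>
  The nodal values of the quasi-interpolant. Averaging makes them depend continuously on the gradient
  in \<open>L\<^sup>2\<close>; stretching first makes them vanish on the boundary, because it moves every boundary
  point farther than the radius of averaging \<open>h * r0\<close> away from the domain.
\<close>

definition avg :: "real \<Rightarrow> (real^2 \<Rightarrow> real) \<Rightarrow> real^2 \<Rightarrow> real" where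
  "avg h \<phi> x = (LINT z|lborel. indicator (cball 0 (h * r0)) z * \<phi> (stretch h x + z))
     / measure lborel (cball (0::real^2) (h * r0))"

context
  fixes \<phi> :: "real^2 \<Rightarrow> real" and h R :: real
  assumes \<phi>: "\<phi> \<in> test_functions \<Omega>" and h: "h > 0"
    and radius: "\<forall>x\<in>closure \<Omega>. norm (x - x0) \<le> R"
begin

private lemma R: "x \<in> closure \<Omega> \<Longrightarrow> norm (x - x0) \<le> R"
  using radius by blast

private abbreviation "B \<equiv> cball (0::real^2) (h * r0)"
private abbreviation "\<mu> \<equiv> measure lborel B"
private abbreviation "dirichlet \<equiv> \<integral>\<^sup>+x. gsq \<phi> x \<partial>lborel"

text \<open>
  In the radius, \<open>1\<close> accounts for the size of a cell, \<open>R\<close> for the stretching and \<open>r0\<close> for the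
  averaging, all in units of \<open>h\<close>.
\<close>

definition local_energy :: "real^2 \<Rightarrow> ennreal" where
  "local_energy x = (\<integral>\<^sup>+y. indicator (cball x ((1 + R + r0) * h)) y * gsq \<phi> y \<partial>lborel)"

lemma R_nonneg: "R \<ge> 0"
proof -
  have "x0 \<in> closure \<Omega>" using ball_\<Omega> r0 closure_subset by fastforce
  from R[OF this] show ?thesis by simp
qed

private lemma \<mu>_pos: "\<mu> > 0"
  using h r0 by simp

private lemma emeasure_B: "emeasure lborel B = ennreal \<mu>"
  using emeasure_lborel_cball_finite[of "0::real^2" "h * r0"]
  by (intro emeasure_eq_ennreal_measure) auto

private lemma B_measurable: "B \<in> sets borel" by simp

private lemma Ck1: "Ck 1 \<phi>" by (rule test_function_Ck[OF \<phi>])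

lemma gsq_\<phi>_measurable: "gsq \<phi> \<in> borel_measurable borel" by (rule gsq_measurable[OF Ck1])

lemma test_function_measurable: "\<phi> \<in> borel_measurable borel"
  using Ck_continuous[OF Ck1] by (rule borel_measurable_continuous_onI)

lemma avg_measurable: "avg h \<phi> \<in> borel_measurable borel"
proof -
  note [measurable] = test_function_measurable B_measurable
  show ?thesis unfolding avg_def[abs_def] stretch_def by measurable
qed

lemma average_square_le:
  assumes f: "f \<in> borel_measurable borel"
  shows "ennreal (((LINT z|lborel. indicator B z * f z) / \<mu>)\<^sup>2)
    \<le> ennreal (1 / \<mu>) * (\<integral>\<^sup>+z. indicator B z * ennreal ((f z)\<^sup>2) \<partial>lborel)"
proof -
  have "ennreal (((LINT z|lborel. indicator B z * f z) / \<mu>)\<^sup>2)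
    = ennreal (1 / \<mu>\<^sup>2) * ennreal ((LINT z|lborel. indicator B z * f z)\<^sup>2)"
    by (simp add: power_divide flip: ennreal_mult)
  also have "\<dots> \<le> ennreal (1 / \<mu>\<^sup>2) * (ennreal \<mu> * (\<integral>\<^sup>+z. indicator B z * ennreal ((f z)\<^sup>2) \<partial>lborel))"
    using integral_square_le[of B f] f by (intro mult_left_mono) (simp_all add: emeasure_B)
  also have "\<dots> = ennreal (1 / \<mu>) * (\<integral>\<^sup>+z. indicator B z * ennreal ((f z)\<^sup>2) \<partial>lborel)"
    using \<mu>_pos by (simp add: power2_eq_square flip: mult.assoc ennreal_mult)
  finally show ?thesis .
qed

private lemma integrable_B: "integrable lborel (\<lambda>z. indicator B z * \<phi> (a + z))"
proof -
  have "integrable lborel (\<lambda>z. indicator B z *\<^sub>R \<phi> (a + z))"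
    by (rule borel_integrable_compact)
      (auto intro!: continuous_intros continuous_on_compose2[OF Ck_continuous[OF Ck1]])
  then show ?thesis by simp
qed

text \<open>
  A point outside the domain is moved so far by the stretching that the ball of averaging misses the
  domain.
\<close>

lemma avg_outside: "x \<notin> \<Omega> \<Longrightarrow> avg h \<phi> x = 0"
proof -
  assume x: "x \<notin> \<Omega>"
  obtain S where S: "compact S" "S \<subseteq> \<Omega>" "\<And>x. x \<notin> S \<Longrightarrow> \<phi> x = 0"
    using test_function_support[OF \<phi>] by blast
  have z0: "indicator B z * \<phi> (stretch h x + z) = 0" for z
  proof (cases "z \<in> B")
    case True
    then have "stretch h x + z \<notin> \<Omega>"
      using stretch_into_domain[OF h, of z x] x closure_subset by auto
    then show ?thesis using S by auto
  qed simp
  show ?thesis unfolding avg_def z0 by simp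
qed

text \<open>
  Write the increment of \<open>\<phi>\<close> between the two shifted balls as an integral of the gradient along
  the segment joining their centres. Every ball met on the way lies in the ball of
  \<open>local_energy\<close> around any point of \<open>K\<close>, so exchanging the integrals over the segment
  and over the ball yields the bound.
\<close>

lemma avg_difference_le:
  assumes K: "convex K" "K \<subseteq> closure \<Omega>" "\<And>p q. p \<in> K \<Longrightarrow> q \<in> K \<Longrightarrow> norm (p - q) \<le> h"
    and x: "x \<in> K" and pq: "p \<in> K" "q \<in> K"
  shows "ennreal ((avg h \<phi> p - avg h \<phi> q)\<^sup>2) \<le> ennreal ((norm (p - q))\<^sup>2) * (ennreal ((1 + h)\<^sup>2 / \<mu>) * local_energy x)"
proof -
  note [measurable] = gsq_\<phi>_measurable test_function_measurable B_measurable
  define w where "w = (1 + h) *\<^sub>R (p - q)"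
  have sp: "stretch h p + z = (stretch h q + z) + w" for z
    by (simp add: w_def stretch_def algebra_simps)
  have "avg h \<phi> p - avg h \<phi> q
      = (LINT z|lborel. indicator B z * (\<phi> ((stretch h q + z) + w) - \<phi> (stretch h q + z))) / \<mu>"
    using integrable_B[of "stretch h p"] integrable_B[of "stretch h q"]
    by (simp add: avg_def diff_divide_distrib right_diff_distrib sp)
  then have "ennreal ((avg h \<phi> p - avg h \<phi> q)\<^sup>2)
    \<le> ennreal (1 / \<mu>) * (\<integral>\<^sup>+z. indicator B z * ennreal ((\<phi> ((stretch h q + z) + w) - \<phi> (stretch h q + z))\<^sup>2) \<partial>lborel)"
    using average_square_le[of "\<lambda>z. \<phi> ((stretch h q + z) + w) - \<phi> (stretch h q + z)"] by simp
  also have "\<dots> \<le> ennreal (1 / \<mu>) * (\<integral>\<^sup>+z. ennreal ((norm w)\<^sup>2) * (indicator B z *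
      (\<integral>\<^sup>+t. indicator {0..1} t * gsq \<phi> ((stretch h q + z) + t *\<^sub>R w) \<partial>lborel)) \<partial>lborel)"
    using difference_square_le[OF Ck1] by (intro mult_left_mono nn_integral_mono) (auto simp: indicator_def)
  also have "\<dots> = ennreal (1 / \<mu>) * (ennreal ((norm w)\<^sup>2) * (\<integral>\<^sup>+z. indicator B z *
      (\<integral>\<^sup>+t. indicator {0..1} t * gsq \<phi> ((stretch h q + z) + t *\<^sub>R w) \<partial>lborel) \<partial>lborel))"
    by (rule arg_cong[where f="(*) (ennreal (1 / \<mu>))"], rule nn_integral_cmult) measurable
  also have "(\<integral>\<^sup>+z. indicator B z *
      (\<integral>\<^sup>+t. indicator {0..1} t * gsq \<phi> ((stretch h q + z) + t *\<^sub>R w) \<partial>lborel) \<partial>lborel)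
    = (\<integral>\<^sup>+z. (\<integral>\<^sup>+t. indicator B z * (indicator {0..1} t * gsq \<phi> ((stretch h q + z) + t *\<^sub>R w)) \<partial>lborel) \<partial>lborel)"
    by (intro nn_integral_cong nn_integral_cmult[symmetric]) measurable
  also have "\<dots> = (\<integral>\<^sup>+t. (\<integral>\<^sup>+z. indicator B z * (indicator {0..1} t * gsq \<phi> ((stretch h q + z) + t *\<^sub>R w)) \<partial>lborel) \<partial>lborel)"
    by (rule nn_integral_swap) measurable
  also have "\<dots> \<le> (\<integral>\<^sup>+t. indicator {0..1::real} t * local_energy x \<partial>lborel)"
  proof (rule nn_integral_mono)
    fix t :: real
    show "(\<integral>\<^sup>+z. indicator B z * (indicator {0..1} t * gsq \<phi> ((stretch h q + z) + t *\<^sub>R w)) \<partial>lborel)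
      \<le> indicator {0..1} t * local_energy x"
    proof (cases "t \<in> {0..1}")
      case True
      define a where "a = stretch h q + t *\<^sub>R w"
      define k where "k = (1 - t) *\<^sub>R q + t *\<^sub>R p"
      have k: "k \<in> K" unfolding k_def using K(1) pq True by (intro convexD) auto
      have ak: "a = stretch h k" by (simp add: a_def k_def w_def stretch_def algebra_simps)
      have "norm (a - x) \<le> norm (h *\<^sub>R (k - x0)) + norm (k - x)"
      proof -
        have "a - x = h *\<^sub>R (k - x0) + (k - x)" by (simp add: ak stretch_def algebra_simps)
        then show ?thesis by (metis norm_triangle_ineq)
      qed
      also have "\<dots> \<le> h * R + h"
        using R[of k] k K(2) K(3)[OF k x] h by (intro add_mono) auto
      finally have ax: "norm (a - x) \<le> h * R + h" .
      have "(\<integral>\<^sup>+z. indicator B z * gsq \<phi> (a + z) \<partial>lborel) \<le> (\<integral>\<^sup>+z. indicator (cball x ((1 + R + r0) * h)) (a + z) * gsq \<phi> (a + z) \<partial>lborel)"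
      proof (rule nn_integral_mono)
        fix z
        have "a + z \<in> cball x ((1 + R + r0) * h)" if "z \<in> B"
        proof -
          have "norm (a + z - x) \<le> norm (a - x) + norm z"
            using norm_triangle_ineq[of "a - x" z] by (simp add: algebra_simps)
          also have "\<dots> \<le> (h * R + h) + h * r0" using ax that by (intro add_mono) auto
          finally show ?thesis by (simp add: dist_norm norm_minus_commute algebra_simps)
        qed
        then show "indicator B z * gsq \<phi> (a + z) \<le> indicator (cball x ((1 + R + r0) * h)) (a + z) * gsq \<phi> (a + z)"
          by (auto simp: indicator_def)
      qed
      also have "\<dots> = local_energy x"
        unfolding local_energy_def
        by (rule nn_integral_translate) (intro borel_measurable_times_ennreal borel_measurable_indicator gsq_\<phi>_measurable, simp)
      finally show ?thesis using True by (simp add: a_def algebra_simps)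
    qed simp
  qed
  also have "\<dots> = local_energy x" by (subst nn_integral_multc) auto
  finally have "ennreal ((avg h \<phi> p - avg h \<phi> q)\<^sup>2) \<le> ennreal (1 / \<mu>) * (ennreal ((norm w)\<^sup>2) * local_energy x)"
    by (simp add: mult_left_mono)
  also have "\<dots> = ennreal ((norm (p - q))\<^sup>2) * (ennreal ((1 + h)\<^sup>2 / \<mu>) * local_energy x)"
  proof -
    have "1 / \<mu> * (norm w)\<^sup>2 = (norm (p - q))\<^sup>2 * ((1 + h)\<^sup>2 / \<mu>)"
      using h by (simp add: w_def power_mult_distrib)
    then have "ennreal (1 / \<mu>) * ennreal ((norm w)\<^sup>2) = ennreal ((norm (p - q))\<^sup>2) * ennreal ((1 + h)\<^sup>2 / \<mu>)"
      using \<mu>_pos by (simp flip: ennreal_mult)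
    then show ?thesis by (simp flip: mult.assoc)
  qed
  finally show ?thesis .
qed

text \<open>
  The displacement from \<open>x\<close> to a point of its shifted ball consists of the stretching, at most
  \<open>h * R\<close>, and of the averaging, at most \<open>h * r0\<close>.
\<close>

lemma avg_error:
  "(\<integral>\<^sup>+x. indicator \<Omega> x * ennreal ((\<phi> x - avg h \<phi> x)\<^sup>2) \<partial>lborel) \<le> ennreal ((h * (R + r0))\<^sup>2) * dirichlet"
proof -
  note [measurable] = gsq_\<phi>_measurable test_function_measurable B_measurable
  have [measurable]: "\<Omega> \<in> sets borel" using open_\<Omega> by simp
  have st: "stretch h x + z = x + (h *\<^sub>R x + (z - h *\<^sub>R x0))" for x z
    by (simp add: stretch_def algebra_simps)
  have one: "ennreal ((\<phi> x - avg h \<phi> x)\<^sup>2)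
      \<le> ennreal (1 / \<mu>) * (\<integral>\<^sup>+z. indicator B z * ennreal ((\<phi> (stretch h x + z) - \<phi> x)\<^sup>2) \<partial>lborel)" for x
  proof -
    have i: "integrable lborel (\<lambda>z. indicator B z * \<phi> x)"
      using emeasure_lborel_cball_finite by (intro integrable_mult_left) (auto simp: integrable_indicator_iff)
    have "(LINT z|lborel. indicator B z * \<phi> x) = \<mu> * \<phi> x"
      using emeasure_lborel_cball_finite by simp
    then have "avg h \<phi> x - \<phi> x = (LINT z|lborel. indicator B z * (\<phi> (stretch h x + z) - \<phi> x)) / \<mu>"
      using integrable_B[of "stretch h x"] i \<mu>_pos
      by (simp add: avg_def right_diff_distrib diff_divide_distrib)
    then show ?thesis
      using average_square_le[of "\<lambda>z. \<phi> (stretch h x + z) - \<phi> x"] power2_commute[of "\<phi> x" "avg h \<phi> x"] by simp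
  qed
  have "(\<integral>\<^sup>+x. indicator \<Omega> x * ennreal ((\<phi> x - avg h \<phi> x)\<^sup>2) \<partial>lborel)
    \<le> (\<integral>\<^sup>+x. ennreal (1 / \<mu>) * (\<integral>\<^sup>+z. indicator B z * (indicator \<Omega> x * ennreal ((\<phi> (x + (h *\<^sub>R x + (z - h *\<^sub>R x0))) - \<phi> x)\<^sup>2)) \<partial>lborel) \<partial>lborel)"
    using one by (intro nn_integral_mono) (auto simp: indicator_def st)
  also have "\<dots> = ennreal (1 / \<mu>) * (\<integral>\<^sup>+x. (\<integral>\<^sup>+z. indicator B z * (indicator \<Omega> x * ennreal ((\<phi> (x + (h *\<^sub>R x + (z - h *\<^sub>R x0))) - \<phi> x)\<^sup>2)) \<partial>lborel) \<partial>lborel)"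
    by (rule nn_integral_cmult) measurable
  also have "(\<integral>\<^sup>+x. (\<integral>\<^sup>+z. indicator B z * (indicator \<Omega> x * ennreal ((\<phi> (x + (h *\<^sub>R x + (z - h *\<^sub>R x0))) - \<phi> x)\<^sup>2)) \<partial>lborel) \<partial>lborel)
    = (\<integral>\<^sup>+z. (\<integral>\<^sup>+x. indicator B z * (indicator \<Omega> x * ennreal ((\<phi> (x + (h *\<^sub>R x + (z - h *\<^sub>R x0))) - \<phi> x)\<^sup>2)) \<partial>lborel) \<partial>lborel)"
    by (rule nn_integral_swap) measurable
  also have "\<dots> \<le> (\<integral>\<^sup>+z. indicator B z * (ennreal ((h * (R + r0))\<^sup>2) * dirichlet) \<partial>lborel)"
  proof (rule nn_integral_mono)
    fix z
    show "(\<integral>\<^sup>+x. indicator B z * (indicator \<Omega> x * ennreal ((\<phi> (x + (h *\<^sub>R x + (z - h *\<^sub>R x0))) - \<phi> x)\<^sup>2)) \<partial>lborel)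
      \<le> indicator B z * (ennreal ((h * (R + r0))\<^sup>2) * dirichlet)"
    proof (cases "z \<in> B")
      case True
      have "(\<integral>\<^sup>+x. indicator \<Omega> x * ennreal ((\<phi> (x + (h *\<^sub>R x + (z - h *\<^sub>R x0))) - \<phi> x)\<^sup>2) \<partial>lborel)
        \<le> ennreal ((h * (R + r0))\<^sup>2) * dirichlet"
      proof (rule increment_L2_le[OF Ck1])
        fix x assume x: "x \<in> \<Omega>"
        have "norm (h *\<^sub>R x + (z - h *\<^sub>R x0)) \<le> norm (h *\<^sub>R (x - x0)) + norm z"
          using norm_triangle_ineq[of "h *\<^sub>R (x - x0)" z] by (simp add: algebra_simps)
        also have "\<dots> \<le> h * R + h * r0"
          using R[of x] x closure_subset True h by (intro add_mono) auto
        finally show "norm (h *\<^sub>R x + (z - h *\<^sub>R x0)) \<le> h * (R + r0)" by (simp add: algebra_simps)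
      qed (use h R_nonneg r0 in auto)
      then show ?thesis using True by simp
    qed simp
  qed
  also have "\<dots> = ennreal \<mu> * (ennreal ((h * (R + r0))\<^sup>2) * dirichlet)"
    by (subst nn_integral_multc) (auto simp: emeasure_B)
  finally have "(\<integral>\<^sup>+x. indicator \<Omega> x * ennreal ((\<phi> x - avg h \<phi> x)\<^sup>2) \<partial>lborel)
     \<le> ennreal (1 / \<mu>) * (ennreal \<mu> * (ennreal ((h * (R + r0))\<^sup>2) * dirichlet))"
    by (simp add: mult_left_mono)
  also have "\<dots> = ennreal ((h * (R + r0))\<^sup>2) * dirichlet"
    using \<mu>_pos by (simp flip: mult.assoc ennreal_mult)
  finally show ?thesis .
qed

text \<open>
  The pairs of points at distance at most the radius form a closed set.
\<close>

lemma local_energy_integrand_measurable: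
  "(\<lambda>(x, y). indicator (cball x ((1 + R + r0) * h)) y * gsq \<phi> y) \<in> borel_measurable (borel \<Otimes>\<^sub>M borel)"
proof -
  note [measurable] = gsq_\<phi>_measurable test_function_measurable B_measurable
  define D where "D = {p::(real^2) \<times> (real^2). dist (fst p) (snd p) \<le> (1 + R + r0) * h}"
  have "closed D"
    unfolding D_def by (intro closed_Collect_le continuous_intros)
  then have [measurable]: "D \<in> sets (borel \<Otimes>\<^sub>M borel)"
    unfolding borel_prod by simp
  have "(\<lambda>p. indicator D p * gsq \<phi> (snd p)) \<in> borel_measurable (borel \<Otimes>\<^sub>M borel)"
    by measurable
  moreover have "(\<lambda>(x, y). indicator (cball x ((1 + R + r0) * h)) y * gsq \<phi> y) = (\<lambda>p. indicator D p * gsq \<phi> (snd p))"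
    by (auto simp: indicator_def D_def fun_eq_iff)
  ultimately show ?thesis by simp
qed

lemma local_energy_measurable: "local_energy \<in> borel_measurable borel"
proof -
  have "(\<lambda>(x, y). indicator (cball x ((1 + R + r0) * h)) y * gsq \<phi> y) \<in> borel_measurable (borel \<Otimes>\<^sub>M lborel)"
    using local_energy_integrand_measurable by (simp cong: measurable_cong_sets sets_pair_measure_cong)
  from lborel.borel_measurable_nn_integral[OF this] show ?thesis
    by (simp add: local_energy_def[abs_def])
qed

text \<open>
  Exchanging the integrals, each point is counted with the measure of one ball.
\<close>

lemma local_energy_total:
  "(\<integral>\<^sup>+x. local_energy x \<partial>lborel) = ennreal (measure lborel (cball (0::real^2) ((1 + R + r0) * h))) * dirichlet"
proof -
  note [measurable] = gsq_\<phi>_measurable test_function_measurable B_measurable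
  have "(\<integral>\<^sup>+x. local_energy x \<partial>lborel) = (\<integral>\<^sup>+y. (\<integral>\<^sup>+x. indicator (cball x ((1 + R + r0) * h)) y * gsq \<phi> y \<partial>lborel) \<partial>lborel)"
    unfolding local_energy_def by (rule nn_integral_swap[symmetric]) (rule local_energy_integrand_measurable)
  also have "\<dots> = (\<integral>\<^sup>+y. ennreal (measure lborel (cball (0::real^2) ((1 + R + r0) * h))) * gsq \<phi> y \<partial>lborel)"
  proof (rule nn_integral_cong)
    fix y
    have "(\<integral>\<^sup>+x. indicator (cball x ((1 + R + r0) * h)) y * gsq \<phi> y \<partial>lborel)
      = (\<integral>\<^sup>+x. indicator (cball y ((1 + R + r0) * h)) x * gsq \<phi> y \<partial>lborel)"
      by (intro nn_integral_cong) (auto simp: indicator_def dist_commute)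
    also have "\<dots> = emeasure lborel (cball y ((1 + R + r0) * h)) * gsq \<phi> y"
      by (subst nn_integral_multc) (auto intro!: borel_measurable_indicator)
    also have "emeasure lborel (cball y ((1 + R + r0) * h)) = ennreal (measure lborel (cball y ((1 + R + r0) * h)))"
      using emeasure_lborel_cball_finite[of y "(1 + R + r0) * h"] by (intro emeasure_eq_ennreal_measure) auto
    also have "measure lborel (cball y ((1 + R + r0) * h)) = measure lborel (cball (0::real^2) ((1 + R + r0) * h))"
      using h r0 R_nonneg by (simp add: content_cball)
    finally show "(\<integral>\<^sup>+x. indicator (cball x ((1 + R + r0) * h)) y * gsq \<phi> y \<partial>lborel)
      = ennreal (measure lborel (cball (0::real^2) ((1 + R + r0) * h))) * gsq \<phi> y" .
  qed
  also have "\<dots> = ennreal (measure lborel (cball (0::real^2) ((1 + R + r0) * h))) * dirichlet"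
    by (rule nn_integral_cmult) (simp add: gsq_\<phi>_measurable)
  finally show ?thesis .
qed

lemma ball_ratio: "measure lborel (cball (0::real^2) ((1 + R + r0) * h)) / \<mu> = ((1 + R + r0) / r0)\<^sup>2"
proof -
  have "measure lborel (cball (0::real^2) ((1 + R + r0) * h)) = unit_ball_vol 2 * ((1 + R + r0) * h)\<^sup>2"
    "\<mu> = unit_ball_vol 2 * (h * r0)\<^sup>2"
    using h r0 R_nonneg by (simp_all add: content_cball)
  moreover have "unit_ball_vol 2 \<noteq> (0::real)"
    using unit_ball_vol_pos[of 2] by linarith
  ultimately show ?thesis
    using h r0 by (simp add: power_mult_distrib power_divide)
qed

lemma dirichlet_finite: "dirichlet < \<infinity>"
  by (simp flip: test_function_energy[OF \<phi>])

lemma local_energy_le: "local_energy x \<le> dirichlet"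
  unfolding local_energy_def by (intro nn_integral_mono) (auto simp: indicator_def)

text \<open>
  On a cell the interpolant lies between its vertex values, which differ from the average at \<open>x\<close>
  by at most the diameter times the root \<open>s\<close> of the scaled local energy. The inscribed ball turns
  this oscillation into a bound for the gradient, in which the diameter cancels; hence small cells
  next to large ones do no harm.
\<close>

lemma cell_estimates:
  assumes K: "compact K" "convex K" "K \<subseteq> closure \<Omega>" "diameter K \<le> h" "diameter K > 0"
    and reg: "diameter K \<le> \<sigma> * ball_diameter K" "\<sigma> > 0"
    and v: "\<And>a. a extreme_point_of K \<Longrightarrow> c + b \<bullet> a = avg h \<phi> a" and x: "x \<in> K"
  shows "ennreal ((c + b \<bullet> x - avg h \<phi> x)\<^sup>2) \<le> ennreal (h\<^sup>2 * (1 + h)\<^sup>2 / \<mu>) * local_energy x"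
    and "ennreal ((norm b)\<^sup>2) \<le> ennreal (16 * \<sigma>\<^sup>2 * (1 + h)\<^sup>2 / \<mu>) * local_energy x"
proof -
  have bK: "bounded K" using K(1) compact_imp_bounded by blast
  have dK: "norm (p - q) \<le> diameter K" if "p \<in> K" "q \<in> K" for p q
    using diameter_bounded_bound[OF bK that] by (simp add: dist_norm)
  define s where "s = sqrt (enn2real (ennreal ((1 + h)\<^sup>2 / \<mu>) * local_energy x))"
  have fin: "ennreal ((1 + h)\<^sup>2 / \<mu>) * local_energy x < \<infinity>"
    using le_less_trans[OF local_energy_le[of x] dirichlet_finite] by (simp add: ennreal_mult_less_top)
  have s0: "s \<ge> 0" by (simp add: s_def)
  have s2: "ennreal (s\<^sup>2) = ennreal ((1 + h)\<^sup>2 / \<mu>) * local_energy x"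
    using fin by (simp add: s_def)
  have lip: "\<bar>avg h \<phi> p - avg h \<phi> q\<bar> \<le> norm (p - q) * s" if "p \<in> K" "q \<in> K" for p q
  proof -
    have "ennreal ((avg h \<phi> p - avg h \<phi> q)\<^sup>2) \<le> ennreal ((norm (p - q))\<^sup>2) * ennreal (s\<^sup>2)"
      unfolding s2 by (rule avg_difference_le[OF K(2,3) _ x that]) (use dK K(4) in force)
    then have "(avg h \<phi> p - avg h \<phi> q)\<^sup>2 \<le> (norm (p - q) * s)\<^sup>2"
      by (simp add: power_mult_distrib flip: ennreal_mult)
    then show ?thesis using s0 by (simp add: abs_le_square_iff[symmetric])
  qed
  define M where "M = diameter K * s"
  have near: "\<bar>c + b \<bullet> p - avg h \<phi> x\<bar> \<le> M" if p: "p \<in> K" for p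
  proof -
    have vert: "\<bar>c + b \<bullet> a - avg h \<phi> x\<bar> \<le> M" if a: "a extreme_point_of K" for a
    proof -
      have "a \<in> K" using a by (simp add: extreme_point_of_def)
      then show ?thesis
        using lip[of a x] x dK[of a x] v[OF a] s0 unfolding M_def by (metis mult_right_mono order_trans)
    qed
    have "c + b \<bullet> p \<le> avg h \<phi> x + M"
      by (rule affine_le_on_extreme_points[OF K(1,2) _ p]) (use vert in \<open>smt (verit)\<close>)
    moreover have "- c + (- b) \<bullet> p \<le> M - avg h \<phi> x"
    proof (rule affine_le_on_extreme_points[OF K(1,2) _ p])
      show "- c + (- b) \<bullet> a \<le> M - avg h \<phi> x" if "a extreme_point_of K" for a
        using vert[OF that] by (simp add: abs_le_iff)
    qed
    ultimately show ?thesis by (simp add: abs_le_iff)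
  qed
  have "M \<le> h * s" unfolding M_def using K(4) s0 by (rule mult_right_mono)
  then have "\<bar>c + b \<bullet> x - avg h \<phi> x\<bar> \<le> h * s" using near[OF x] by linarith
  then have "(c + b \<bullet> x - avg h \<phi> x)\<^sup>2 \<le> (h * s)\<^sup>2" using s0 h by (simp add: abs_le_square_iff[symmetric])
  then have "ennreal ((c + b \<bullet> x - avg h \<phi> x)\<^sup>2) \<le> ennreal (h\<^sup>2) * ennreal (s\<^sup>2)"
    by (simp add: power_mult_distrib ennreal_leI flip: ennreal_mult)
  also have "\<dots> = ennreal (h\<^sup>2 * (1 + h)\<^sup>2 / \<mu>) * local_energy x"
    unfolding s2 using \<mu>_pos by (simp flip: mult.assoc ennreal_mult)
  finally show "ennreal ((c + b \<bullet> x - avg h \<phi> x)\<^sup>2) \<le> ennreal (h\<^sup>2 * (1 + h)\<^sup>2 / \<mu>) * local_energy x" .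
  obtain z r where r: "r > 0" "cball z r \<subseteq> K" "diameter K \<le> 4 * \<sigma> * r"
    using inscribed_ball[OF bK K(5) reg] by blast
  have "r * norm b \<le> M" by (rule norm_gradient_le_oscillation[OF r(2,1) near])
  also have "\<dots> \<le> (4 * \<sigma> * r) * s" unfolding M_def using r(3) s0 by (rule mult_right_mono)
  finally have "r * norm b \<le> r * (4 * \<sigma> * s)" by (simp add: mult_ac)
  then have "norm b \<le> 4 * \<sigma> * s" using r(1) by simp
  then have "(norm b)\<^sup>2 \<le> (4 * \<sigma> * s)\<^sup>2" by (intro power_mono) auto
  then have "ennreal ((norm b)\<^sup>2) \<le> ennreal (16 * \<sigma>\<^sup>2) * ennreal (s\<^sup>2)"
    by (simp add: power_mult_distrib ennreal_leI flip: ennreal_mult)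
  also have "\<dots> = ennreal (16 * \<sigma>\<^sup>2 * (1 + h)\<^sup>2 / \<mu>) * local_energy x"
    unfolding s2 using \<mu>_pos by (simp flip: mult.assoc ennreal_mult)
  finally show "ennreal ((norm b)\<^sup>2) \<le> ennreal (16 * \<sigma>\<^sup>2 * (1 + h)\<^sup>2 / \<mu>) * local_energy x" .
qed

text \<open>
  Integrate a pointwise bound by a local energy; the ratio of the two ball measures is what turns
  \<open>1 / \<mu>\<close> into a constant that is free of \<open>h\<close>.
\<close>

lemma L2_norm_le_density:
  fixes k :: "real^2 \<Rightarrow> 'b::euclidean_space"
  assumes k: "k \<in> L2 \<Omega>" and F: "F \<in> borel_measurable borel" "(\<integral>\<^sup>+x. F x \<partial>lborel) \<le> ennreal f"
    and nn: "f \<ge> 0" "s \<ge> 0"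
    and ae: "AE x in lebesgue. x \<in> \<Omega> \<longrightarrow>
      ennreal ((norm (k x))\<^sup>2) \<le> 2 * F x + 2 * (ennreal (s * (1 + h)\<^sup>2 / \<mu>) * local_energy x)"
  shows "(L2_norm \<Omega> k)\<^sup>2 \<le> 2 * f + 2 * (s * (1 + h)\<^sup>2 * ((1 + R + r0) / r0)\<^sup>2 * (L2_norm \<Omega> (wgrad \<Omega> \<phi>))\<^sup>2)"
proof -
  note [measurable] = F(1) local_energy_measurable
  define c where "c = s * (1 + h)\<^sup>2 / \<mu>"
  define m where "m = measure lborel (cball (0::real^2) ((1 + R + r0) * h))"
  define D where "D = (L2_norm \<Omega> (wgrad \<Omega> \<phi>))\<^sup>2"
  have c: "c \<ge> 0" using nn \<mu>_pos by (simp add: c_def)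
  have "ennreal ((L2_norm \<Omega> k)\<^sup>2) = (\<integral>\<^sup>+x. indicator \<Omega> x * ennreal ((norm (k x))\<^sup>2) \<partial>lebesgue)"
    by (rule L2_norm_nn[OF k])
  also have "\<dots> \<le> (\<integral>\<^sup>+x. 2 * F x + 2 * (ennreal c * local_energy x) \<partial>lebesgue)"
  proof (rule nn_integral_mono_AE)
    show "AE x in lebesgue. indicator \<Omega> x * ennreal ((norm (k x))\<^sup>2) \<le> 2 * F x + 2 * (ennreal c * local_energy x)"
      using ae by eventually_elim (auto simp: indicator_def c_def)
  qed
  also have "\<dots> = (\<integral>\<^sup>+x. 2 * F x \<partial>lborel) + (\<integral>\<^sup>+x. 2 * (ennreal c * local_energy x) \<partial>lborel)"
    unfolding nn_integral_completion by (rule nn_integral_add) measurable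
  also have "(\<integral>\<^sup>+x. 2 * F x \<partial>lborel) = 2 * (\<integral>\<^sup>+x. F x \<partial>lborel)"
    by (rule nn_integral_cmult) measurable
  also have "(\<integral>\<^sup>+x. 2 * (ennreal c * local_energy x) \<partial>lborel) = 2 * (\<integral>\<^sup>+x. ennreal c * local_energy x \<partial>lborel)"
    by (rule nn_integral_cmult) measurable
  also have "(\<integral>\<^sup>+x. ennreal c * local_energy x \<partial>lborel) = ennreal c * (\<integral>\<^sup>+x. local_energy x \<partial>lborel)"
    by (rule nn_integral_cmult) measurable
  also have "(\<integral>\<^sup>+x. local_energy x \<partial>lborel) = ennreal m * ennreal D"
    by (simp add: local_energy_total m_def D_def test_function_energy[OF \<phi>])
  also have "2 * (\<integral>\<^sup>+x. F x \<partial>lborel) + 2 * (ennreal c * (ennreal m * ennreal D))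
      \<le> 2 * ennreal f + 2 * (ennreal c * (ennreal m * ennreal D))"
    using F(2) by (intro add_right_mono mult_left_mono) auto
  also have "\<dots> = ennreal (2 * f + 2 * (c * (m * D)))"
    using nn c by (simp add: ennreal_mult m_def D_def)
  finally have le: "ennreal ((L2_norm \<Omega> k)\<^sup>2) \<le> ennreal (2 * f + 2 * (c * (m * D)))" .
  have "0 \<le> 2 * f + 2 * (c * (m * D))" using nn c by (simp add: m_def D_def)
  from iffD1[OF ennreal_le_iff[OF this] le]
  have "(L2_norm \<Omega> k)\<^sup>2 \<le> 2 * f + 2 * (c * (m * D))" .
  also have "c * (m * D) = s * (1 + h)\<^sup>2 * (m / \<mu>) * D"
    by (simp add: c_def)
  finally show ?thesis
    unfolding m_def D_def ball_ratio .
qed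

end

end

section \<open>Finite-dimensional projections\<close>

context bounded_domain
begin

lemma weak_gradient_cong:
  assumes "\<And>x. x \<in> \<Omega> \<Longrightarrow> u x = v x"
  shows "is_weak_gradient \<Omega> u g \<longleftrightarrow> is_weak_gradient \<Omega> v g"
proof -
  have "(LINT x|lebesgue_on \<Omega>. u x * partial_deriv i \<phi> x) = (LINT x|lebesgue_on \<Omega>. v x * partial_deriv i \<phi> x)" for i \<phi>
    by (rule Bochner_Integration.integral_cong) (use assms in auto)
  then show ?thesis by (simp add: is_weak_gradient_def)
qed

lemma wgrad_cong: "(\<And>x. x \<in> \<Omega> \<Longrightarrow> u x = v x) \<Longrightarrow> wgrad \<Omega> u = wgrad \<Omega> v"
  using weak_gradient_cong[of u v] by (simp add: wgrad_def)

lemma L2_norm_cong: "(\<And>x. x \<in> \<Omega> \<Longrightarrow> u x = v x) \<Longrightarrow> L2_norm \<Omega> u = L2_norm \<Omega> v"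
  unfolding L2_norm_def by (rule arg_cong[where f=sqrt], rule Bochner_Integration.integral_cong) auto

lemma wform_self_cong: "(\<And>x. x \<in> \<Omega> \<Longrightarrow> u x = v x) \<Longrightarrow> wform p c u u = wform p c v v"
  using L2_norm_cong[of u v] wgrad_cong[of u v] by (simp add: wform_self)

lemma wform_sum:
  assumes "finite I" "\<And>i. i \<in> I \<Longrightarrow> f i \<in> H10 \<Omega>" "w \<in> H1 \<Omega>"
  shows "wform p c (\<lambda>x. \<Sum>i\<in>I. s i * f i x) w = (\<Sum>i\<in>I. s i * wform p c (f i) w)"
  using assms(1,2)
proof (induction I rule: finite_induct)
  case empty
  have z: "(\<lambda>x. 0) \<in> H1 \<Omega>" using zero_H10 H10_H1 by blast
  show ?case using wform_lincomb[OF z z assms(3), of p c 0 0] by simp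
next
  case (insert i I)
  have "wform p c (\<lambda>x. s i * f i x + 1 * (\<Sum>i\<in>I. s i * f i x)) w
     = s i * wform p c (f i) w + 1 * wform p c (\<lambda>x. \<Sum>i\<in>I. s i * f i x) w"
    by (rule wform_lincomb) (use insert H10_sum[of I f s] assms(3) H10_H1 in auto)
  then show ?case using insert by simp
qed

lemma bilin_sum_left:
  assumes A: "elliptic_coefficient \<Omega> \<alpha> \<beta> A"
    and "finite I" "\<And>i. i \<in> I \<Longrightarrow> f i \<in> H10 \<Omega>" "w \<in> H1 \<Omega>"
  shows "bilin \<Omega> A (\<lambda>x. \<Sum>i\<in>I. s i * f i x) w = (\<Sum>i\<in>I. s i * bilin \<Omega> A (f i) w)"
  using assms(2,3)
proof (induction I rule: finite_induct)
  case empty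
  have z: "(\<lambda>x. 0) \<in> H1 \<Omega>" using zero_H10 H10_H1 by blast
  show ?case using bilin_lincomb[OF A z z assms(4), of 0 0] by simp
next
  case (insert i I)
  have "bilin \<Omega> A (\<lambda>x. s i * f i x + 1 * (\<Sum>i\<in>I. s i * f i x)) w
     = s i * bilin \<Omega> A (f i) w + 1 * bilin \<Omega> A (\<lambda>x. \<Sum>i\<in>I. s i * f i x) w"
    by (rule bilin_lincomb[OF A]) (use insert H10_sum[of I f s] assms(4) H10_H1 in auto)
  then show ?case using insert by simp
qed

text \<open>
  Otherwise the quadratic function \<open>s \<mapsto> wform p c (u + s z) (u + s z)\<close> would be affine and
  nonconstant, hence somewhere negative.
\<close>

lemma wform_null:
  assumes "p \<ge> 0" "c \<ge> 0" "u \<in> H1 \<Omega>" "z \<in> H1 \<Omega>" "wform p c z z = 0"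
  shows "wform p c u z = 0"
proof (rule ccontr)
  assume nz: "wform p c u z \<noteq> 0"
  define s where "s = - (wform p c u u + 1) / (2 * wform p c u z)"
  have "0 \<le> wform p c u u + 2 * s * wform p c u z"
    using wform_nonneg[OF assms(1,2), of "\<lambda>x. 1 * u x + s * z x"] wform_expand[OF assms(3,4), of p c 1 s] assms(5)
    by simp
  moreover have "2 * s * wform p c u z = - (wform p c u u + 1)" using nz by (simp add: s_def)
  ultimately show False by linarith
qed

text \<open>
  Gram--Schmidt, with the new direction made orthogonal to the old ones first. A direction of
  seminorm zero is orthogonal to everything and needs no correction; the quotient \<open>r\<close> is then
  \<open>0 / 0 = 0\<close>.
\<close>

lemma projection_exists:
  assumes pc: "p \<ge> 0" "c \<ge> 0" and "finite I" "\<And>i. i \<in> I \<Longrightarrow> f i \<in> H10 \<Omega>" "u \<in> H10 \<Omega>"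
  shows "\<exists>s. \<forall>j\<in>I. wform p c (\<lambda>x. 1 * u x + (- 1) * (\<Sum>i\<in>I. s i * f i x)) (f j) = 0"
  using assms(3-5)
proof (induction I arbitrary: u rule: finite_induct)
  case (insert i I)
  let ?S = "\<lambda>s x. \<Sum>i\<in>I. s i * f i x"
  have fI: "\<And>j. j \<in> I \<Longrightarrow> f j \<in> H10 \<Omega>" and fi: "f i \<in> H10 \<Omega>" using insert by auto
  obtain s where s: "\<And>j. j \<in> I \<Longrightarrow> wform p c (\<lambda>x. 1 * u x + (- 1) * ?S s x) (f j) = 0"
    using insert.IH[OF fI \<open>u \<in> H10 \<Omega>\<close>] by blast
  obtain t where t: "\<And>j. j \<in> I \<Longrightarrow> wform p c (\<lambda>x. 1 * f i x + (- 1) * ?S t x) (f j) = 0"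
    using insert.IH[OF fI fi] by blast
  define u' where "u' x = 1 * u x + (- 1) * ?S s x" for x
  define k where "k x = 1 * f i x + (- 1) * ?S t x" for x
  have H: "u' \<in> H1 \<Omega>" "k \<in> H1 \<Omega>" "?S t \<in> H1 \<Omega>"
    unfolding u'_def[abs_def] k_def[abs_def]
    by (intro H10_H1 H10_lincomb H10_sum insert fI fi; assumption?)+
  define r where "r = wform p c u' k / wform p c k k"
  have rk: "wform p c u' k - r * wform p c k k = 0"
    using wform_null[OF pc H(1,2)] by (auto simp: r_def)
  define v where "v x = 1 * u' x + (- r) * k x" for x
  have vH: "v \<in> H1 \<Omega>" unfolding v_def[abs_def] by (intro H1_lincomb H)
  have vj: "wform p c v (f j) = 0" if "j \<in> I" for j
    unfolding v_def[abs_def] using that s t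
    by (subst wform_lincomb[OF H(1,2) H10_H1[OF fI]]) (auto simp: u'_def[abs_def] k_def[abs_def])
  have vk: "wform p c v k = 0"
    unfolding v_def[abs_def] using rk by (subst wform_lincomb[OF H(1,2,2)]) simp
  have fik: "f i = (\<lambda>x. 1 * k x + 1 * ?S t x)" by (auto simp: k_def)
  have "wform p c v (f i) = wform p c (\<lambda>x. 1 * k x + 1 * ?S t x) v"
    by (subst fik) (rule wform_commute)
  also have "\<dots> = wform p c k v + wform p c (?S t) v"
    using wform_lincomb[OF H(2,3) vH, of p c 1 1] by simp
  also have "wform p c (?S t) v = 0"
    using wform_sum[of I f v p c t, OF insert.hyps(1) fI vH] vj by (simp add: wform_commute[of p c _ v])
  finally have vi: "wform p c v (f i) = 0" using vk by (simp add: wform_commute[of p c k v])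
  define q where "q j = (if j = i then r else s j - r * t j)" for j
  have "v = (\<lambda>x. 1 * u x + (- 1) * (\<Sum>j\<in>insert i I. q j * f j x))"
  proof
    fix x
    have "(\<Sum>j\<in>insert i I. q j * f j x) = r * f i x + (\<Sum>j\<in>I. (s j - r * t j) * f j x)"
      using insert.hyps by (auto simp: q_def intro!: sum.cong)
    also have "(\<Sum>j\<in>I. (s j - r * t j) * f j x) = ?S s x - r * ?S t x"
      by (simp add: left_diff_distrib sum_subtractf sum_distrib_left mult.assoc)
    finally show "v x = 1 * u x + (- 1) * (\<Sum>j\<in>insert i I. q j * f j x)"
      by (simp add: v_def u'_def k_def algebra_simps)
  qed
  then show ?case using vi vj by (intro exI[of _ q]) auto
qed simp

end

section \<open>The coarse space and the kernel of the interpolation\<close>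

context mesh
begin

abbreviation "hat \<equiv> nodal_basis \<Omega> T"
abbreviation "nodes \<equiv> interior_nodes \<Omega> T"
abbreviation "h \<equiv> mesh_size T"

text \<open>
  The interpolant of the vertex values of a hat function satisfies the description, so the choice in
  the definition of \<open>nodal_basis\<close> is not void.
\<close>

lemma hat_spec:
  assumes "a \<in> nodes"
  shows "hat a \<in> Vh \<Omega> T" "hat a a = 1" "\<And>b. b \<in> mesh_vertices T \<Longrightarrow> b \<noteq> a \<Longrightarrow> hat a b = 0"
proof -
  have a: "a \<in> mesh_vertices T" "a \<in> \<Omega>" using assms by (auto simp: interior_nodes_def)
  obtain w c b where w: "\<And>K x. K \<in> T \<Longrightarrow> x \<in> K \<Longrightarrow> w x = c K + b K \<bullet> x"
    "\<And>v. v \<in> mesh_vertices T \<Longrightarrow> w v = (if v = a then 1 else 0)" "w \<in> H10 \<Omega>"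
    using pw_affine_interpolant[of "\<lambda>v. if v = a then 1 else 0"] a(2) by (smt (verit, best))
  have "w \<in> Vh \<Omega> T \<and> w a = 1 \<and> (\<forall>b\<in>mesh_vertices T - {a}. w b = 0)"
    using w a by (auto simp: Vh_def)
  then have "hat a \<in> Vh \<Omega> T \<and> hat a a = 1 \<and> (\<forall>b\<in>mesh_vertices T - {a}. hat a b = 0)"
    unfolding nodal_basis_def by (rule someI[where P="\<lambda>l. l \<in> Vh \<Omega> T \<and> l a = 1 \<and> (\<forall>b\<in>mesh_vertices T - {a}. l b = 0)"])
  then show "hat a \<in> Vh \<Omega> T" "hat a a = 1" "\<And>b. b \<in> mesh_vertices T \<Longrightarrow> b \<noteq> a \<Longrightarrow> hat a b = 0"
    by auto
qed

lemma hat_H10: "a \<in> nodes \<Longrightarrow> hat a \<in> H10 \<Omega>"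
  using hat_spec(1) by (simp add: Vh_def)

lemma hat_pw_affine: "a \<in> nodes \<Longrightarrow> pw_affine (hat a)"
  using hat_spec(1) by (simp add: Vh_def pw_affine_def)

text \<open>
  On the closure of the domain a hat function coincides with its continuous interpolant, which is
  nonnegative and equals 1 at the node.
\<close>

lemma hat_integral_pos:
  assumes a: "a \<in> nodes"
  shows "(LINT x|lebesgue_on \<Omega>. hat a x) > 0"
proof -
  have aM: "a \<in> mesh_vertices T" "a \<in> \<Omega>" using a by (auto simp: interior_nodes_def)
  obtain w c b L where w: "\<And>K x. K \<in> T \<Longrightarrow> x \<in> K \<Longrightarrow> w x = c K + b K \<bullet> x"
    "\<And>v. v \<in> mesh_vertices T \<Longrightarrow> w v = hat a v" "L-lipschitz_on UNIV w" "\<And>x. x \<notin> \<Omega> \<Longrightarrow> w x = 0"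
  proof (rule pw_affine_interpolant[of "hat a"])
    show "hat a v = 0" if "v \<in> mesh_vertices T" "v \<notin> \<Omega>" for v
      using hat_spec(3)[OF a that(1)] aM(2) that(2) by metis
  qed blast
  have cw: "continuous_on UNIV w" by (rule lipschitz_on_continuous_on[OF w(3)])
  have eq: "hat a x = w x" if "x \<in> closure \<Omega>" for x
    by (rule pw_affine_unique[OF hat_pw_affine[OF a] _ _ that]) (use w in \<open>auto simp: pw_affine_def\<close>)
  have w_nonneg: "w x \<ge> 0" for x
  proof (cases "x \<in> \<Omega>")
    case True
    then obtain K where K: "K \<in> T" "x \<in> K" using Union_T closure_subset by blast
    have "- c K + (- b K) \<bullet> x \<le> 0"
    proof (rule affine_le_on_extreme_points[OF cell_compact[OF K(1)] cell_convex[OF K(1)] _ K(2)])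
      fix p assume p: "p extreme_point_of K"
      then have "p \<in> K" "p \<in> mesh_vertices T" using K(1) by (auto simp: extreme_point_of_def mesh_vertices_def)
      moreover from this have "hat a p \<ge> 0" using hat_spec(2,3)[OF a] by (cases "p = a") auto
      ultimately show "- c K + (- b K) \<bullet> p \<le> 0" using w(1)[OF K(1)] w(2) by force
    qed
    then show ?thesis using w(1)[OF K] by simp
  qed (simp add: w(4))
  have iw: "integrable lborel w"
    by (rule integrable_lborel_compact_support[OF cw, of "closure \<Omega>"])
      (use bounded_\<Omega> w(4) closure_subset in \<open>auto simp: compact_closure\<close>)
  have "(LINT x|lebesgue_on \<Omega>. hat a x) = (LINT x|lebesgue_on \<Omega>. w x)"
    by (rule Bochner_Integration.integral_cong) (use eq closure_subset in auto)
  also have "\<dots> = (LINT x|lborel. w x)"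
    by (rule integral_supported(1)[OF borel_measurable_continuous_onI[OF cw] w(4)])
  also have "\<dots> > 0"
    by (rule lborel_positive_integral[OF iw w_nonneg cw, of a]) (use w(2)[OF aM(1)] hat_spec(2)[OF a] in simp)
  finally show ?thesis .
qed

text \<open>
  Up to the positive denominator, the nodal functional is the product with the hat function, because
  the cells tile the domain up to the skeleton.
\<close>

lemma node_value_zero_iff:
  assumes v: "v \<in> H1 \<Omega>" and a: "a \<in> nodes"
  shows "node_value \<Omega> T v a = 0 \<longleftrightarrow> wform 1 (h\<^sup>2) v (hat a) = 0"
proof -
  have la: "hat a \<in> H1 \<Omega>" using hat_H10[OF a] H10_H1 by blast
  have "integrable (lebesgue_on \<Omega>) (\<lambda>x. wgrad \<Omega> v x \<bullet> wgrad \<Omega> (hat a) x)"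
    using coefficient_integrable[OF identity_coefficient wgrad_L2[OF v] wgrad_L2[OF la]] by simp
  then have num: "(LINT x|lebesgue_on \<Omega>. v x * hat a x) + h\<^sup>2 * (\<Sum>K\<in>T. LINT x|lebesgue_on K. wgrad \<Omega> v x \<bullet> wgrad \<Omega> (hat a) x)
     = wform 1 (h\<^sup>2) v (hat a)"
    by (simp add: integral_cells wform_def L2_inner_def bilin_def)
  have "(\<Sum>K\<in>T. LINT x|lebesgue_on K. norm (wgrad \<Omega> (hat a) x)) \<ge> 0"
    by (intro sum_nonneg Bochner_Integration.integral_nonneg) auto
  then have "(LINT x|lebesgue_on \<Omega>. hat a x) + h\<^sup>2 * (\<Sum>K\<in>T. LINT x|lebesgue_on K. norm (wgrad \<Omega> (hat a) x)) > 0"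
    using hat_integral_pos[OF a] by (intro add_pos_nonneg) auto
  then show ?thesis
    unfolding node_value_def num by simp
qed

text \<open>
  The kernel of the interpolation is an orthogonal complement: the hat functions take the values
  \<open>0\<close> and \<open>1\<close> at the nodes, so the interpolation vanishes only if all nodal functionals do.
\<close>

lemma Vf_iff: "v \<in> Vf \<Omega> T \<longleftrightarrow> v \<in> H10 \<Omega> \<and> (\<forall>a\<in>nodes. wform 1 (h\<^sup>2) v (hat a) = 0)"
proof (cases "v \<in> H10 \<Omega>")
  case True
  have "(\<forall>x\<in>\<Omega>. interp \<Omega> T v x = 0) \<longleftrightarrow> (\<forall>a\<in>nodes. node_value \<Omega> T v a = 0)"
  proof
    assume *: "\<forall>x\<in>\<Omega>. interp \<Omega> T v x = 0"
    show "\<forall>a\<in>nodes. node_value \<Omega> T v a = 0"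
    proof
      fix a assume a: "a \<in> nodes"
      have "interp \<Omega> T v a = (\<Sum>b\<in>nodes. if b = a then node_value \<Omega> T v a else 0)"
        unfolding interp_def
      proof (rule sum.cong[OF refl])
        fix b assume "b \<in> nodes"
        then show "node_value \<Omega> T v b * hat b a = (if b = a then node_value \<Omega> T v a else 0)"
          using hat_spec(2,3)[of b] a by (auto simp: interior_nodes_def)
      qed
      then show "node_value \<Omega> T v a = 0"
        using * a finite_interior_nodes by (simp add: interior_nodes_def)
    qed
  qed (simp add: interp_def)
  then show ?thesis
    using True node_value_zero_iff[OF H10_H1[OF True]] by (simp add: Vf_def)
qed (simp add: Vf_def)

lemma Vf_H10: "v \<in> Vf \<Omega> T \<Longrightarrow> v \<in> H10 \<Omega>"
  by (simp add: Vf_iff)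

lemma Vf_lincomb:
  assumes "u \<in> Vf \<Omega> T" "v \<in> Vf \<Omega> T"
  shows "(\<lambda>x. s * u x + t * v x) \<in> Vf \<Omega> T"
  unfolding Vf_iff
proof (intro conjI ballI)
  show "(\<lambda>x. s * u x + t * v x) \<in> H10 \<Omega>"
    using assms by (intro H10_lincomb) (auto simp: Vf_iff)
  show "wform 1 (h\<^sup>2) (\<lambda>x. s * u x + t * v x) (hat a) = 0" if "a \<in> nodes" for a
    using wform_lincomb[of u v "hat a" 1 "h\<^sup>2" s t] assms that H10_H1 hat_H10 by (auto simp: Vf_iff)
qed

lemma Vf_sum:
  assumes "\<And>a. a \<in> nodes \<Longrightarrow> \<psi> a \<in> Vf \<Omega> T"
  shows "(\<lambda>x. \<Sum>a\<in>nodes. s a * \<psi> a x) \<in> Vf \<Omega> T"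
  unfolding Vf_iff
proof (intro conjI ballI)
  have H: "\<And>a. a \<in> nodes \<Longrightarrow> \<psi> a \<in> H10 \<Omega>" using assms Vf_H10 by blast
  show "(\<lambda>x. \<Sum>a\<in>nodes. s a * \<psi> a x) \<in> H10 \<Omega>"
    by (rule H10_sum[OF finite_interior_nodes H])
  show "wform 1 (h\<^sup>2) (\<lambda>x. \<Sum>a\<in>nodes. s a * \<psi> a x) (hat b) = 0" if "b \<in> nodes" for b
    using wform_sum[OF finite_interior_nodes H H10_H1[OF hat_H10[OF that]]] assms that
    by (simp add: Vf_iff)
qed

lemma cell_diameter_le: "K \<in> T \<Longrightarrow> diameter K \<le> h"
  unfolding mesh_size_def using finite_T by (intro Max_ge) auto

lemma cell_diameter_pos:
  assumes K: "K \<in> T"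
  shows "diameter K > 0"
proof -
  have "card {a. a extreme_point_of K} > 1" using cell_vertices(2)[OF K] by simp
  then obtain p q where "p extreme_point_of K" "q extreme_point_of K" "p \<noteq> q"
    by (metis (mono_tags, lifting) One_nat_def card_le_Suc0_iff_eq cell_vertices(3)[OF K] mem_Collect_eq not_less)
  then have "p \<in> K" "q \<in> K" "dist p q > 0" by (auto simp: extreme_point_of_def)
  then show ?thesis
    using diameter_bounded_bound[OF compact_imp_bounded[OF cell_compact[OF K]], of p q] by linarith
qed

lemma T_nonempty: "T \<noteq> {}"
  using Union_T ball_\<Omega> r0 closure_subset[of \<Omega>] by (metis Union_empty centre_in_cball empty_iff less_imp_le subsetD)

lemma mesh_size_pos: "h > 0"
proof -
  obtain K where K: "K \<in> T" using T_nonempty by blast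
  then show ?thesis using cell_diameter_pos[OF K] cell_diameter_le[OF K] by linarith
qed

lemma mesh_size_le:
  assumes R: "\<And>x. x \<in> closure \<Omega> \<Longrightarrow> norm (x - x0) \<le> R"
  shows "h \<le> 2 * R"
proof -
  have "diameter K \<le> 2 * R" if K: "K \<in> T" for K
  proof (rule diameter_le)
    show "K \<noteq> {} \<or> 0 \<le> 2 * R" using cell_diameter_pos[OF K] by auto
    show "norm (x - y) \<le> 2 * R" if "x \<in> K" "y \<in> K" for x y
      using R[of x] R[of y] that cell_subset[OF K] norm_triangle_ineq4[of "x - x0" "y - x0"] by force
  qed
  then show ?thesis
    unfolding mesh_size_def using finite_T T_nonempty by (intro Max.boundedI) auto
qed

text \<open>
  The quasi-interpolant takes the averages of the stretched function as nodal values. They vanish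
  at the boundary, so only interior nodes contribute.
\<close>

lemma average_interpolant:
  assumes \<phi>: "\<phi> \<in> test_functions \<Omega>" and R: "\<forall>x\<in>closure \<Omega>. norm (x - x0) \<le> R"
  obtains w c b G where "\<And>K x. K \<in> T \<Longrightarrow> x \<in> K \<Longrightarrow> w x = c K + b K \<bullet> x"
    "\<And>a. a \<in> mesh_vertices T \<Longrightarrow> w a = avg h \<phi> a" "w \<in> H10 \<Omega>" "is_weak_gradient \<Omega> w G"
    "\<And>K x. K \<in> T \<Longrightarrow> x \<in> interior K \<Longrightarrow> G x = b K"
    "\<And>x. x \<in> closure \<Omega> \<Longrightarrow> (\<Sum>a\<in>nodes. avg h \<phi> a * hat a x) = w x"
proof -
  note out = avg_outside[OF \<phi> mesh_size_pos R]
  obtain w c b G L where w: "\<And>K x. K \<in> T \<Longrightarrow> x \<in> K \<Longrightarrow> w x = c K + b K \<bullet> x"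
    "\<And>a. a \<in> mesh_vertices T \<Longrightarrow> w a = avg h \<phi> a" "w \<in> H10 \<Omega>" "is_weak_gradient \<Omega> w G"
    "\<And>K x. K \<in> T \<Longrightarrow> x \<in> interior K \<Longrightarrow> G x = b K"
    "L-lipschitz_on UNIV w" "\<And>x. x \<notin> \<Omega> \<Longrightarrow> w x = 0"
  proof (rule pw_affine_interpolant[of "avg h \<phi>"])
    show "avg h \<phi> a = 0" if "a \<notin> \<Omega>" for a
      by (rule out[OF that])
  qed blast
  have "(\<Sum>a\<in>nodes. avg h \<phi> a * hat a x) = w x" if "x \<in> closure \<Omega>" for x
  proof (rule pw_affine_unique[OF pw_affine_sum[OF finite_interior_nodes hat_pw_affine] _ _ that])
    show "pw_affine w" using w(1) by (auto simp: pw_affine_def)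
    fix a assume a: "a \<in> mesh_vertices T"
    have "(\<Sum>b\<in>nodes. avg h \<phi> b * hat b a) = (\<Sum>b\<in>nodes. if b = a then avg h \<phi> a else 0)"
    proof (rule sum.cong[OF refl])
      fix b assume "b \<in> nodes"
      then show "avg h \<phi> b * hat b a = (if b = a then avg h \<phi> a else 0)"
        using hat_spec(2,3)[of b] a by auto
    qed
    also have "\<dots> = avg h \<phi> a"
    proof (cases "a \<in> nodes")
      case False
      then have "avg h \<phi> a = 0" using a out[of a] by (auto simp: interior_nodes_def)
      then show ?thesis using finite_interior_nodes by simp
    qed (use finite_interior_nodes in simp)
    finally show "(\<Sum>b\<in>nodes. avg h \<phi> b * hat b a) = w a" using w(2)[OF a] by simp
  qed
  from that[OF w(1-5) this] show thesis .
qed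

text \<open>
  Almost every point is interior to one cell, where the estimates on cells apply. The constant depends
  only on the shape regularity and, through \<open>R\<close> and \<open>r0\<close>, on the domain, because \<open>h \<le> 2 * R\<close>.
\<close>

lemma quasi_interpolation:
  assumes R: "\<And>x. x \<in> closure \<Omega> \<Longrightarrow> norm (x - x0) \<le> R"
    and reg: "\<And>K. K \<in> T \<Longrightarrow> diameter K \<le> \<sigma> * ball_diameter K" "\<sigma> > 0"
    and \<phi>: "\<phi> \<in> test_functions \<Omega>"
  defines "Q \<equiv> (1 + 2 * R)\<^sup>2 * ((1 + R + r0) / r0)\<^sup>2"
  defines "v \<equiv> \<lambda>x. \<Sum>a\<in>nodes. avg h \<phi> a * hat a x"
  shows "wform 1 (h\<^sup>2) (\<lambda>x. 1 * \<phi> x + (- 1) * v x) (\<lambda>x. 1 * \<phi> x + (- 1) * v x)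
    \<le> (2 * (R + r0)\<^sup>2 + 2 * Q + 2 + 32 * \<sigma>\<^sup>2 * Q) * h\<^sup>2 * (L2_norm \<Omega> (wgrad \<Omega> \<phi>))\<^sup>2"
proof -
  have radius: "\<forall>x\<in>closure \<Omega>. norm (x - x0) \<le> R" using R by blast
  note ctx = \<phi> mesh_size_pos radius
  define \<mu> where "\<mu> = measure lborel (cball (0::real^2) (h * r0))"
  define E where "E = local_energy \<phi> h R"
  define D where "D = (L2_norm \<Omega> (wgrad \<Omega> \<phi>))\<^sup>2"
  define q where "q = ((1 + R + r0) / r0)\<^sup>2"
  obtain w c b G where w: "\<And>K x. K \<in> T \<Longrightarrow> x \<in> K \<Longrightarrow> w x = c K + b K \<bullet> x"
    "\<And>a. a \<in> mesh_vertices T \<Longrightarrow> w a = avg h \<phi> a" "w \<in> H10 \<Omega>" "is_weak_gradient \<Omega> w G"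
    "\<And>K x. K \<in> T \<Longrightarrow> x \<in> interior K \<Longrightarrow> G x = b K" "\<And>x. x \<in> closure \<Omega> \<Longrightarrow> v x = w x"
    unfolding v_def by (rule average_interpolant[OF \<phi> radius]) blast
  define e where "e x = 1 * \<phi> x + (- 1) * w x" for x
  have eH: "e \<in> H1 \<Omega>"
    unfolding e_def[abs_def] by (intro H1_lincomb test_function_H1 \<phi> H10_H1 w)
  have cell: "ennreal ((w x - avg h \<phi> x)\<^sup>2) \<le> ennreal (h\<^sup>2 * (1 + h)\<^sup>2 / \<mu>) * E x"
    "ennreal ((norm (G x))\<^sup>2) \<le> ennreal (16 * \<sigma>\<^sup>2 * (1 + h)\<^sup>2 / \<mu>) * E x"
    if x: "x \<in> \<Omega>" "x \<notin> skeleton" for x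
  proof -
    obtain K where K: "K \<in> T" "x \<in> interior K"
      using off_skeleton[of x] x closure_subset by blast
    then have xK: "x \<in> K" using interior_subset by blast
    have vert: "c K + b K \<bullet> a = avg h \<phi> a" if "a extreme_point_of K" for a
    proof -
      have "a \<in> K" "a \<in> mesh_vertices T" using that K(1) by (auto simp: extreme_point_of_def mesh_vertices_def)
      then show ?thesis using w(1)[OF K(1), of a] w(2)[of a] by simp
    qed
    note est = cell_estimates[OF ctx cell_compact[OF K(1)] cell_convex[OF K(1)] cell_subset[OF K(1)]
        cell_diameter_le[OF K(1)] cell_diameter_pos[OF K(1)] reg(1)[OF K(1)] reg(2) vert xK]
    show "ennreal ((w x - avg h \<phi> x)\<^sup>2) \<le> ennreal (h\<^sup>2 * (1 + h)\<^sup>2 / \<mu>) * E x"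
      "ennreal ((norm (G x))\<^sup>2) \<le> ennreal (16 * \<sigma>\<^sup>2 * (1 + h)\<^sup>2 / \<mu>) * E x"
      using est w(1)[OF K(1) xK] w(5)[OF K] by (simp_all add: E_def \<mu>_def)
  qed
  have off: "AE x in lebesgue. x \<notin> skeleton"
    using negligible_skeleton by (intro AE_not_in) (simp add: negligible_iff_null_sets)
  have sq2: "ennreal ((norm (s - t))\<^sup>2) \<le> 2 * ennreal ((norm s)\<^sup>2) + 2 * ennreal ((norm t)\<^sup>2)"
    for s t :: "'z::real_normed_vector"
  proof -
    have "(norm (s - t))\<^sup>2 \<le> (norm s + norm t)\<^sup>2"
      by (intro power_mono norm_triangle_ineq4) simp
    also have "\<dots> \<le> 2 * (norm s)\<^sup>2 + 2 * (norm t)\<^sup>2"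
      using zero_le_power2[of "norm s - norm t"] unfolding power2_sum power2_diff by linarith
    finally have "ennreal ((norm (s - t))\<^sup>2) \<le> ennreal (2 * (norm s)\<^sup>2 + 2 * (norm t)\<^sup>2)"
      by (rule ennreal_leI)
    then show ?thesis by (simp add: ennreal_mult)
  qed
  have D0: "D \<ge> 0" by (simp add: D_def)
  have dir: "(\<integral>\<^sup>+x. gsq \<phi> x \<partial>lborel) = ennreal D"
    by (simp add: D_def test_function_energy[OF \<phi>])
  have [measurable]: "\<phi> \<in> borel_measurable borel" "avg h \<phi> \<in> borel_measurable borel" "\<Omega> \<in> sets borel"
    using test_function_measurable[OF ctx] avg_measurable[OF ctx] open_\<Omega> by simp_all
  have hR: "(1 + h)\<^sup>2 * q * D \<le> Q * D"
    using mesh_size_le[OF R] mesh_size_pos D0 unfolding Q_def q_def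
    by (intro mult_right_mono power_mono) auto
  \<comment> \<open>compare both \<open>\<phi>\<close> and \<open>w\<close> with the moving average\<close>
  have ae1: "AE x in lebesgue. x \<in> \<Omega> \<longrightarrow> ennreal ((norm (e x))\<^sup>2)
      \<le> 2 * (indicator \<Omega> x * ennreal ((\<phi> x - avg h \<phi> x)\<^sup>2)) + 2 * (ennreal (h\<^sup>2 * (1 + h)\<^sup>2 / \<mu>) * E x)"
    using off
  proof (eventually_elim, intro impI)
    fix x assume x: "x \<notin> skeleton" "x \<in> \<Omega>"
    have "ennreal ((norm (e x))\<^sup>2) \<le> 2 * ennreal ((\<phi> x - avg h \<phi> x)\<^sup>2) + 2 * ennreal ((w x - avg h \<phi> x)\<^sup>2)"
      using sq2[of "\<phi> x - avg h \<phi> x" "w x - avg h \<phi> x"] by (simp add: e_def)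
    also have "\<dots> \<le> 2 * ennreal ((\<phi> x - avg h \<phi> x)\<^sup>2) + 2 * (ennreal (h\<^sup>2 * (1 + h)\<^sup>2 / \<mu>) * E x)"
      using cell(1)[OF x(2,1)] by (intro add_mono mult_left_mono) auto
    finally show "ennreal ((norm (e x))\<^sup>2)
      \<le> 2 * (indicator \<Omega> x * ennreal ((\<phi> x - avg h \<phi> x)\<^sup>2)) + 2 * (ennreal (h\<^sup>2 * (1 + h)\<^sup>2 / \<mu>) * E x)"
      using x by simp
  qed
  have m1: "(\<lambda>x. indicator \<Omega> x * ennreal ((\<phi> x - avg h \<phi> x)\<^sup>2)) \<in> borel_measurable borel"
    by measurable
  have int1: "(\<integral>\<^sup>+x. indicator \<Omega> x * ennreal ((\<phi> x - avg h \<phi> x)\<^sup>2) \<partial>lborel) \<le> ennreal ((h * (R + r0))\<^sup>2 * D)"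
    using avg_error[OF ctx] D0 unfolding dir by (simp add: ennreal_mult)
  have "(L2_norm \<Omega> e)\<^sup>2 \<le> 2 * ((h * (R + r0))\<^sup>2 * D) + 2 * (h\<^sup>2 * (1 + h)\<^sup>2 * q * D)"
    unfolding q_def D_def
    by (rule L2_norm_le_density[OF ctx H1_L2[OF eH] m1 int1[unfolded D_def] _ _ ae1[unfolded E_def \<mu>_def]])
      simp_all
  also have "\<dots> \<le> 2 * ((h * (R + r0))\<^sup>2 * D) + 2 * (h\<^sup>2 * (Q * D))"
    using mult_left_mono[OF hR, of "h\<^sup>2"] by (simp add: mult.assoc)
  finally have 1: "(L2_norm \<Omega> e)\<^sup>2 \<le> 2 * ((h * (R + r0))\<^sup>2 * D) + 2 * (h\<^sup>2 * (Q * D))" .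
  \<comment> \<open>the gradients of \<open>\<phi>\<close> and \<open>w\<close> are bounded separately\<close>
  have "AE x in lebesgue_on \<Omega>. wgrad \<Omega> e x = 1 *\<^sub>R grad \<phi> x + (- 1) *\<^sub>R G x"
    unfolding e_def[abs_def]
    by (intro wgrad_AE weak_gradient_lincomb test_function_L2 \<phi> H1_L2 H10_H1 w test_function_weak_gradient)
  then have "AE x in lebesgue. x \<in> \<Omega> \<longrightarrow> wgrad \<Omega> e x = grad \<phi> x - G x"
    by (simp add: AE_lebesgue_on_iff)
  then have ae2: "AE x in lebesgue. x \<in> \<Omega> \<longrightarrow> ennreal ((norm (wgrad \<Omega> e x))\<^sup>2)
      \<le> 2 * gsq \<phi> x + 2 * (ennreal (16 * \<sigma>\<^sup>2 * (1 + h)\<^sup>2 / \<mu>) * E x)"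
    using off
  proof (eventually_elim, intro impI)
    fix x assume x: "x \<in> \<Omega> \<longrightarrow> wgrad \<Omega> e x = grad \<phi> x - G x" "x \<notin> skeleton" "x \<in> \<Omega>"
    have "ennreal ((norm (wgrad \<Omega> e x))\<^sup>2) \<le> 2 * gsq \<phi> x + 2 * ennreal ((norm (G x))\<^sup>2)"
      using sq2[of "grad \<phi> x" "G x"] x by (simp add: gsq_def)
    also have "\<dots> \<le> 2 * gsq \<phi> x + 2 * (ennreal (16 * \<sigma>\<^sup>2 * (1 + h)\<^sup>2 / \<mu>) * E x)"
      using cell(2)[OF x(3,2)] by (intro add_mono mult_left_mono) auto
    finally show "ennreal ((norm (wgrad \<Omega> e x))\<^sup>2)
      \<le> 2 * gsq \<phi> x + 2 * (ennreal (16 * \<sigma>\<^sup>2 * (1 + h)\<^sup>2 / \<mu>) * E x)" .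
  qed
  have "(L2_norm \<Omega> (wgrad \<Omega> e))\<^sup>2 \<le> 2 * D + 2 * (16 * \<sigma>\<^sup>2 * (1 + h)\<^sup>2 * q * D)"
    unfolding q_def D_def
    by (rule L2_norm_le_density[OF ctx wgrad_L2[OF eH] gsq_\<phi>_measurable[OF ctx] eq_refl[OF dir[unfolded D_def]] _ _
          ae2[unfolded E_def \<mu>_def]]) simp_all
  also have "\<dots> \<le> 2 * D + 2 * (16 * \<sigma>\<^sup>2 * (Q * D))"
    using mult_left_mono[OF hR, of "16 * \<sigma>\<^sup>2"] by (simp add: mult.assoc)
  finally have 2: "(L2_norm \<Omega> (wgrad \<Omega> e))\<^sup>2 \<le> 2 * D + 2 * (16 * \<sigma>\<^sup>2 * (Q * D))" .
  have "wform 1 (h\<^sup>2) (\<lambda>x. 1 * \<phi> x + (- 1) * v x) (\<lambda>x. 1 * \<phi> x + (- 1) * v x) = wform 1 (h\<^sup>2) e e"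
    by (rule wform_self_cong) (use w(6) closure_subset in \<open>auto simp: e_def\<close>)
  also have "\<dots> = (L2_norm \<Omega> e)\<^sup>2 + h\<^sup>2 * (L2_norm \<Omega> (wgrad \<Omega> e))\<^sup>2"
    by (simp add: wform_self)
  also have "\<dots> \<le> (2 * ((h * (R + r0))\<^sup>2 * D) + 2 * (h\<^sup>2 * (Q * D))) + h\<^sup>2 * (2 * D + 2 * (16 * \<sigma>\<^sup>2 * (Q * D)))"
    using 1 2 by (intro add_mono mult_left_mono) auto
  also have "\<dots> = (2 * (R + r0)\<^sup>2 + 2 * Q + 2 + 32 * \<sigma>\<^sup>2 * Q) * h\<^sup>2 * D"
    unfolding power_mult_distrib by (simp add: distrib_left distrib_right mult_ac)
  finally show ?thesis by (simp add: D_def)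
qed

end

section \<open>The error estimate\<close>

context mesh
begin

text \<open>
  On the kernel of the interpolation the function is orthogonal to the coarse space with respect to
  the weighted product \<open>(u, v) + h\<^sup>2 (\<nabla>u, \<nabla>v)\<close>, so its weighted norm is at most its weighted
  distance to any coarse function.
\<close>

lemma Vf_L2_bound:
  assumes R: "\<And>x. x \<in> closure \<Omega> \<Longrightarrow> norm (x - x0) \<le> R"
    and reg: "\<And>K. K \<in> T \<Longrightarrow> diameter K \<le> \<sigma> * ball_diameter K" "\<sigma> > 0"
    and e: "e \<in> Vf \<Omega> T"
  defines "Q \<equiv> (1 + 2 * R)\<^sup>2 * ((1 + R + r0) / r0)\<^sup>2"
  defines "C \<equiv> 2 * (R + r0)\<^sup>2 + 2 * Q + 2 + 32 * \<sigma>\<^sup>2 * Q"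
  shows "(L2_norm \<Omega> e)\<^sup>2 \<le> 4 * C * h\<^sup>2 * (L2_norm \<Omega> (wgrad \<Omega> e))\<^sup>2"
proof -
  have Q0: "Q \<ge> 0" by (simp add: Q_def)
  then have C0: "C \<ge> 0" by (simp add: C_def)
  have eH: "e \<in> H10 \<Omega>" and orth: "\<And>a. a \<in> nodes \<Longrightarrow> wform 1 (h\<^sup>2) e (hat a) = 0"
    using e by (auto simp: Vf_iff)
  define G where "G = (L2_norm \<Omega> (wgrad \<Omega> e))\<^sup>2"
  have bound: "(L2_norm \<Omega> e)\<^sup>2 \<le> 4 * C * h\<^sup>2 * G + d * (2 + 2 * h\<^sup>2 + 4 * C * h\<^sup>2)" if d: "d > 0" for d
  proof -
    obtain \<phi> where \<phi>: "\<phi> \<in> test_functions \<Omega>" "(L2_norm \<Omega> (\<lambda>x. 1 * e x + (- 1) * \<phi> x))\<^sup>2 \<le> d"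
      "(L2_norm \<Omega> (wgrad \<Omega> (\<lambda>x. 1 * e x + (- 1) * \<phi> x)))\<^sup>2 \<le> d"
      using H10_approx[OF eH d] by blast
    define k where "k x = 1 * e x + (- 1) * \<phi> x" for x
    define v where "v x = (\<Sum>a\<in>nodes. avg h \<phi> a * hat a x)" for x
    define r where "r x = 1 * \<phi> x + (- 1) * v x" for x
    have vH: "v \<in> H10 \<Omega>"
      unfolding v_def[abs_def] by (rule H10_sum[OF finite_interior_nodes hat_H10])
    have H: "e \<in> H1 \<Omega>" "\<phi> \<in> H1 \<Omega>" "v \<in> H1 \<Omega>" "k \<in> H1 \<Omega>" "r \<in> H1 \<Omega>"
      unfolding k_def[abs_def] r_def[abs_def]
      using H10_H1[OF eH] H10_H1[OF vH] test_function_H1[OF \<phi>(1)] by (auto intro!: H1_lincomb[of _ _ 1 "- 1", simplified])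
    have pk: "\<phi> = (\<lambda>x. 1 * e x + (- 1) * k x)" by (auto simp: k_def)
    have kr: "(\<lambda>x. 1 * e x + (- 1) * v x) = (\<lambda>x. 1 * k x + 1 * r x)" by (auto simp: k_def r_def)
    have "wform 1 (h\<^sup>2) v e = 0"
      unfolding v_def[abs_def] using wform_sum[of nodes hat e 1 "h\<^sup>2" "avg h \<phi>", OF finite_interior_nodes hat_H10 H(1)] orth
      by (simp add: wform_commute[of _ _ _ e])
    then have "wform 1 (h\<^sup>2) e e + wform 1 (h\<^sup>2) v v = wform 1 (h\<^sup>2) (\<lambda>x. 1 * e x + (- 1) * v x) (\<lambda>x. 1 * e x + (- 1) * v x)"
      using wform_expand[OF H(1,3), of 1 "h\<^sup>2" 1 "- 1"] by (simp add: wform_commute[of _ _ e v])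
    also have "\<dots> \<le> 2 * 1\<^sup>2 * wform 1 (h\<^sup>2) k k + 2 * 1\<^sup>2 * wform 1 (h\<^sup>2) r r"
      unfolding kr by (rule wform_lincomb_le[OF H(4,5)]) auto
    finally have 1: "wform 1 (h\<^sup>2) e e \<le> 2 * wform 1 (h\<^sup>2) k k + 2 * wform 1 (h\<^sup>2) r r"
      using wform_nonneg[of 1 "h\<^sup>2" v] by simp
    have 2: "wform 1 (h\<^sup>2) k k \<le> d + h\<^sup>2 * d"
      unfolding wform_self mult_1 using \<phi>(2,3) by (intro add_mono mult_left_mono) (auto simp: k_def[abs_def])
    have 3: "wform 1 (h\<^sup>2) r r \<le> C * h\<^sup>2 * (L2_norm \<Omega> (wgrad \<Omega> \<phi>))\<^sup>2"
      unfolding r_def[abs_def] v_def[abs_def] C_def Q_def by (rule quasi_interpolation[OF R reg \<phi>(1)])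
    have "wform 0 1 \<phi> \<phi> \<le> 2 * wform 0 1 e e + 2 * wform 0 1 k k"
      using wform_lincomb_le[OF H(1,4), of 0 1 1 "- 1", folded pk] by simp
    then have "(L2_norm \<Omega> (wgrad \<Omega> \<phi>))\<^sup>2 \<le> 2 * G + 2 * d"
      using \<phi>(3) by (simp add: wform_self G_def k_def[abs_def])
    then have "C * h\<^sup>2 * (L2_norm \<Omega> (wgrad \<Omega> \<phi>))\<^sup>2 \<le> C * h\<^sup>2 * (2 * G + 2 * d)"
      using C0 by (intro mult_left_mono) auto
    with 3 have 4: "wform 1 (h\<^sup>2) r r \<le> C * h\<^sup>2 * (2 * G + 2 * d)"
      by (rule order_trans)
    have "(L2_norm \<Omega> e)\<^sup>2 \<le> wform 1 (h\<^sup>2) e e" by (simp add: wform_self)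
    also note 1
    also have "2 * wform 1 (h\<^sup>2) k k + 2 * wform 1 (h\<^sup>2) r r \<le> 2 * (d + h\<^sup>2 * d) + 2 * (C * h\<^sup>2 * (2 * G + 2 * d))"
      using 2 4 by (intro add_mono mult_left_mono) auto
    also have "\<dots> = 4 * C * h\<^sup>2 * G + d * (2 + 2 * h\<^sup>2 + 4 * C * h\<^sup>2)"
      by (simp add: algebra_simps)
    finally show ?thesis .
  qed
  define K where "K = 2 + 2 * h\<^sup>2 + 4 * C * h\<^sup>2"
  have K: "K > 0" using C0 by (simp add: K_def add_pos_nonneg)
  show ?thesis
    unfolding G_def[symmetric]
  proof (rule field_le_epsilon)
    fix t :: real assume "t > 0"
    then show "(L2_norm \<Omega> e)\<^sup>2 \<le> 4 * C * h\<^sup>2 * G + t"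
      using bound[of "t / K"] K by (simp flip: K_def)
  qed
qed

lemma Vms_H10:
  assumes "\<And>a. a \<in> nodes \<Longrightarrow> \<psi> a \<in> H10 \<Omega>" "v \<in> Vms \<Omega> T \<psi>"
  shows "v \<in> H10 \<Omega>"
proof -
  obtain c where v: "v = (\<lambda>x. \<Sum>a\<in>nodes. c a * (hat a x - \<psi> a x))"
    using assms(2) by (auto simp: Vms_def)
  have "(\<lambda>x. hat a x - \<psi> a x) \<in> H10 \<Omega>" if "a \<in> nodes" for a
    using H10_lincomb[OF hat_H10 assms(1), OF that that, of 1 "- 1"] by simp
  then show ?thesis unfolding v by (rule H10_sum[OF finite_interior_nodes])
qed

text \<open>
  By linearity it is enough to test with the difference of a hat function and its corrector, and there
  orthogonality is the equation that defines the corrector.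
\<close>

lemma Vms_orthogonal_Vf:
  assumes A: "elliptic_coefficient \<Omega> \<alpha> \<beta> A" and cor: "\<And>a. a \<in> nodes \<Longrightarrow> is_corrector \<Omega> A T a (\<psi> a)"
    and v: "v \<in> Vms \<Omega> T \<psi>" and w: "w \<in> Vf \<Omega> T"
  shows "bilin \<Omega> A v w = 0"
proof -
  obtain c where v: "v = (\<lambda>x. \<Sum>a\<in>nodes. c a * (hat a x - \<psi> a x))"
    using v by (auto simp: Vms_def)
  have wH: "w \<in> H1 \<Omega>" using w Vf_H10 H10_H1 by blast
  have \<psi>H: "\<psi> a \<in> H10 \<Omega>" if "a \<in> nodes" for a
    using cor[OF that] Vf_H10 by (simp add: is_corrector_def)
  have dH: "(\<lambda>x. hat a x - \<psi> a x) \<in> H10 \<Omega>" if "a \<in> nodes" for a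
    using H10_lincomb[OF hat_H10 \<psi>H, OF that that, of 1 "- 1"] by simp
  have "bilin \<Omega> A (\<lambda>x. hat a x - \<psi> a x) w = 0" if a: "a \<in> nodes" for a
    using bilin_lincomb[OF A H10_H1[OF hat_H10[OF a]] H10_H1[OF \<psi>H[OF a]] wH, of 1 "- 1"] cor[OF a] w
    by (simp add: is_corrector_def)
  then show ?thesis
    unfolding v using bilin_sum_left[OF A finite_interior_nodes dH wH, of "\<lambda>a. a" c] by simp
qed

text \<open>
  The multiscale Galerkin error lies in the kernel of the interpolation: modulo that kernel every
  function is congruent to a coarse function, hence to a function of the modified coarse space,
  and this function must be the Galerkin solution.
\<close>

lemma galerkin_error_in_Vf:
  assumes A: "elliptic_coefficient \<Omega> \<alpha> \<beta> A" and \<alpha>: "\<alpha> > 0"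
    and cor: "\<And>a. a \<in> nodes \<Longrightarrow> is_corrector \<Omega> A T a (\<psi> a)"
    and u: "galerkin_solution \<Omega> A (H10 \<Omega>) f u"
    and um: "galerkin_solution \<Omega> A (Vms \<Omega> T \<psi>) f um"
  shows "(\<lambda>x. u x - um x) \<in> Vf \<Omega> T"
proof -
  have \<psi>f: "\<psi> a \<in> Vf \<Omega> T" if "a \<in> nodes" for a
    using cor[OF that] by (simp add: is_corrector_def)
  have \<psi>H: "\<psi> a \<in> H10 \<Omega>" if "a \<in> nodes" for a
    using \<psi>f[OF that] Vf_H10 by blast
  have uH: "u \<in> H10 \<Omega>" using u by (simp add: galerkin_solution_def)
  have umV: "um \<in> Vms \<Omega> T \<psi>" using um by (simp add: galerkin_solution_def)
  have umH: "um \<in> H10 \<Omega>" by (rule Vms_H10[OF \<psi>H umV])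
  obtain c where c: "\<And>b. b \<in> nodes \<Longrightarrow> wform 1 (h\<^sup>2) (\<lambda>x. 1 * u x + (- 1) * (\<Sum>a\<in>nodes. c a * hat a x)) (hat b) = 0"
    using projection_exists[OF _ _ finite_interior_nodes hat_H10 uH, of 1 "h\<^sup>2" "\<lambda>a. a"] by auto
  define w where "w x = 1 * u x + (- 1) * (\<Sum>a\<in>nodes. c a * hat a x)" for x
  have w: "w \<in> Vf \<Omega> T"
    unfolding Vf_iff w_def[abs_def] using c
    by (auto intro!: H10_lincomb[of _ _ 1 "- 1", simplified] uH H10_sum[OF finite_interior_nodes hat_H10])
  define vm where "vm x = (\<Sum>a\<in>nodes. c a * (hat a x - \<psi> a x))" for x
  have vmV: "vm \<in> Vms \<Omega> T \<psi>" unfolding vm_def[abs_def] Vms_def by blast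
  define w' where "w' x = 1 * w x + 1 * (\<Sum>a\<in>nodes. c a * \<psi> a x)" for x
  have w': "w' \<in> Vf \<Omega> T"
    unfolding w'_def[abs_def] by (rule Vf_lincomb[OF w Vf_sum[OF \<psi>f]])
  have w'_eq: "w' x = u x - vm x" for x
    by (simp add: w'_def w_def vm_def right_diff_distrib sum_subtractf)
  define z where "z x = 1 * vm x + (- 1) * um x" for x
  have zV: "z \<in> Vms \<Omega> T \<psi>"
  proof -
    obtain s where s: "um = (\<lambda>x. \<Sum>a\<in>nodes. s a * (hat a x - \<psi> a x))"
      using umV by (auto simp: Vms_def)
    have "z = (\<lambda>x. \<Sum>a\<in>nodes. (c a - s a) * (hat a x - \<psi> a x))"
      by (simp add: fun_eq_iff z_def vm_def s left_diff_distrib sum_subtractf)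
    then show ?thesis
      unfolding Vms_def by (intro CollectI exI[of _ "\<lambda>a. c a - s a"] conjI TrueI)
  qed
  have zH: "z \<in> H10 \<Omega>" by (rule Vms_H10[OF \<psi>H zV])
  have H: "u \<in> H1 \<Omega>" "um \<in> H1 \<Omega>" "z \<in> H1 \<Omega>" "w' \<in> H1 \<Omega>"
    using uH umH zH w' Vf_H10 H10_H1 by auto
  define e where "e x = 1 * u x + (- 1) * um x" for x
  have eH: "e \<in> H1 \<Omega>" unfolding e_def[abs_def] by (intro H1_lincomb H)
  have "bilin \<Omega> A e z = bilin \<Omega> A u z - bilin \<Omega> A um z"
    unfolding e_def[abs_def] using bilin_lincomb[OF A H(1,2,3), of 1 "- 1"] by simp
  also have "\<dots> = 0"
    using u um zH zV by (simp add: galerkin_solution_def)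
  finally have ez: "bilin \<Omega> A e z = 0" .
  have "z = (\<lambda>x. 1 * e x + (- 1) * w' x)"
    by (simp add: fun_eq_iff z_def e_def w'_eq)
  then have "bilin \<Omega> A z z = bilin \<Omega> A e z - bilin \<Omega> A w' z"
    using bilin_lincomb[OF A eH H(4,3), of 1 "- 1"] by simp
  also have "bilin \<Omega> A w' z = 0"
    using Vms_orthogonal_Vf[OF A cor zV w'] bilin_commute[OF A, of w' z] by simp
  finally have "bilin \<Omega> A z z = 0" using ez by simp
  then have "\<alpha> * (L2_norm \<Omega> (wgrad \<Omega> z))\<^sup>2 \<le> 0"
    using bilin_coercive[OF A H(3)] by simp
  then have gz: "L2_norm \<Omega> (wgrad \<Omega> z) = 0"
    using \<alpha> by (simp add: mult_le_0_iff)
  then have zz: "wform 1 (h\<^sup>2) z z = 0"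
    using poincare[OF zH] by (simp add: wform_self)
  have "wform 1 (h\<^sup>2) (\<lambda>x. 1 * w' x + 1 * z x) (hat a) = 0" if a: "a \<in> nodes" for a
  proof -
    have aH: "hat a \<in> H1 \<Omega>" using hat_H10[OF a] H10_H1 by blast
    have "wform 1 (h\<^sup>2) z (hat a) = 0"
      using wform_null[OF _ _ aH H(3) zz] by (simp add: wform_commute[of _ _ z])
    then show ?thesis
      using wform_lincomb[OF H(4,3) aH, of 1 "h\<^sup>2" 1 1] w' a by (simp add: Vf_iff)
  qed
  moreover have "(\<lambda>x. 1 * w' x + 1 * z x) \<in> H10 \<Omega>"
    by (intro H10_lincomb zH Vf_H10 w')
  moreover have "(\<lambda>x. u x - um x) = (\<lambda>x. 1 * w' x + 1 * z x)"
    by (simp add: fun_eq_iff z_def w'_eq)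
  ultimately show ?thesis by (simp only: Vf_iff) blast
qed

lemma L2_inner_young:
  assumes "f \<in> L2 \<Omega>" "g \<in> L2 \<Omega>" "t > 0"
  shows "L2_inner \<Omega> f g \<le> t / 2 * (L2_norm \<Omega> f)\<^sup>2 + 1 / (2 * t) * (L2_norm \<Omega> g)\<^sup>2"
proof -
  have "L2_inner \<Omega> f g \<le> (LINT x|lebesgue_on \<Omega>. t / 2 * (norm (f x))\<^sup>2 + 1 / (2 * t) * (norm (g x))\<^sup>2)"
    unfolding L2_inner_def
  proof (rule integral_mono)
    show "f x * g x \<le> t / 2 * (norm (f x))\<^sup>2 + 1 / (2 * t) * (norm (g x))\<^sup>2" for x
    proof -
      have "0 \<le> (t * f x - g x)\<^sup>2 / (2 * t)" using assms(3) by simp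
      also have "\<dots> = t / 2 * (f x)\<^sup>2 + 1 / (2 * t) * (g x)\<^sup>2 - f x * g x"
        using assms(3) by (simp add: power2_eq_square field_simps)
      finally show ?thesis by simp
    qed
  qed (use assms L2_mult_integrable[OF assms(1,2)] in \<open>auto simp: L2_def\<close>)
  also have "\<dots> = t / 2 * (L2_norm \<Omega> f)\<^sup>2 + 1 / (2 * t) * (L2_norm \<Omega> g)\<^sup>2"
    unfolding L2_norm_square using assms by (simp add: L2_def)
  finally show ?thesis .
qed

text \<open>
  The error \<open>e\<close> is orthogonal in the energy to the Galerkin solution, which lies in the modified
  coarse space. So its energy equals \<open>(f, e)\<close>, and the factor \<open>h\<close> comes from the
  \<open>L\<^sup>2\<close> bound on the kernel.
\<close>

lemma galerkin_error_bound:
  assumes A: "elliptic_coefficient \<Omega> \<alpha> \<beta> A" and \<alpha>: "\<alpha> > 0"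
    and cor: "\<And>a. a \<in> nodes \<Longrightarrow> is_corrector \<Omega> A T a (\<psi> a)"
    and f: "f \<in> L2 \<Omega>"
    and u: "galerkin_solution \<Omega> A (H10 \<Omega>) f u"
    and um: "galerkin_solution \<Omega> A (Vms \<Omega> T \<psi>) f um"
    and c: "c > 0" "\<And>e. e \<in> Vf \<Omega> T \<Longrightarrow> (L2_norm \<Omega> e)\<^sup>2 \<le> c * h\<^sup>2 * (L2_norm \<Omega> (wgrad \<Omega> e))\<^sup>2"
    and d: "h \<le> d"
  shows "H1_norm \<Omega> (\<lambda>x. u x - um x) \<le> sqrt ((c * d\<^sup>2 + 1) * c) / \<alpha> * h * L2_norm \<Omega> f"
proof -
  define e where "e x = 1 * u x + (- 1) * um x" for x
  have ee: "(\<lambda>x. u x - um x) = e" by (simp add: e_def fun_eq_iff)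
  have ef: "e \<in> Vf \<Omega> T" using galerkin_error_in_Vf[OF A \<alpha> cor u um] by (simp add: ee)
  have eH: "e \<in> H10 \<Omega>" by (rule Vf_H10[OF ef])
  have umV: "um \<in> Vms \<Omega> T \<psi>" using um by (simp add: galerkin_solution_def)
  have umH: "um \<in> H10 \<Omega>"
    by (rule Vms_H10[OF _ umV]) (use cor Vf_H10 in \<open>auto simp: is_corrector_def\<close>)
  have uH: "u \<in> H10 \<Omega>" using u by (simp add: galerkin_solution_def)
  define G where "G = (L2_norm \<Omega> (wgrad \<Omega> e))\<^sup>2"
  define N where "N = (L2_norm \<Omega> e)\<^sup>2"
  define F where "F = (L2_norm \<Omega> f)\<^sup>2"
  have N: "N \<le> c * h\<^sup>2 * G" using c(2)[OF ef] by (simp add: N_def G_def)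
  have "bilin \<Omega> A e e = bilin \<Omega> A u e - bilin \<Omega> A um e"
    using bilin_lincomb[OF A H10_H1[OF uH] H10_H1[OF umH] H10_H1[OF eH], of 1 "- 1"]
    by (simp add: e_def[abs_def])
  also have "bilin \<Omega> A um e = 0" by (rule Vms_orthogonal_Vf[OF A cor umV ef])
  also have "bilin \<Omega> A u e = L2_inner \<Omega> f e" using u eH by (simp add: galerkin_solution_def)
  finally have "\<alpha> * G \<le> L2_inner \<Omega> f e"
    using bilin_coercive[OF A H10_H1[OF eH]] by (simp add: G_def)
  \<comment> \<open>this weight makes half of the left-hand side absorb the second term\<close>
  define t where "t = c * h\<^sup>2 / \<alpha>"
  have hpos: "h > 0" by (rule mesh_size_pos)
  have t: "t > 0" using c \<alpha> hpos by (simp add: t_def)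
  have "1 / (2 * t) * N \<le> 1 / (2 * t) * (c * h\<^sup>2 * G)"
    using N t by (intro mult_left_mono) auto
  also have "\<dots> = \<alpha> * G / 2"
    using c \<alpha> hpos by (simp add: t_def)
  finally have NG: "1 / (2 * t) * N \<le> \<alpha> * G / 2" .
  note \<open>\<alpha> * G \<le> L2_inner \<Omega> f e\<close>
  also have "L2_inner \<Omega> f e \<le> t / 2 * F + 1 / (2 * t) * N"
    unfolding F_def N_def by (rule L2_inner_young[OF f H1_L2[OF H10_H1[OF eH]] t])
  also have "\<dots> \<le> t / 2 * F + \<alpha> * G / 2" using NG by (rule add_left_mono)
  finally have "\<alpha> * G \<le> t * F" by simp
  then have G: "G \<le> c * h\<^sup>2 / \<alpha>\<^sup>2 * F"
    using \<alpha> by (simp add: t_def field_simps power2_eq_square)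
  have "(H1_norm \<Omega> e)\<^sup>2 = N + G" by (simp add: H1_norm_square wform_self N_def G_def)
  also have "\<dots> \<le> (c * h\<^sup>2 + 1) * G" using N by (simp add: algebra_simps)
  also have "\<dots> \<le> (c * d\<^sup>2 + 1) * (c * h\<^sup>2 / \<alpha>\<^sup>2 * F)"
    using G d hpos c by (intro mult_mono add_mono mult_left_mono power_mono) (auto simp: G_def)
  also have "\<dots> = (sqrt ((c * d\<^sup>2 + 1) * c) / \<alpha> * h * L2_norm \<Omega> f)\<^sup>2"
    using c by (simp add: F_def power_mult_distrib power_divide)
  finally have "(H1_norm \<Omega> e)\<^sup>2 \<le> (sqrt ((c * d\<^sup>2 + 1) * c) / \<alpha> * h * L2_norm \<Omega> f)\<^sup>2" .
  moreover have "0 \<le> sqrt ((c * d\<^sup>2 + 1) * c) / \<alpha> * h * L2_norm \<Omega> f"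
    using \<alpha> hpos c by (intro mult_nonneg_nonneg divide_nonneg_nonneg) (auto simp: L2_norm_def)
  ultimately show ?thesis
    unfolding ee by (rule power2_le_imp_le)
qed

end

lemma ball_diameter_nonneg:
  assumes "bounded K" "K \<noteq> {}"
  shows "ball_diameter K \<ge> 0"
proof -
  obtain k where k: "k \<in> K" using assms(2) by blast
  have "2 * 0 \<le> ball_diameter K"
    unfolding ball_diameter_def
  proof (rule cSup_upper)
    show "2 * 0 \<in> {2 * r |r. 0 \<le> r \<and> (\<exists>c. cball c r \<subseteq> K)}"
      using k by (intro CollectI exI[of _ 0] conjI exI[of _ k]) auto
    show "bdd_above {2 * r |r. 0 \<le> r \<and> (\<exists>c. cball c r \<subseteq> K)}"
    proof (rule bdd_aboveI[of _ "diameter K"])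
      fix y assume "y \<in> {2 * r |r. 0 \<le> r \<and> (\<exists>c. cball c r \<subseteq> K)}"
      then obtain r c where "y = 2 * r" "0 \<le> r" "cball c r \<subseteq> K" by blast
      then show "y \<le> diameter K"
        using diameter_subset[OF _ assms(1), of "cball c r"] by simp
    qed
  qed
  then show ?thesis by simp
qed

theorem theorem2p3:
  fixes \<Omega> :: "(real^2) set"
    and A :: "real^2 \<Rightarrow> real^2^2"
    and \<alpha> \<beta> :: real
    and \<F> :: "(real^2) set set set"
  assumes "convex_polygonal_domain \<Omega>"
    and "\<alpha> > 0" and "\<beta> > 0"
    and "elliptic_coefficient \<Omega> \<alpha> \<beta> A"
    and "regular_family \<Omega> \<F>"
  shows "\<exists>C>0. \<forall>T\<in>\<F>. \<forall>\<phi> f u u\<^sub>m\<^sub>s.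
           (\<forall>a\<in>interior_nodes \<Omega> T. is_corrector \<Omega> A T a (\<phi> a)) \<longrightarrow>
           f \<in> L2 \<Omega> \<longrightarrow>
           galerkin_solution \<Omega> A (H10 \<Omega>) f u \<longrightarrow>
           galerkin_solution \<Omega> A (Vms \<Omega> T \<phi>) f u\<^sub>m\<^sub>s \<longrightarrow>
           H1_norm \<Omega> (\<lambda>x. u x - u\<^sub>m\<^sub>s x) \<le> C * mesh_size T * L2_norm \<Omega> f"
proof -
  have dom: "open \<Omega>" "\<Omega> \<noteq> {}" "bounded \<Omega>" "convex \<Omega>"
    using assms(1) by (auto simp: convex_polygonal_domain_def)
  obtain x0 r0 where x0: "r0 > 0" "cball x0 r0 \<subseteq> \<Omega>"
    using dom(1,2) open_contains_cball by (metis ex_in_conv)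
  interpret convex_domain \<Omega> x0 r0
    by unfold_locales (use dom x0 in auto)
  obtain R where R: "R > 0" "\<And>x. x \<in> closure \<Omega> \<Longrightarrow> norm (x - x0) \<le> R"
    using domain_radius by blast
  obtain \<sigma>0 where tri: "\<And>T. T \<in> \<F> \<Longrightarrow> triangulation_of \<Omega> T"
    and \<sigma>0: "\<And>T K. T \<in> \<F> \<Longrightarrow> K \<in> T \<Longrightarrow> diameter K \<le> \<sigma>0 * ball_diameter K"
    using assms(5) unfolding regular_family_def by blast
  \<comment> \<open>a larger regularity constant is admissible because \<open>ball_diameter\<close> is nonnegative\<close>
  define \<sigma> where "\<sigma> = max \<sigma>0 1"
  define Q where "Q = (1 + 2 * R)\<^sup>2 * ((1 + R + r0) / r0)\<^sup>2"
  define c where "c = 4 * (2 * (R + r0)\<^sup>2 + 2 * Q + 2 + 32 * \<sigma>\<^sup>2 * Q)"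
  have "Q \<ge> 0" by (simp add: Q_def)
  then have c: "c > 0" unfolding c_def by (intro mult_pos_pos add_pos_nonneg add_nonneg_pos) auto
  define C where "C = sqrt ((c * (2 * R)\<^sup>2 + 1) * c) / \<alpha>"
  have "C > 0" unfolding C_def using c assms(2) by (simp add: add_nonneg_pos)
  moreover have "H1_norm \<Omega> (\<lambda>x. u x - um x) \<le> C * mesh_size T * L2_norm \<Omega> f"
    if T: "T \<in> \<F>" and cor: "\<forall>a\<in>interior_nodes \<Omega> T. is_corrector \<Omega> A T a (\<phi> a)" and f: "f \<in> L2 \<Omega>"
      and u: "galerkin_solution \<Omega> A (H10 \<Omega>) f u" and um: "galerkin_solution \<Omega> A (Vms \<Omega> T \<phi>) f um"
    for T \<phi> f u um
  proof -
    interpret mesh \<Omega> x0 r0 T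
      by unfold_locales (rule tri[OF T])
    have reg: "diameter K \<le> \<sigma> * ball_diameter K" if K: "K \<in> T" for K
    proof -
      have "K \<noteq> {}" using cell_diameter_pos[OF K] by auto
      then have "ball_diameter K \<ge> 0"
        by (rule ball_diameter_nonneg[OF compact_imp_bounded[OF cell_compact[OF K]]])
      then have "\<sigma>0 * ball_diameter K \<le> \<sigma> * ball_diameter K"
        by (intro mult_right_mono) (auto simp: \<sigma>_def)
      then show ?thesis using \<sigma>0[OF T K] by linarith
    qed
    have \<sigma>: "\<sigma> > 0" by (simp add: \<sigma>_def)
    have "(L2_norm \<Omega> e)\<^sup>2 \<le> c * (mesh_size T)\<^sup>2 * (L2_norm \<Omega> (wgrad \<Omega> e))\<^sup>2" if "e \<in> Vf \<Omega> T" for e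
      unfolding c_def Q_def by (rule Vf_L2_bound[OF R(2) reg \<sigma> that])
    then show ?thesis
      unfolding C_def
      using galerkin_error_bound[OF assms(4,2) _ f u um c _ mesh_size_le[OF R(2)]] cor by blast
  qed
  ultimately show ?thesis by blast
qed

end
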